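(* Let $n\ge2$, $N>1$, and let $F:(0,R)\to\mathbb{R}$ satisfy the geometric structure conditions. Assume that for some $C>0$ the function $$\varphi(r)\equiv C|F'(r)|^{N}r^{N+1}$$ satisfies $\lim_{r\to0}\varphi(r)=0$. Assume in addition that the geometry $F$ satisfies $$F''(r)\le\left(1+\frac{1-\varepsilon}{N}\right)\frac{|F'(r)|}{r},\qquad r\in(0,r_0),$$ for some $\varepsilon>0$ and $r_0\in(0,R)$. For a positive function $\theta$, say that the $(\Phi_N,\theta)$-Sobolev inequality holds with geometry $F$ if there is a constant $C'$ such that for all sufficiently small $r>0$, $$\left\|T_{B(0,r)}g\right\|_{L^{\Phi_N}(\mu_r)}\le C'\,\theta(r)\,\|g\|_{L^1(\mu_r)}\qquad\text{for all } g\in L^1(\mu_r),$$ with $C'$ independent of $r$ and $g$. Then: 1. the $(\Phi_N,\varphi)$-Sobolev inequality holds with geometry $F$; 2. if $\varphi_{\max}(r)\equiv\sup_{0<s<r_0}\varphi(s)<\infty$ (a finite constant function), then the $(\Phi_N,\varphi_{\max})$-Sobolev inequality holds with geometry $F$; 3. in particular, if for some $\varepsilon>0$ we have $|F'(r)|\le C\left(\frac1r\right)^{1+\frac{1-\varepsilon}{N}}$, then the $(\Phi_N,\varphi_{\max})$-Sobolev inequality holds with geometry $F$ and $\varphi_{\max}(r)\equiv C$ a constant.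
   Context: Geometric structure conditions on $F$ (for some $C\ge1$, $0<\varepsilon<1$, unrelated to the constants above): (1) $\lim_{x\to0^+}F(x)=+\infty$; (2) $F'<0$ and $F''>0$ on $(0,R)$; (3) $\frac1C|F'(r)|\le|F'(x)|\le C|F'(r)|$ for $\frac12r<x<2r<R$; (4) $\frac1{-xF'(x)}$ is increasing on $(0,R)$ and $\le\frac1\varepsilon$ there; (5) $\frac{F''(x)}{-F'(x)}\approx\frac1x$ on $(0,R)$. Put $f(x)=e^{-F(|x|)}$ for $0<|x|<R$, $f(0)=0$. $\Phi_N(t)=t(\ln t)^N$ for $t\ge E_N=e^{2N}$ and $\Phi_N(t)=(\ln E_N)^Nt$ for $0\le t\le E_N$; $\|h\|_{L^\Phi(\mu)}=\inf\{k>0:\int\Phi(|h|/k)d\mu\le1\}$. Write $x=(x_1,\mathbf{x}_2,x_3)\in\mathbb{R}\times\mathbb{R}^{n-2}\times\mathbb{R}$ (for $n=2$ the variable $\mathbf{x}_2$ is absent). $d$ is the control distance with length element $dt^2=dx_1^2+|d\mathbf{x}_2|^2+f(x_1)^{-2}dx_3^2$, $B(x,r)$ are its balls, $|\cdot|$ is Lebesgue measure, and $d\mu_r=dx/|B(0,r)|$ on $B(0,r)$. For $x_1>0$ and $r>0$ (with $x_1+r<R$), $r^*(x_1,r)>0$ is defined by the condition that in the plane with metric $dx^2+f(x)^{-2}dy^2$ there is a unique point $(x_1+r^*,h)$, $r^*,h>0$, of the boundary of the control ball centered at $(x_1,0)$ of radius $r$ at which the geodesic from $(x_1,0)$ has a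 vertical tangent; equivalently $r=\int_{x_1}^{x_1+r^*}\frac{\lambda^*}{\sqrt{(\lambda^* )^2-f(u)^2}}du$ with $\lambda^*=f(x_1+r^* )$. For $x_1,t>0$, $h^*(x_1,t)=\int_{x_1}^{x_1+t}\frac{f(u)^2}{\sqrt{f(x_1+t)^2-f(u)^2}}du$. Given $x$ with $x_1>0$ and $r>0$, let $r_0(x)=r$ and recursively (writing $\rho_0=r$) $\rho_{k+1}=r^*(x_1,\rho_k)$ if $\rho_k\ge\frac1{|F'(x_1)|}$ and $\rho_{k+1}=\frac12\rho_k$ if $\rho_k<\frac1{|F'(x_1)|}$. Set $$\widetilde E(x,\rho_k)=\left\{y:\rho_{k+1}\le y_1-x_1<\rho_k,\ |\mathbf{y}_2-\mathbf{x}_2|<\sqrt{\rho_k^2-\rho_{k+1}^2},\ |y_3-x_3|<h^*(x_1,\rho_k)\right\},\qquad \widetilde\Gamma(x,r)=\bigcup_{k=1}^\infty\widetilde E(x,\rho_k).$$ For $x_1<0$ these objects are defined by reflection in $x_1=0$. With $$\widehat d(x,y)=\min\left\{d(x,y),\frac1{|F'(x_1+d(x,y))|}\right\},\qquad K_{B(0,r)}(x,y)=\frac{\widehat d(x,y)}{|B(x,d(x,y))|}\mathbf{1}_{\widetilde\Gamma(x,r)}(y),$$ the operator is $T_{B(0,r)}g(x)=\int_{B(0,r)}K_{B(0,r)}(x,y)g(y)\,dy$. *)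

theory Defs
  imports "HOL-Analysis.Analysis"
begin

definition geometric_structure :: "real \<Rightarrow> (real \<Rightarrow> real) \<Rightarrow> bool" where
  "geometric_structure R F \<longleftrightarrow>
     (\<forall>x\<in>{0<..<R}. F differentiable (at x) \<and> deriv F differentiable (at x)) \<and>
     filterlim F at_top (at_right 0) \<and>
     (\<forall>x\<in>{0<..<R}. deriv F x < 0 \<and> deriv (deriv F) x > 0) \<and>
     (\<exists>C\<ge>1. \<forall>r x. r / 2 < x \<and> x < 2 * r \<and> 2 * r < R \<longrightarrow>
        1 / C * \<bar>deriv F r\<bar> \<le> \<bar>deriv F x\<bar> \<and> \<bar>deriv F x\<bar> \<le> C * \<bar>deriv F r\<bar>) \<and>
     mono_on {0<..<R} (\<lambda>x. 1 / (- x * deriv F x)) \<and>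
     (\<exists>\<epsilon>. 0 < \<epsilon> \<and> \<epsilon> < 1 \<and> (\<forall>x\<in>{0<..<R}. 1 / (- x * deriv F x) \<le> 1 / \<epsilon>)) \<and>
     (\<exists>C\<ge>1. \<forall>x\<in>{0<..<R}.
        1 / C * (1 / x) \<le> deriv (deriv F) x / (- deriv F x) \<and>
        deriv (deriv F) x / (- deriv F x) \<le> C * (1 / x))"

definition geom_f :: "(real \<Rightarrow> real) \<Rightarrow> real \<Rightarrow> real" where
  "geom_f F x = (if x = 0 then 0 else exp (- F \<bar>x\<bar>))"

text \<open>
  Points of \<open>n\<close>-space are vectors \<open>x :: real^'n\<close> with two distinct distinguished indices
  \<open>i1\<close>, \<open>i3\<close>; the scalar variables \<open>x\<^sub>1\<close>, \<open>x\<^sub>3\<close> are \<open>x $ i1\<close>, \<open>x $ i3\<close>, and the vector variable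
  \<open>x\<^sub>2\<close> collects the other \<open>n - 2\<close> components. For \<open>n = 2\<close> there are none, and
  \<open>mid_norm\<close> is \<open>0\<close>. Everything lives in the strip \<open>\<bar>x\<^sub>1\<bar> < R\<close>, where \<open>geom_f F\<close> is meaningful.
\<close>

definition mid_norm :: "'n \<Rightarrow> 'n \<Rightarrow> real^'n \<Rightarrow> real" where
  "mid_norm i1 i3 v = sqrt (\<Sum>i\<in>UNIV - {i1, i3}. (v $ i)\<^sup>2)"

text \<open>
  On the degenerate hyperplane \<open>x\<^sub>1 = 0\<close> the coefficient \<open>f\<^sup>-\<^sup>2\<close> is infinite, so a velocity with
  nonzero third component has infinite length there (with zero third component, the last summand
  below is \<open>0 / 0 = 0\<close>).
\<close>

definition length_element ::
    "(real \<Rightarrow> real) \<Rightarrow> 'n::finite \<Rightarrow> 'n \<Rightarrow> real^'n \<Rightarrow> real^'n \<Rightarrow> ennreal" where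
  "length_element F i1 i3 p v =
     (if geom_f F (p $ i1) = 0 \<and> v $ i3 \<noteq> 0 then \<infinity>
      else ennreal (sqrt ((v $ i1)\<^sup>2 + (mid_norm i1 i3 v)\<^sup>2 + (v $ i3)\<^sup>2 / (geom_f F (p $ i1))\<^sup>2)))"

definition curve_length ::
    "(real \<Rightarrow> real) \<Rightarrow> 'n::finite \<Rightarrow> 'n \<Rightarrow> (real \<Rightarrow> real^'n) \<Rightarrow> ennreal" where
  "curve_length F i1 i3 \<gamma> =
     (\<integral>\<^sup>+t\<in>{0..1}. length_element F i1 i3 (\<gamma> t) (vector_derivative \<gamma> (at t)) \<partial>lborel)"

definition control_dist ::
    "(real \<Rightarrow> real) \<Rightarrow> real \<Rightarrow> 'n::finite \<Rightarrow> 'n \<Rightarrow> real^'n \<Rightarrow> real^'n \<Rightarrow> ennreal" where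
  "control_dist F R i1 i3 x y =
     (INF \<gamma>\<in>{\<gamma>. valid_path \<gamma> \<and> pathstart \<gamma> = x \<and> pathfinish \<gamma> = y \<and>
               (\<forall>p\<in>path_image \<gamma>. \<bar>p $ i1\<bar> < R)}. curve_length F i1 i3 \<gamma>)"

definition control_ball ::
    "(real \<Rightarrow> real) \<Rightarrow> real \<Rightarrow> 'n::finite \<Rightarrow> 'n \<Rightarrow> real^'n \<Rightarrow> real \<Rightarrow> (real^'n) set" where
  "control_ball F R i1 i3 x r = {y. control_dist F R i1 i3 x y < ennreal r}"

definition ball_measure ::
    "(real \<Rightarrow> real) \<Rightarrow> real \<Rightarrow> 'n::finite \<Rightarrow> 'n \<Rightarrow> real \<Rightarrow> (real^'n) measure" where
  "ball_measure F R i1 i3 r = uniform_measure lebesgue (control_ball F R i1 i3 0 r)"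

definition r_star :: "(real \<Rightarrow> real) \<Rightarrow> real \<Rightarrow> real \<Rightarrow> real \<Rightarrow> real" where
  "r_star F R x1 r = (THE s. 0 < s \<and> x1 + s < R \<and>
     ((\<lambda>u. geom_f F (x1 + s) / sqrt ((geom_f F (x1 + s))\<^sup>2 - (geom_f F u)\<^sup>2)) has_integral r)
       {x1..x1 + s})"

definition h_star :: "(real \<Rightarrow> real) \<Rightarrow> real \<Rightarrow> real \<Rightarrow> real" where
  "h_star F x1 t = integral {x1..x1 + t}
     (\<lambda>u. (geom_f F u)\<^sup>2 / sqrt ((geom_f F (x1 + t))\<^sup>2 - (geom_f F u)\<^sup>2))"

definition next_radius :: "(real \<Rightarrow> real) \<Rightarrow> real \<Rightarrow> real \<Rightarrow> real \<Rightarrow> real" where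
  "next_radius F R x1 \<rho> =
     (if \<rho> \<ge> 1 / \<bar>deriv F x1\<bar> then r_star F R x1 \<rho> else \<rho> / 2)"

definition radius_seq :: "(real \<Rightarrow> real) \<Rightarrow> real \<Rightarrow> real \<Rightarrow> real \<Rightarrow> nat \<Rightarrow> real" where
  "radius_seq F R x1 r k = (next_radius F R x1 ^^ k) r"

definition E_tilde ::
    "(real \<Rightarrow> real) \<Rightarrow> real \<Rightarrow> 'n::finite \<Rightarrow> 'n \<Rightarrow> real^'n \<Rightarrow> real \<Rightarrow> (real^'n) set" where
  "E_tilde F R i1 i3 x \<rho> =
     {y. next_radius F R (x $ i1) \<rho> \<le> y $ i1 - x $ i1 \<and> y $ i1 - x $ i1 < \<rho> \<and>
         mid_norm i1 i3 (y - x) < sqrt (\<rho>\<^sup>2 - (next_radius F R (x $ i1) \<rho>)\<^sup>2) \<and>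
         \<bar>y $ i3 - x $ i3\<bar> < h_star F (x $ i1) \<rho>}"

definition Gamma_pos ::
    "(real \<Rightarrow> real) \<Rightarrow> real \<Rightarrow> 'n::finite \<Rightarrow> 'n \<Rightarrow> real^'n \<Rightarrow> real \<Rightarrow> (real^'n) set" where
  "Gamma_pos F R i1 i3 x r = (\<Union>k\<in>{1..}. E_tilde F R i1 i3 x (radius_seq F R (x $ i1) r k))"

definition reflect :: "'n \<Rightarrow> real^'n \<Rightarrow> real^'n" where
  "reflect i1 x = (\<chi> i. if i = i1 then - (x $ i) else x $ i)"

text \<open>The value on the null set \<open>x\<^sub>1 = 0\<close> is immaterial.\<close>

definition Gamma_tilde ::
    "(real \<Rightarrow> real) \<Rightarrow> real \<Rightarrow> 'n::finite \<Rightarrow> 'n \<Rightarrow> real^'n \<Rightarrow> real \<Rightarrow> (real^'n) set" where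
  "Gamma_tilde F R i1 i3 x r =
     (if x $ i1 > 0 then Gamma_pos F R i1 i3 x r
      else if x $ i1 < 0 then {y. reflect i1 y \<in> Gamma_pos F R i1 i3 (reflect i1 x) r}
      else {})"

text \<open>
  The absolute value \<open>\<bar>x\<^sub>1\<bar>\<close> extends the formula for \<open>x\<^sub>1 > 0\<close> by reflection in \<open>x\<^sub>1 = 0\<close>.
\<close>

definition d_hat ::
    "(real \<Rightarrow> real) \<Rightarrow> real \<Rightarrow> 'n::finite \<Rightarrow> 'n \<Rightarrow> real^'n \<Rightarrow> real^'n \<Rightarrow> real" where
  "d_hat F R i1 i3 x y =
     (let d = enn2real (control_dist F R i1 i3 x y)
      in min d (1 / \<bar>deriv F (\<bar>x $ i1\<bar> + d)\<bar>))"

definition kernel ::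
    "(real \<Rightarrow> real) \<Rightarrow> real \<Rightarrow> 'n::finite \<Rightarrow> 'n \<Rightarrow> real \<Rightarrow> real^'n \<Rightarrow> real^'n \<Rightarrow> real" where
  "kernel F R i1 i3 r x y =
     d_hat F R i1 i3 x y /
       measure lebesgue (control_ball F R i1 i3 x (enn2real (control_dist F R i1 i3 x y))) *
     indicator (Gamma_tilde F R i1 i3 x r) y"

definition T_op ::
    "(real \<Rightarrow> real) \<Rightarrow> real \<Rightarrow> 'n::finite \<Rightarrow> 'n \<Rightarrow> real \<Rightarrow> (real^'n \<Rightarrow> real) \<Rightarrow> real^'n \<Rightarrow> real" where
  "T_op F R i1 i3 r g x =
     (LINT y:control_ball F R i1 i3 0 r|lebesgue. kernel F R i1 i3 r x y * g y)"

definition Phi :: "real \<Rightarrow> real \<Rightarrow> real" where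
  "Phi N t = (if t \<ge> exp (2 * N) then t * (ln t) powr N else (ln (exp (2 * N))) powr N * t)"

definition luxemburg_norm :: "(real \<Rightarrow> real) \<Rightarrow> 'a measure \<Rightarrow> ('a \<Rightarrow> real) \<Rightarrow> ennreal" where
  "luxemburg_norm \<Phi> \<mu> h =
     Inf {ennreal k | k. k > 0 \<and> (\<integral>\<^sup>+x. ennreal (\<Phi> (\<bar>h x\<bar> / k)) \<partial>\<mu>) \<le> 1}"

text \<open>
  The Bochner integral of a non-integrable function is \<open>0\<close> and \<open>nn_integral\<close> of a non-measurable
  one is only a lower integral, so the inequality proper is accompanied by the assertion that
  \<open>T g\<close> is defined almost everywhere and measurable.
\<close>

definition sobolev_inequality ::
    "(real \<Rightarrow> real) \<Rightarrow> real \<Rightarrow> 'n::finite \<Rightarrow> 'n \<Rightarrow> real \<Rightarrow> (real \<Rightarrow> real) \<Rightarrow> bool" where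
  "sobolev_inequality F R i1 i3 N \<theta> \<longleftrightarrow>
     (\<exists>C'>0. \<forall>\<^sub>F r in at_right 0. \<forall>g. integrable (ball_measure F R i1 i3 r) g \<longrightarrow>
        (AE x in ball_measure F R i1 i3 r.
           set_integrable lebesgue (control_ball F R i1 i3 0 r)
             (\<lambda>y. kernel F R i1 i3 r x y * g y)) \<and>
        T_op F R i1 i3 r g \<in> borel_measurable (ball_measure F R i1 i3 r) \<and>
        luxemburg_norm (Phi N) (ball_measure F R i1 i3 r) (T_op F R i1 i3 r g)
          \<le> ennreal (C' * \<theta> r * (LINT x|ball_measure F R i1 i3 r. \<bar>g x\<bar>)))"

end

theory Submission
  imports Defs
begin

text \<open>
  Write \<open>p = \<bar>F'\<bar>\<close>, \<open>f = exp (- F)\<close> and \<open>t = \<bar>y\<^sub>1\<bar> - \<bar>x\<^sub>1\<bar>\<close>. By Tonelli and a convexity argument,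
  the inequality with \<open>\<theta> = \<phi>\<close> follows once \<open>\<integral> \<Phi>\<^sub>N (K(x, y) |B| / (c \<phi>(r))) dx \<le> |B|\<close> over \<open>B = B(0, r)\<close> for
  every \<open>y \<in> B\<close>. As \<open>\<Phi>\<^sub>N(s) = s max(2N, ln s)\<^sup>N\<close>, this needs two bounds. First, explicit
  paths bound the volume of \<open>B(x, d)\<close> from below, so \<open>K\<close> is at most a decreasing function of \<open>d\<close>,
  and \<open>\<integral> K dx\<^sub>2 dx\<^sub>3\<close> over a section of the cone is \<open>O((r / t)\<^sup>\<delta>)\<close> for each \<open>\<delta> > 0\<close>. Second, the
  bound on \<open>F''\<close> says that \<open>p(u) u\<^sup>1\<^sup>+\<^sup>a\<close> is nondecreasing with \<open>a = (1 - \<epsilon>) / N\<close>, whence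
  \<open>F(y\<^sub>1) - F(r)\<close>, and with it the logarithm of \<open>K |B| / \<phi>\<close>, is \<open>O(r p(r) (r / t)\<^sup>a)\<close>. Since \<open>a N < 1\<close>, the
  remaining integral \<open>\<integral> (r / t)\<^sup>a\<^sup>N\<^sup>+\<^sup>\<delta> dt\<close> is \<open>O(r)\<close>, and the total is \<open>O(r (r p(r))\<^sup>N) = O(\<phi>(r))\<close>. The other
  two inequalities follow by comparing \<open>\<theta>\<close> with \<open>\<phi>\<close>.
\<close>

section \<open>Orlicz bounds for kernel operators\<close>

text \<open>The integration runs over x with y fixed, so every estimate is phrased through
  \<open>y_1\<close> and the gap t. The sections of the cone and the volume bound then contain the
  same quantities \<open>f(y_1)\<close>, \<open>p(y_1)\<close> and min(t, 1 / p(y_1)). In the n - 2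
  middle directions these cancel up to a constant. In the vertical direction they do not: near its
  vertex the cone may be much higher than a ball of radius t, and its high points are really farther
  away than t. Geodesics are never constructed. The cone is given by \<open>r_star\<close> and
  \<open>h_star\<close>, a definite description and an integral with a singular endpoint, so the
  radii must be shown to exist, to be comparable from one cell to the next and to depend measurably
  on \<open>x_1\<close>. For the control distance, broken lines give the upper bounds and the growth
  of single coordinates along a path gives the lower ones. Doubling of p also comes from the bound
  on F'': since a < 1, p(u) is at most (v / u)^2 p(v) for u < v. Together with the monotonicity of p
  this lets values of f and p be moved by lengths up to 1 / p at the cost of constants.\<close>

lemma Phi_eq:
  assumes "0 \<le> t" "0 < N"
  shows "Phi N t = t * max (2 * N) (ln t) powr N"
proof (cases "t = 0")
  case False
  then have "exp (2 * N) \<le> t \<longleftrightarrow> 2 * N \<le> ln t"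
    using assms ln_ge_iff[of t "2 * N"] by simp
  then show ?thesis by (auto simp: Phi_def max_def)
qed (simp add: Phi_def)

lemma Phi_nonneg: "0 \<le> t \<Longrightarrow> 0 < N \<Longrightarrow> 0 \<le> Phi N t"
  by (simp add: Phi_eq)

lemma Phi_weight_mono:
  fixes s t N :: real
  assumes "0 < s" "s \<le> t" "0 < N"
  shows "max (2 * N) (ln s) powr N \<le> max (2 * N) (ln t) powr N"
proof -
  have "ln s \<le> ln t" using assms by simp
  then show ?thesis using assms by (intro powr_mono2 max.mono) auto
qed

lemma Phi_mono:
  assumes "0 \<le> s" "s \<le> t" "0 < N"
  shows "Phi N s \<le> Phi N t"
proof (cases "s = 0")
  case True then show ?thesis using assms Phi_nonneg[of t N] by (simp add: Phi_eq)
next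
  case False then show ?thesis
    using assms Phi_weight_mono[of s t N] by (auto simp: Phi_eq intro!: mult_mono)
qed

text \<open>Makes a bound on the integral of \<open>Phi N\<close> of the kernel serve as an L1 bound
  as well, so that finiteness of \<open>T g\<close> needs no separate estimate.\<close>

lemma Phi_ge_self:
  assumes "0 \<le> t" "1 \<le> N"
  shows "t \<le> Phi N t"
proof -
  have "1 \<le> max (2 * N) (ln t) powr N"
    using assms by (intro ge_one_powr_ge_zero) auto
  then show ?thesis using assms by (simp add: Phi_eq mult_le_cancel_left1)
qed

text \<open>Takes the place of Jensen's inequality: integrating in \<open>X\<close> over a probability measure with
  mean \<open>2 * m\<close> gives \<open>Phi N m\<close> as a lower bound, so the norm estimate only loses a factor \<open>2\<close>.\<close>

lemma Phi_ge_line: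
  assumes "0 \<le> X" "0 < m" "0 < N"
  shows "Phi N m / m * (X - m) \<le> Phi N X"
proof (cases "m \<le> X")
  case True
  have "Phi N m / m * (X - m) \<le> max (2 * N) (ln m) powr N * X"
    using assms by (simp add: Phi_eq mult_left_mono)
  also have "\<dots> \<le> max (2 * N) (ln X) powr N * X"
    using assms True by (intro mult_right_mono Phi_weight_mono) auto
  finally show ?thesis using assms by (simp add: Phi_eq mult.commute)
next
  case False
  then have "Phi N m / m * (X - m) \<le> 0"
    using assms by (intro mult_nonneg_nonpos) (auto simp: Phi_nonneg)
  then show ?thesis using Phi_nonneg[of X N] assms by linarith
qed

lemma borel_measurable_Phi [measurable]: "Phi N \<in> borel_measurable borel"
  unfolding Phi_def by measurable

text \<open>For fixed x, the variable \<open>k x y * v / \<omega>\<close>, with v the volume of B,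
  is averaged over y in B against |g| normalised to mass 1. \<open>Phi_ge_line\<close> at half the
  mean bounds this average of \<open>Phi N\<close> from below by its value at that half. Integrating
  in x and exchanging the integrals then reduces the norm estimate to \<open>bound\<close>, used for
  one y at a time.\<close>

lemma kernel_orlicz_bound:
  fixes B :: "'a::euclidean_space set" and k :: "'a \<Rightarrow> 'a \<Rightarrow> real"
  assumes B[measurable]: "B \<in> sets borel" and Bpos: "0 < emeasure lborel B" and Bfin: "emeasure lborel B < \<infinity>"
    and kmeas: "(\<lambda>(x, y). indicator B y * k x y) \<in> borel_measurable borel"
    and knn: "\<And>x y. 0 \<le> k x y"
    and N: "1 \<le> N" and \<omega>: "0 < \<omega>"
    and bound: "\<And>y. y \<in> B \<Longrightarrow>
      (\<integral>\<^sup>+x. ennreal (Phi N (k x y * measure lborel B / \<omega>)) * indicator B x \<partial>lborel) \<le> emeasure lborel B"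
    and g: "integrable (uniform_measure lebesgue B) g"
  defines "T \<equiv> \<lambda>x. LINT y:B|lebesgue. k x y * g y"
  shows "AE x in uniform_measure lebesgue B. set_integrable lebesgue B (\<lambda>y. k x y * g y)"
    and "T \<in> borel_measurable (uniform_measure lebesgue B)"
    and "luxemburg_norm (Phi N) (uniform_measure lebesgue B) T
          \<le> ennreal (2 * \<omega> * (LINT x|uniform_measure lebesgue B. \<bar>g x\<bar>))"
proof -
  let ?\<mu> = "uniform_measure lebesgue B"
  define v where "v = measure lborel B"
  have v1: "emeasure lborel B = ennreal v"
    unfolding v_def using Bfin by (intro emeasure_eq_ennreal_measure) auto
  have "0 < v"
    using Bpos unfolding v1 by simp
  note v = v1 this
  have vl: "emeasure lebesgue B = ennreal v"
    using v by simp
  have gm[measurable]: "g \<in> borel_measurable lebesgue"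
    using borel_measurable_integrable[OF g] by simp
  \<comment> \<open>Tonelli is applied to Borel functions on \<open>lborel\<close>; g is only
    Lebesgue measurable and is replaced by an almost everywhere equal Borel function.\<close>
  obtain g' where g'[measurable]: "g' \<in> borel_measurable lborel" and gg: "AE x in lborel. g x = g' x"
    using completion_ex_borel_measurable_real[OF gm] by auto
  have ggl: "AE x in lebesgue. g x = g' x"
    using gg by (rule AE_completion)
  have g'l[measurable]: "g' \<in> borel_measurable lebesgue"
    using g' by (rule measurable_completion)
  have Bl[measurable]: "B \<in> sets lebesgue" by simp
  define \<kappa> where "\<kappa> x y = indicator B y * k x y" for x y
  have \<kappa>nn: "0 \<le> \<kappa> x y" for x y using knn by (simp add: \<kappa>_def)
  have [measurable]: "(\<lambda>(x, y). \<kappa> x y) \<in> borel_measurable (borel \<Otimes>\<^sub>M borel)"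
    using kmeas by (simp add: \<kappa>_def borel_prod)
  have \<kappa>x: "\<kappa> x \<in> borel_measurable borel" for x
    by measurable
  have \<kappa>l: "\<kappa> x \<in> borel_measurable lebesgue" for x
    by (rule measurable_completion) (use \<kappa>x in simp)
  define W where "W y = ennreal (indicator B y * \<bar>g' y\<bar>)" for y
  have Wm[measurable]: "W \<in> borel_measurable borel"
    unfolding W_def by measurable
  have gint: "(\<integral>\<^sup>+y. ennreal \<bar>g y\<bar> \<partial>?\<mu>) = (\<integral>\<^sup>+y. W y \<partial>lborel) / ennreal v"
  proof -
    have "(\<integral>\<^sup>+y. ennreal \<bar>g y\<bar> \<partial>?\<mu>) = (\<integral>\<^sup>+y. ennreal \<bar>g y\<bar> * indicator B y \<partial>lebesgue) / ennreal v"
      by (subst nn_integral_uniform_measure) (auto simp: vl)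
    also have "(\<integral>\<^sup>+y. ennreal \<bar>g y\<bar> * indicator B y \<partial>lebesgue) = (\<integral>\<^sup>+y. W y \<partial>lebesgue)"
      by (intro nn_integral_cong_AE eventually_mono[OF ggl]) (auto simp: W_def indicator_def)
    finally show ?thesis by (simp add: nn_integral_completion)
  qed
  have "(\<integral>\<^sup>+y. ennreal \<bar>g y\<bar> \<partial>?\<mu>) < \<infinity>"
    using g by (simp add: integrable_iff_bounded)
  then have Wfin: "(\<integral>\<^sup>+y. W y \<partial>lborel) < \<infinity>"
    using v(2) unfolding gint by (auto simp: ennreal_divide_eq_top_iff less_top[symmetric])
  define A where "A = enn2real (\<integral>\<^sup>+y. W y \<partial>lborel)"
  have A: "(\<integral>\<^sup>+y. W y \<partial>lborel) = ennreal A" "0 \<le> A"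
    using Wfin by (auto simp: A_def less_top)
  have gA: "(LINT y|?\<mu>. \<bar>g y\<bar>) = A / v"
    using borel_measurable_integrable[OF g] v A
    by (subst integral_eq_nn_integral) (auto simp: gint divide_ennreal)
  \<comment> \<open>By \<open>Phi_ge_self\<close> the hypothesis also controls the L1 norm of the
    kernel in x. As W has finite mass, u is then finite almost everywhere on B, which is what
    integrability in y needs.\<close>
  have \<kappa>_le: "(\<integral>\<^sup>+x. ennreal (\<kappa> x y) * indicator B x \<partial>lborel) \<le> ennreal \<omega>" for y
  proof (cases "y \<in> B")
    case True
    have "(\<integral>\<^sup>+x. ennreal (v / \<omega>) * (ennreal (\<kappa> x y) * indicator B x) \<partial>lborel)
        \<le> (\<integral>\<^sup>+x. ennreal (Phi N (k x y * measure lborel B / \<omega>)) * indicator B x \<partial>lborel)"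
    proof (intro nn_integral_mono)
      fix x
      have "v / \<omega> * \<kappa> x y \<le> Phi N (k x y * v / \<omega>)"
        using True Phi_ge_self[of "k x y * v / \<omega>" N] N knn[of x y] v(2) \<omega> by (simp add: \<kappa>_def mult_ac)
      then show "ennreal (v / \<omega>) * (ennreal (\<kappa> x y) * indicator B x)
          \<le> ennreal (Phi N (k x y * measure lborel B / \<omega>)) * indicator B x"
        using v \<omega> \<kappa>nn by (auto simp: indicator_def ennreal_mult[symmetric] v_def[symmetric] intro: ennreal_leI)
    qed
    also have "\<dots> \<le> ennreal v" using bound[OF True] v by simp
    finally have *: "ennreal (v / \<omega>) * (\<integral>\<^sup>+x. ennreal (\<kappa> x y) * indicator B x \<partial>lborel) \<le> ennreal v"
      by (subst (asm) nn_integral_cmult) measurable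
    have "(\<integral>\<^sup>+x. ennreal (\<kappa> x y) * indicator B x \<partial>lborel)
        = ennreal (\<omega> / v) * (ennreal (v / \<omega>) * (\<integral>\<^sup>+x. ennreal (\<kappa> x y) * indicator B x \<partial>lborel))"
      using v \<omega> by (simp add: mult.assoc[symmetric] ennreal_mult[symmetric])
    also have "\<dots> \<le> ennreal (\<omega> / v) * ennreal v" by (intro mult_left_mono *) auto
    finally show ?thesis using v \<omega> by (simp add: ennreal_mult[symmetric])
  next
    case False then show ?thesis by (simp add: \<kappa>_def)
  qed
  define u where "u x = (\<integral>\<^sup>+y. ennreal (\<kappa> x y) * W y \<partial>lborel)" for x
  have um[measurable]: "u \<in> borel_measurable borel" unfolding u_def by measurable
  have "(\<integral>\<^sup>+x. u x * indicator B x \<partial>lborel) = (\<integral>\<^sup>+x. (\<integral>\<^sup>+y. ennreal (\<kappa> x y) * W y * indicator B x \<partial>lborel) \<partial>lborel)"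
    unfolding u_def by (intro nn_integral_cong nn_integral_multc[symmetric]) measurable
  also have "\<dots> = (\<integral>\<^sup>+y. (\<integral>\<^sup>+x. ennreal (\<kappa> x y) * W y * indicator B x \<partial>lborel) \<partial>lborel)"
    by (rule lborel_pair.Fubini'[symmetric]) measurable
  also have "\<dots> = (\<integral>\<^sup>+y. W y * (\<integral>\<^sup>+x. ennreal (\<kappa> x y) * indicator B x \<partial>lborel) \<partial>lborel)"
    by (intro nn_integral_cong, subst nn_integral_cmult[symmetric])
       (measurable, auto intro!: nn_integral_cong simp: mult_ac)
  also have "\<dots> \<le> (\<integral>\<^sup>+y. W y * ennreal \<omega> \<partial>lborel)"
    by (intro nn_integral_mono mult_left_mono \<kappa>_le) auto
  also have "\<dots> < \<infinity>"
    using Wfin by (subst nn_integral_multc) (auto simp: ennreal_mult_less_top)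
  finally have "AE x in lborel. u x * indicator B x \<noteq> \<infinity>"
    by (intro nn_integral_PInf_AE) auto
  then have ufin: "AE x in lborel. x \<in> B \<longrightarrow> u x < \<infinity>"
    by eventually_elim (auto simp: less_top)
  have T_eq: "T x = (LINT y|lborel. \<kappa> x y * g' y)" for x
  proof -
    have m: "(\<lambda>y. \<kappa> x y * g' y) \<in> borel_measurable lborel" using \<kappa>x[of x] by measurable
    have m2: "(\<lambda>y. \<kappa> x y * g y) \<in> borel_measurable lebesgue"
      by (intro borel_measurable_times \<kappa>l gm)
    have "T x = (LINT y|lebesgue. \<kappa> x y * g y)"
      unfolding T_def set_lebesgue_integral_def \<kappa>_def by (simp add: mult.assoc)
    also have "\<dots> = (LINT y|lebesgue. \<kappa> x y * g' y)"
      by (intro integral_cong_AE m2 measurable_completion[OF m]) (rule eventually_mono[OF ggl], simp)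
    finally show ?thesis using integral_completion[OF m] by simp
  qed
  have Tb[measurable]: "T \<in> borel_measurable borel"
    unfolding T_eq by measurable
  have Tl[measurable]: "T \<in> borel_measurable lebesgue"
    by (rule measurable_completion) simp
  show "T \<in> borel_measurable ?\<mu>"
    using Tl by simp
  have norm_eq: "ennreal (norm (\<kappa> x y * g' y)) = ennreal (\<kappa> x y) * W y" for x y
    using knn[of x y] by (auto simp: W_def \<kappa>_def indicator_def abs_mult ennreal_mult)
  have int: "integrable lborel (\<lambda>y. \<kappa> x y * g' y)" if "u x < \<infinity>" for x
    using that \<kappa>x[of x] unfolding integrable_iff_bounded norm_eq u_def by auto
  have Tu: "ennreal \<bar>T x\<bar> \<le> u x" for x
    unfolding T_eq u_def norm_eq[symmetric]
    using integral_norm_bound_ennreal[of lborel "\<lambda>y. \<kappa> x y * g' y"] 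
    by (cases "integrable lborel (\<lambda>y. \<kappa> x y * g' y)") (auto simp: not_integrable_integral_eq)
  have "AE x in lebesgue. x \<in> B \<longrightarrow> set_integrable lebesgue B (\<lambda>y. k x y * g y)"
    using AE_completion[OF ufin]
  proof eventually_elim
    case (elim x)
    show ?case
    proof
      assume "x \<in> B"
      then have "integrable lborel (\<lambda>y. \<kappa> x y * g' y)" using elim int by blast
      then have 1: "integrable lebesgue (\<lambda>y. \<kappa> x y * g' y)"
        by (subst integrable_completion) auto
      have "integrable lebesgue (\<lambda>y. \<kappa> x y * g y)"
        by (intro integrable_cong_AE_imp[OF 1] borel_measurable_times \<kappa>l gm) (rule eventually_mono[OF ggl], simp)
      then show "set_integrable lebesgue B (\<lambda>y. k x y * g y)"
        by (simp add: set_integrable_def \<kappa>_def mult.assoc)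
    qed
  qed
  then show "AE x in ?\<mu>. set_integrable lebesgue B (\<lambda>y. k x y * g y)"
    using v(2) by (subst AE_uniform_measure) (auto simp: vl)
  show "luxemburg_norm (Phi N) ?\<mu> T \<le> ennreal (2 * \<omega> * (LINT x|?\<mu>. \<bar>g x\<bar>))"
  proof (cases "A = 0")
    \<comment> \<open>The number c of the other case would be 0 here. T vanishes identically, so
      every positive k is admissible and the infimum is 0 without being attained.\<close>
    case True
    then have W0: "AE y in lborel. W y = 0"
      using A nn_integral_0_iff_AE[of W lborel] by simp
    have T0: "T x = 0" for x
    proof -
      have "u x = (\<integral>\<^sup>+y. 0 \<partial>(lborel :: 'a measure))"
        unfolding u_def by (intro nn_integral_cong_AE eventually_mono[OF W0]) auto
      then show ?thesis using Tu[of x] by simp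
    qed
    have "luxemburg_norm (Phi N) ?\<mu> T \<le> ennreal e" if "e > 0" for e
      unfolding luxemburg_norm_def using that N by (intro Inf_lower) (auto simp: T0 Phi_eq)
    then have "luxemburg_norm (Phi N) ?\<mu> T \<le> 0 + ennreal e" if "e > 0" for e
      unfolding add_0_left using that by blast
    then have "luxemburg_norm (Phi N) ?\<mu> T \<le> 0"
      by (rule ennreal_le_epsilon)
    then show ?thesis by simp
  next
    case False
    then have Apos: "0 < A" using A by simp
    \<comment> \<open>With W normalised by its mass A, the variable
      \<open>\<kappa> x y * v / \<omega>\<close> has mean \<open>U * v / (\<omega> * A)\<close>;
      this c makes the mean equal to \<open>2 * m\<close> for \<open>m = U / c\<close>.\<close>
    define c where "c = 2 * \<omega> * (A / v)"
    have c: "0 < c" using Apos \<omega> v by (simp add: c_def)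
    have key: "ennreal (Phi N (\<bar>T x\<bar> / c)) * ennreal A
        \<le> (\<integral>\<^sup>+y. ennreal (Phi N (\<kappa> x y * v / \<omega>)) * W y \<partial>lborel)" if "u x < \<infinity>" for x
    proof (cases "u x = 0")
      case True
      then have "T x = 0" using Tu[of x] by simp
      then show ?thesis using N by (simp add: Phi_eq)
    next
      case un: False
      define U where "U = enn2real (u x)"
      have U: "u x = ennreal U" "0 < U"
        using that un by (auto simp: U_def less_top enn2real_positive_iff zero_less_iff_neq_zero)
      define m where "m = U / c"
      have m: "0 < m" using U c by (simp add: m_def)
      define w where "w = Phi N m / m"
      have w: "0 \<le> w" using m N Phi_nonneg[of m N] by (simp add: w_def)
      have "ennreal (Phi N (\<bar>T x\<bar> / c)) \<le> ennreal (Phi N m)"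
        using Tu[of x] U c N by (intro ennreal_leI Phi_mono) (auto simp: m_def divide_right_mono)
      moreover have "ennreal (Phi N m) * ennreal A \<le> (\<integral>\<^sup>+y. ennreal (Phi N (\<kappa> x y * v / \<omega>)) * W y \<partial>lborel)" (is "_ \<le> ?R")
      proof -
        have le: "ennreal (w * v / \<omega>) * (ennreal (\<kappa> x y) * W y)
            \<le> ennreal (Phi N (\<kappa> x y * v / \<omega>)) * W y + ennreal (w * m) * W y" for y
        proof -
          have "w * (\<kappa> x y * v / \<omega> - m) \<le> Phi N (\<kappa> x y * v / \<omega>)"
            using Phi_ge_line[of "\<kappa> x y * v / \<omega>" m N] \<kappa>nn[of x y] v \<omega> m N by (simp add: w_def)
          then have "w * v / \<omega> * \<kappa> x y \<le> Phi N (\<kappa> x y * v / \<omega>) + w * m"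
            by (simp add: algebra_simps)
          then have "ennreal (w * v / \<omega>) * ennreal (\<kappa> x y) \<le> ennreal (Phi N (\<kappa> x y * v / \<omega>)) + ennreal (w * m)"
            using w v \<omega> m \<kappa>nn[of x y] N
            by (simp add: ennreal_mult[symmetric] ennreal_plus[symmetric] Phi_nonneg del: ennreal_plus)
          then show ?thesis
            by (simp add: distrib_right[symmetric] mult.assoc[symmetric] mult_right_mono)
        qed
        have "ennreal (w * v / \<omega>) * u x
            = (\<integral>\<^sup>+y. ennreal (w * v / \<omega>) * (ennreal (\<kappa> x y) * W y) \<partial>lborel)"
          unfolding u_def using \<kappa>x[of x] by (intro nn_integral_cmult[symmetric]) measurable
        also have "\<dots> \<le> (\<integral>\<^sup>+y. ennreal (Phi N (\<kappa> x y * v / \<omega>)) * W y + ennreal (w * m) * W y \<partial>lborel)"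
          by (intro nn_integral_mono le)
        also have "\<dots> = ?R + ennreal (w * m) * ennreal A"
          using \<kappa>x[of x] by (subst nn_integral_add) (auto simp: nn_integral_cmult A)
        finally have 1: "ennreal (w * v / \<omega>) * u x \<le> ?R + ennreal (w * m) * ennreal A" .
        have "w * v / \<omega> * U = 2 * (Phi N m * A)"
          using U m c Apos v \<omega> by (simp add: w_def m_def c_def field_simps)
        then have "ennreal (w * v / \<omega>) * u x = ennreal (Phi N m * A) + ennreal (Phi N m * A)"
          using U w v \<omega> m N Apos
          by (simp add: ennreal_mult[symmetric] ennreal_plus[symmetric] Phi_nonneg del: ennreal_plus)
        moreover have "ennreal (w * m) * ennreal A = ennreal (Phi N m * A)"
          using m N Apos by (simp add: w_def ennreal_mult Phi_nonneg)
        ultimately have "ennreal (Phi N m * A) + ennreal (Phi N m * A) \<le> ?R + ennreal (Phi N m * A)"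
          using 1 by simp
        \<comment> \<open>One of the two copies may be cancelled because it is a finite real;
          \<open>?R\<close> itself may be infinite.\<close>
        then have "ennreal (Phi N m * A) \<le> ?R"
          by (simp add: ennreal_add_left_cancel_le add.commute)
        then show ?thesis using m N Apos by (simp add: ennreal_mult Phi_nonneg)
      qed
      ultimately show ?thesis by (meson mult_right_mono order_trans zero_le)
    qed
    have "(\<integral>\<^sup>+x. ennreal (Phi N (\<bar>T x\<bar> / c)) * indicator B x \<partial>lborel) * ennreal A
        = (\<integral>\<^sup>+x. ennreal (Phi N (\<bar>T x\<bar> / c)) * indicator B x * ennreal A \<partial>lborel)"
      by (intro nn_integral_multc[symmetric]) measurable
    also have "\<dots> \<le> (\<integral>\<^sup>+x. (\<integral>\<^sup>+y. ennreal (Phi N (\<kappa> x y * v / \<omega>)) * W y * indicator B x \<partial>lborel) \<partial>lborel)"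
    proof (intro nn_integral_mono_AE)
      show "AE x in lborel. ennreal (Phi N (\<bar>T x\<bar> / c)) * indicator B x * ennreal A
          \<le> (\<integral>\<^sup>+y. ennreal (Phi N (\<kappa> x y * v / \<omega>)) * W y * indicator B x \<partial>lborel)"
        by (rule eventually_mono[OF ufin]) (use key in \<open>auto simp: indicator_def\<close>)
    qed
    also have "\<dots> = (\<integral>\<^sup>+y. (\<integral>\<^sup>+x. ennreal (Phi N (\<kappa> x y * v / \<omega>)) * W y * indicator B x \<partial>lborel) \<partial>lborel)"
      by (rule lborel_pair.Fubini'[symmetric]) measurable
    also have "\<dots> = (\<integral>\<^sup>+y. W y * (\<integral>\<^sup>+x. ennreal (Phi N (\<kappa> x y * v / \<omega>)) * indicator B x \<partial>lborel) \<partial>lborel)"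
      by (intro nn_integral_cong, subst nn_integral_cmult[symmetric])
         (measurable, auto intro!: nn_integral_cong simp: mult_ac)
    also have "\<dots> \<le> (\<integral>\<^sup>+y. W y * ennreal v \<partial>lborel)"
    proof (intro nn_integral_mono)
      fix y show "W y * (\<integral>\<^sup>+x. ennreal (Phi N (\<kappa> x y * v / \<omega>)) * indicator B x \<partial>lborel) \<le> W y * ennreal v"
      proof (cases "y \<in> B")
        case True
        then have "\<kappa> x y = k x y" for x by (simp add: \<kappa>_def)
        then show ?thesis using bound[OF True] v by (intro mult_left_mono) (auto simp: v_def)
      qed (simp add: W_def)
    qed
    also have "\<dots> = ennreal v * ennreal A"
      by (subst nn_integral_multc) (auto simp: A mult.commute)
    finally have 2: "(\<integral>\<^sup>+x. ennreal (Phi N (\<bar>T x\<bar> / c)) * indicator B x \<partial>lborel) * ennreal A \<le> ennreal v * ennreal A" .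
    have 3: "(\<integral>\<^sup>+x. ennreal (Phi N (\<bar>T x\<bar> / c)) * indicator B x \<partial>lborel) \<le> ennreal v" (is "?I \<le> _")
    proof -
      have "?I = ?I * ennreal A * ennreal (1 / A)"
        using Apos by (simp add: mult.assoc ennreal_mult[symmetric])
      also have "\<dots> \<le> ennreal v * ennreal A * ennreal (1 / A)" by (intro mult_right_mono 2) auto
      also have "\<dots> = ennreal v" using Apos by (simp add: mult.assoc ennreal_mult[symmetric])
      finally show ?thesis .
    qed
    have "(\<integral>\<^sup>+x. ennreal (Phi N (\<bar>T x\<bar> / c)) \<partial>?\<mu>)
        = (\<integral>\<^sup>+x. ennreal (Phi N (\<bar>T x\<bar> / c)) * indicator B x \<partial>lebesgue) / ennreal v"
      by (subst nn_integral_uniform_measure) (auto simp: vl)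
    also have "\<dots> = ?I / ennreal v"
      by (subst nn_integral_completion) auto
    also have "\<dots> \<le> ennreal v / ennreal v" by (intro divide_right_mono_ennreal 3)
    also have "\<dots> = 1" using v by simp
    finally have "(\<integral>\<^sup>+x. ennreal (Phi N (\<bar>T x\<bar> / c)) \<partial>?\<mu>) \<le> 1" .
    then have "luxemburg_norm (Phi N) ?\<mu> T \<le> ennreal c"
      unfolding luxemburg_norm_def using c by (intro Inf_lower) auto
    then show ?thesis by (simp add: gA c_def)
  qed
qed

section \<open>The profile function\<close>

text \<open>\<open>e0\<close> stands for the epsilon in the structure condition bounding
  \<open>1 / (- x * F')\<close>, and \<open>a\<close> for the exponent
  \<open>(1 - \<epsilon>) / N\<close>. The upper bound on F'' enters in the integrated form
  \<open>F'_growth\<close>, which is how the estimates use it.\<close>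

locale degenerate_geometry =
  fixes F :: "real \<Rightarrow> real" and R r0 e0 a :: real
  assumes r0: "0 < r0" "r0 < R"
    and F_diff: "\<And>x. 0 < x \<Longrightarrow> x < R \<Longrightarrow> F differentiable (at x)"
    and F'_diff: "\<And>x. 0 < x \<Longrightarrow> x < R \<Longrightarrow> deriv F differentiable (at x)"
    and F_lim: "filterlim F at_top (at_right 0)"
    and F'_neg: "\<And>x. 0 < x \<Longrightarrow> x < R \<Longrightarrow> deriv F x < 0"
    and F''_pos: "\<And>x. 0 < x \<Longrightarrow> x < R \<Longrightarrow> deriv (deriv F) x > 0"
    and e0: "0 < e0" "e0 \<le> 1"
    and F'_ge: "\<And>x. 0 < x \<Longrightarrow> x < R \<Longrightarrow> e0 \<le> x * (- deriv F x)"
    and a: "0 < a" "a < 1"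
    and F'_growth: "\<And>u v. 0 < u \<Longrightarrow> u \<le> v \<Longrightarrow> v < r0 \<Longrightarrow>
      - deriv F u * u powr (1 + a) \<le> - deriv F v * v powr (1 + a)"
begin

definition p :: "real \<Rightarrow> real" where "p x = - deriv F x"

abbreviation f :: "real \<Rightarrow> real" where "f \<equiv> geom_f F"

lemma R_pos: "0 < R"
  using r0 by simp

lemma F_deriv: "0 < x \<Longrightarrow> x < R \<Longrightarrow> (F has_real_derivative - p x) (at x)"
  using F_diff[of x] by (simp add: p_def DERIV_deriv_iff_real_differentiable)

lemma p_deriv: "0 < x \<Longrightarrow> x < R \<Longrightarrow> (p has_real_derivative - deriv (deriv F) x) (at x)"
  unfolding p_def by (intro DERIV_minus) (use F'_diff in \<open>simp add: DERIV_deriv_iff_real_differentiable\<close>)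

lemma p_pos: "0 < x \<Longrightarrow> x < R \<Longrightarrow> 0 < p x"
  using F'_neg[of x] by (simp add: p_def)

lemma p_ge: "0 < x \<Longrightarrow> x < R \<Longrightarrow> e0 \<le> x * p x"
  using F'_ge[of x] by (simp add: p_def)

text \<open>The natural length 1 / p, over which f grows by at most the factor e, never exceeds a
  fixed multiple of the distance x to the degenerate hyperplane.\<close>

lemma inverse_p_le: "0 < x \<Longrightarrow> x < R \<Longrightarrow> 1 / p x \<le> x / e0"
  using p_ge[of x] p_pos[of x] e0 by (simp add: field_simps)

lemma p_anti: "0 < u \<Longrightarrow> u \<le> v \<Longrightarrow> v < R \<Longrightarrow> p v \<le> p u"
proof (rule DERIV_nonpos_imp_nonincreasing[of u v p])
  fix x assume "0 < u" "v < R" "u \<le> x" "x \<le> v"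
  then show "\<exists>y. (p has_real_derivative y) (at x) \<and> y \<le> 0"
    using p_deriv[of x] F''_pos[of x] by (intro exI[of _ "- deriv (deriv F) x"]) auto
qed

lemma continuous_on_p: "continuous_on {0<..<R} p"
  by (intro continuous_at_imp_continuous_on) (auto intro!: DERIV_isCont p_deriv)

text \<open>The exponent 1 + a is rounded up to 2, which keeps a out of the geometric
  constants.\<close>

lemma p_double:
  assumes "0 < u" "u \<le> v" "v < r0"
  shows "p u \<le> (v / u)\<^sup>2 * p v"
proof -
  have "p u * u powr (1 + a) \<le> p v * v powr (1 + a)"
    using F'_growth[OF assms] by (simp add: p_def)
  then have "p u \<le> p v * (v / u) powr (1 + a)"
    using assms by (simp add: powr_divide field_simps)
  also have "\<dots> \<le> p v * (v / u) powr 2"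
    using assms a p_pos[of v] r0 by (intro mult_left_mono powr_mono) auto
  finally show ?thesis using assms by (simp add: mult.commute)
qed

lemma p_growth:
  assumes "0 < u" "u \<le> v" "v < r0"
  shows "p u \<le> p v * (v / u) powr (1 + a)"
  using F'_growth[OF assms] assms by (simp add: p_def powr_divide field_simps)

lemma F_diff_bounds:
  assumes "0 < u" "u \<le> v" "v < R"
  shows "(v - u) * p v \<le> F u - F v" "F u - F v \<le> (v - u) * p u"
proof -
  have "(v - u) * p v \<le> F u - F v \<and> F u - F v \<le> (v - u) * p u"
  proof (cases "u = v")
    case False
    then have "u < v" using assms by simp
    then obtain z where z: "u < z" "z < v" "F v - F u = (v - u) * (- p z)"
      using MVT2[of u v F "\<lambda>x. - p x"] F_deriv assms by force
    then have "p v \<le> p z" "p z \<le> p u" using p_anti assms by auto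
    moreover have "F u - F v = (v - u) * p z" using z(3) by simp
    ultimately show ?thesis using \<open>u < v\<close> by (auto intro: mult_left_mono)
  qed simp
  then show "(v - u) * p v \<le> F u - F v" "F u - F v \<le> (v - u) * p u" by auto
qed

lemma F_anti: "0 < u \<Longrightarrow> u \<le> v \<Longrightarrow> v < R \<Longrightarrow> F v \<le> F u"
  using F_diff_bounds(1)[of u v] p_pos[of v] by (smt (verit) mult_nonneg_nonneg)

lemma f_0 [simp]: "f 0 = 0"
  by (simp add: geom_f_def)

lemma f_abs [simp]: "f \<bar>x\<bar> = f x"
  by (simp add: geom_f_def)

lemma f_eq: "0 < x \<Longrightarrow> f x = exp (- F x)"
  by (simp add: geom_f_def)

lemma f_pos: "x \<noteq> 0 \<Longrightarrow> 0 < f x"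
  by (simp add: geom_f_def)

lemma f_nonneg: "0 \<le> f x"
  by (simp add: geom_f_def)

lemma f_eq_0 [simp]: "f x = 0 \<longleftrightarrow> x = 0"
  by (simp add: geom_f_def)

lemma f_mono: "0 \<le> u \<Longrightarrow> u \<le> v \<Longrightarrow> v < R \<Longrightarrow> f u \<le> f v"
  using F_anti[of u v] by (cases "u = 0") (auto simp: f_eq f_nonneg)

lemma f_mono_abs: "\<bar>u\<bar> \<le> v \<Longrightarrow> v < R \<Longrightarrow> f u \<le> f v"
  using f_mono[of "\<bar>u\<bar>" v] by simp

lemma f_strict_mono: "0 \<le> u \<Longrightarrow> u < v \<Longrightarrow> v < R \<Longrightarrow> f u < f v"
proof (cases "u = 0")
  case False
  assume "0 \<le> u" "u < v" "v < R"
  then show ?thesis using F_diff_bounds(1)[of u v] p_pos[of v] False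
    by (smt (verit) exp_less_mono f_eq mult_pos_pos)
qed (auto simp: f_pos)

lemma f_deriv: "0 < x \<Longrightarrow> x < R \<Longrightarrow> (f has_real_derivative f x * p x) (at x)"
proof -
  assume x: "0 < x" "x < R"
  have "((\<lambda>x. exp (- F x)) has_real_derivative exp (- F x) * p x) (at x)"
    by (rule derivative_eq_intros F_deriv[OF x] refl)+ simp
  then have "((\<lambda>x. exp (- F x)) has_real_derivative f x * p x) (at x)"
    using x by (simp add: f_eq)
  then show ?thesis
    by (rule has_field_derivative_transform_within_open[of _ _ _ "{0<..}"]) (use x in \<open>auto simp: f_eq\<close>)
qed

text \<open>The logarithm of f is -F with derivative p, and p decreases, so the left endpoint gives
  the fastest growth. Over a length \<open>1 / p u\<close> the factor is at most
  \<open>exp 1\<close>.\<close>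

lemma f_ratio: "0 < u \<Longrightarrow> u \<le> v \<Longrightarrow> v < R \<Longrightarrow> f v \<le> exp ((v - u) * p u) * f u"
  using F_diff_bounds(2)[of u v] by (simp add: f_eq mult_exp_exp)

lemma continuous_on_f: "continuous_on {-R<..<R} f"
proof (intro continuous_at_imp_continuous_on ballI)
  fix x assume x: "x \<in> {-R<..<R}"
  have 1: "isCont f y" if "0 < y" "y < R" for y
    using f_deriv[OF that] by (rule DERIV_isCont)
  show "isCont f x"
  proof (cases x "0 :: real" rule: linorder_cases)
    case greater then show ?thesis using x by (intro 1) auto
  next
    case less
    then have "isCont f (- x)" using x by (intro 1) auto
    then have "isCont (\<lambda>x. f (- x)) x"
      by (intro isCont_o2[where g = f and f = uminus]) simp_all
    moreover have "(\<lambda>x. f (- x)) = f" by (auto simp: geom_f_def)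
    ultimately show ?thesis by simp
  next
    \<comment> \<open>Continuity at the degenerate point is exactly the divergence of F to infinity;
      the left limit follows from evenness.\<close>
    case equal
    have "((\<lambda>x. exp (- F x)) \<longlongrightarrow> 0) (at_right 0)"
      by (rule filterlim_compose[OF exp_at_bot]) (use F_lim in \<open>simp add: filterlim_uminus_at_bot\<close>)
    then have r: "(f \<longlongrightarrow> 0) (at_right 0)"
      by (rule tendsto_cong[THEN iffD1, rotated]) (auto simp: eventually_at_filter f_eq)
    moreover have "(\<lambda>x. f (- x)) = f" by (auto simp: geom_f_def)
    ultimately have "(f \<longlongrightarrow> 0) (at_left 0)"
      by (simp add: filterlim_at_left_to_right)
    with r show ?thesis
      unfolding equal isCont_def filterlim_at_split by simp
  qed
qed

end

section \<open>The control distance and its balls\<close>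

lemma measurable_vec_nth [measurable]: "(\<lambda>x::real^'n. x $ i) \<in> borel_measurable borel"
  by (intro borel_measurable_continuous_onI continuous_intros)

lemma measurable_mid_norm [measurable]: "mid_norm i1 i3 \<in> borel_measurable (borel :: (real^'n::finite) measure)"
  unfolding mid_norm_def by measurable

lemma mid_norm_nonneg: "0 \<le> mid_norm i1 i3 v"
  by (simp add: mid_norm_def sum_nonneg)

lemma mid_norm_power2: "(mid_norm i1 i3 v)\<^sup>2 = (\<Sum>i\<in>UNIV - {i1, i3}. (v $ i)\<^sup>2)"
  by (simp add: mid_norm_def sum_nonneg)

lemma mid_norm_scaleR: "mid_norm i1 i3 (c *\<^sub>R v) = \<bar>c\<bar> * mid_norm i1 i3 v"
  by (simp add: mid_norm_def power_mult_distrib sum_distrib_left[symmetric] real_sqrt_mult)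

lemma component_le_mid_norm: "i \<noteq> i1 \<Longrightarrow> i \<noteq> i3 \<Longrightarrow> \<bar>v $ i\<bar> \<le> mid_norm i1 i3 (v :: real^'n::finite)"
  unfolding mid_norm_def by (rule real_le_rsqrt) (auto intro!: member_le_sum)

lemma length_element_scaleR:
  "0 < c \<Longrightarrow> length_element F i1 i3 p (c *\<^sub>R v) = ennreal c * length_element F i1 i3 p v"
proof -
  assume c: "0 < c"
  have "(c *\<^sub>R v) $ i1 ^ 2 + (mid_norm i1 i3 (c *\<^sub>R v))\<^sup>2 + ((c *\<^sub>R v) $ i3)\<^sup>2 / (geom_f F (p $ i1))\<^sup>2
    = c\<^sup>2 * ((v $ i1)\<^sup>2 + (mid_norm i1 i3 v)\<^sup>2 + (v $ i3)\<^sup>2 / (geom_f F (p $ i1))\<^sup>2)"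
    by (simp add: mid_norm_scaleR power_mult_distrib algebra_simps)
  then show ?thesis
    using c by (auto simp: length_element_def real_sqrt_mult ennreal_mult ennreal_mult_top)
qed

lemma abs_component_le_length_element:
  "i \<noteq> i3 \<Longrightarrow> ennreal \<bar>v $ i\<bar> \<le> length_element F i1 i3 p (v :: real^'n::finite)"
proof -
  assume i: "i \<noteq> i3"
  have "(v $ i)\<^sup>2 \<le> (v $ i1)\<^sup>2 + (mid_norm i1 i3 v)\<^sup>2"
    using component_le_mid_norm[of i i1 i3 v] i
    by (cases "i = i1") (auto simp: abs_le_square_iff[symmetric] mid_norm_nonneg intro: add_increasing)
  then have "\<bar>v $ i\<bar> \<le> sqrt ((v $ i1)\<^sup>2 + (mid_norm i1 i3 v)\<^sup>2 + (v $ i3)\<^sup>2 / (geom_f F (p $ i1))\<^sup>2)"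
    by (intro real_le_rsqrt) (auto intro: order_trans)
  then show ?thesis by (auto simp: length_element_def intro: ennreal_leI)
qed

text \<open>Holds on the degenerate hyperplane too: there the right side is infinite unless the
  vertical velocity vanishes.\<close>

lemma abs_vertical_le_length_element:
  assumes "geom_f F (p $ i1) \<le> c" "0 < c"
  shows "ennreal \<bar>v $ i3\<bar> \<le> ennreal c * length_element F i1 i3 p (v :: real^'n::finite)"
proof (cases "geom_f F (p $ i1) = 0")
  case True
  then show ?thesis using assms by (cases "v $ i3 = 0") (auto simp: length_element_def ennreal_mult_top)
next
  case False
  let ?f = "geom_f F (p $ i1)"
  have f: "0 < ?f" using False by (auto simp: geom_f_def)
  have "\<bar>v $ i3\<bar> / ?f \<le> sqrt ((v $ i1)\<^sup>2 + (mid_norm i1 i3 v)\<^sup>2 + (v $ i3)\<^sup>2 / ?f\<^sup>2)"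
    by (intro real_le_rsqrt) (auto simp: power_divide)
  then have "\<bar>v $ i3\<bar> \<le> ?f * sqrt ((v $ i1)\<^sup>2 + (mid_norm i1 i3 v)\<^sup>2 + (v $ i3)\<^sup>2 / ?f\<^sup>2)"
    using f by (simp add: field_simps)
  also have "\<dots> \<le> c * sqrt ((v $ i1)\<^sup>2 + (mid_norm i1 i3 v)\<^sup>2 + (v $ i3)\<^sup>2 / ?f\<^sup>2)"
    using assms by (intro mult_right_mono) auto
  finally show ?thesis using False assms by (simp add: length_element_def ennreal_mult[symmetric] ennreal_leI)
qed

lemma valid_path_derivative:
  fixes \<gamma> :: "real \<Rightarrow> real^'n::finite"
  assumes "valid_path \<gamma>"
  obtains S where "finite S" "{0, 1} \<subseteq> S"
    "\<And>t. t \<in> {0..1} - S \<Longrightarrow> (\<gamma> has_vector_derivative vector_derivative \<gamma> (at t)) (at t)"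
    "continuous_on ({0..1} - S) (\<lambda>t. vector_derivative \<gamma> (at t))"
    "continuous_on {0..1} \<gamma>"
proof -
  obtain S where S: "finite S" "\<gamma> C1_differentiable_on {0..1} - S" and c: "continuous_on {0..1} \<gamma>"
    using assms by (auto simp: valid_path_def piecewise_C1_differentiable_on_def)
  show ?thesis
  proof (rule that[of "insert 0 (insert 1 S)"])
    show "continuous_on ({0..1} - insert 0 (insert 1 S)) (\<lambda>t. vector_derivative \<gamma> (at t))"
      using S(2) unfolding C1_differentiable_on_eq by (auto elim: continuous_on_subset)
    show "(\<gamma> has_vector_derivative vector_derivative \<gamma> (at t)) (at t)"
      if "t \<in> {0..1} - insert 0 (insert 1 S)" for t
      using S(2) that unfolding C1_differentiable_on_eq by (simp add: vector_derivative_works[symmetric])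
  qed (use S c in auto)
qed

lemma measurable_path_derivative:
  fixes \<gamma> :: "real \<Rightarrow> real^'n::finite"
  assumes "valid_path \<gamma>"
  shows "(\<lambda>t. indicator {0..1} t *\<^sub>R vector_derivative \<gamma> (at t)) \<in> borel_measurable borel"
proof -
  obtain S where S: "finite S" "continuous_on ({0..1} - S) (\<lambda>t. vector_derivative \<gamma> (at t))"
    using valid_path_derivative[OF assms] by metis
  have "(\<lambda>t. indicator ({0..1} - S) t *\<^sub>R vector_derivative \<gamma> (at t)) \<in> borel_measurable borel"
    using S by (intro borel_measurable_continuous_on_indicator) (auto intro: sets.Diff borel_closed finite_imp_closed)
  then show ?thesis
    by (rule measurable_discrete_difference[where X = S]) (use S in \<open>auto simp: indicator_def countable_finite\<close>)
qed

text \<open>The gauge form of the fundamental theorem needs no integrability of the derivative. If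
  the right side is finite, the derivative is Lebesgue integrable and the two integrals agree; if it
  is infinite, there is nothing to prove.\<close>

lemma path_component_bound:
  fixes \<gamma> :: "real \<Rightarrow> real^'n::finite"
  assumes "valid_path \<gamma>" and t: "t \<in> {0..1}"
  shows "ennreal \<bar>\<gamma> t $ i - \<gamma> 0 $ i\<bar> \<le> (\<integral>\<^sup>+s\<in>{0..1}. ennreal \<bar>vector_derivative \<gamma> (at s) $ i\<bar> \<partial>lborel)"
    (is "_ \<le> ?I")
proof (cases "?I < \<infinity>")
  case False then show ?thesis by (simp add: less_top[symmetric] top_unique)
next
  case True
  define v where "v s = indicator {0..1} s * (vector_derivative \<gamma> (at s) $ i)" for s :: real
  have vm: "v \<in> borel_measurable borel"
    using measurable_compose[OF measurable_path_derivative[OF assms(1)] measurable_vec_nth[of i]]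
    by (simp add: v_def[abs_def])
  have I: "(\<integral>\<^sup>+s. ennreal (norm (v s)) \<partial>lborel) = ?I"
    by (intro nn_integral_cong) (auto simp: v_def indicator_def)
  obtain S where S: "finite S" "\<And>t. t \<in> {0..1} - S \<Longrightarrow> (\<gamma> has_vector_derivative vector_derivative \<gamma> (at t)) (at t)"
     "continuous_on {0..1} \<gamma>"
    using valid_path_derivative[OF assms(1)] by metis
  have "((\<lambda>s. vector_derivative \<gamma> (at s)) has_integral (\<gamma> t - \<gamma> 0)) {0..t}"
    using S t by (intro fundamental_theorem_of_calculus_interior_strong[of S]) (auto elim: continuous_on_subset)
  from has_integral_linear[OF this bounded_linear_vec_nth[of i]]
  have "((\<lambda>s. vector_derivative \<gamma> (at s) $ i) has_integral (\<gamma> t $ i - \<gamma> 0 $ i)) {0..t}"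
    by (simp add: o_def)
  then have h: "(v has_integral (\<gamma> t $ i - \<gamma> 0 $ i)) {0..t}"
    by (rule has_integral_eq[rotated]) (use t in \<open>auto simp: v_def\<close>)
  have "integrable lborel v"
    using True vm I by (auto simp: integrable_iff_bounded)
  then have si: "set_integrable lborel {0..t} v"
    unfolding set_integrable_def by (intro integrable_mult_indicator) auto
  have "\<gamma> t $ i - \<gamma> 0 $ i = (LINT s:{0..t}|lborel. v s)"
    using set_borel_integral_eq_integral(2)[OF si] h by (simp add: integral_unique)
  also have "ennreal (norm \<dots>) \<le> (\<integral>\<^sup>+s. ennreal (norm (indicator {0..t} s *\<^sub>R v s)) \<partial>lborel)"
    using si unfolding set_lebesgue_integral_def set_integrable_def by (rule integral_norm_bound_ennreal)
  also have "\<dots> \<le> (\<integral>\<^sup>+s. ennreal (norm (v s)) \<partial>lborel)"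
    by (intro nn_integral_mono) (auto simp: indicator_def)
  finally show ?thesis unfolding I by simp
qed

locale degenerate_metric = degenerate_geometry F R r0 e0 a for F R r0 e0 a +
  fixes i1 i3 :: "'n::finite"
  assumes i13: "i1 \<noteq> i3"
begin

abbreviation d :: "real^'n \<Rightarrow> real^'n \<Rightarrow> ennreal" where "d \<equiv> control_dist F R i1 i3"

abbreviation mid :: "real^'n \<Rightarrow> real" where "mid \<equiv> mid_norm i1 i3"

abbreviation speed :: "(real \<Rightarrow> real^'n) \<Rightarrow> real \<Rightarrow> ennreal" where
  "speed \<gamma> t \<equiv> length_element F i1 i3 (\<gamma> t) (vector_derivative \<gamma> (at t)) * indicator {0..1} t"

definition strip :: "(real^'n) set" where "strip = {x. \<bar>x $ i1\<bar> < R}"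

lemma open_strip: "open strip"
  unfolding strip_def by (intro open_Collect_less continuous_intros)

lemma convex_strip: "convex strip"
proof -
  have "strip = (\<lambda>x. x $ i1) -` {-R<..<R}" by (auto simp: strip_def)
  then show ?thesis
    using convex_linear_vimage[of "\<lambda>x::real^'n. x $ i1" "{-R<..<R}"] bounded_linear_vec_nth[of i1, THEN bounded_linear.linear]
    by auto
qed

definition admissible :: "(real \<Rightarrow> real^'n) \<Rightarrow> bool" where
  "admissible \<gamma> \<longleftrightarrow> valid_path \<gamma> \<and> path_image \<gamma> \<subseteq> strip"

lemma control_dist_eq:
  "d x y = (INF \<gamma>\<in>{\<gamma>. admissible \<gamma> \<and> pathstart \<gamma> = x \<and> pathfinish \<gamma> = y}. curve_length F i1 i3 \<gamma>)"
  unfolding control_dist_def admissible_def strip_def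
  by (rule INF_cong) auto

lemma control_dist_le:
  "admissible \<gamma> \<Longrightarrow> pathstart \<gamma> = x \<Longrightarrow> pathfinish \<gamma> = y \<Longrightarrow> d x y \<le> curve_length F i1 i3 \<gamma>"
  unfolding control_dist_eq by (rule INF_lower) auto

lemma control_dist_lessD:
  assumes "d x y < D"
  obtains \<gamma> where "admissible \<gamma>" "pathstart \<gamma> = x" "pathfinish \<gamma> = y" "curve_length F i1 i3 \<gamma> < D"
  using assms unfolding control_dist_eq INF_less_iff by blast

lemma control_dist_strip: "d x y < \<infinity> \<Longrightarrow> x \<in> strip \<and> y \<in> strip"
  by (erule control_dist_lessD) (auto simp: admissible_def pathstart_in_path_image pathfinish_in_path_image)

lemma measurable_speed:
  assumes "admissible \<gamma>"
  shows "speed \<gamma> \<in> borel_measurable borel"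
proof -
  define V where "V t = indicator {0..1} t *\<^sub>R vector_derivative \<gamma> (at t)" for t
  define h where "h t = indicator {0..1} t *\<^sub>R f (\<gamma> t $ i1)" for t :: real
  have [measurable]: "V \<in> borel_measurable borel"
    using measurable_path_derivative assms by (auto simp: V_def[abs_def] admissible_def)
  have "continuous_on {0..1} \<gamma>"
    using assms by (auto simp: admissible_def dest!: valid_path_imp_path simp: path_def)
  then have "continuous_on {0..1} (\<lambda>t. f (\<gamma> t $ i1))"
    using assms by (intro continuous_on_compose2[OF continuous_on_f] continuous_intros)
      (auto simp: admissible_def strip_def path_image_def abs_less_iff)
  then have [measurable]: "h \<in> borel_measurable borel"
    unfolding h_def[abs_def] by (intro borel_measurable_continuous_on_indicator) auto
  have "(\<lambda>t. (if h t = 0 \<and> V t $ i3 \<noteq> 0 then \<infinity>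
      else ennreal (sqrt ((V t $ i1)\<^sup>2 + (mid (V t))\<^sup>2 + (V t $ i3)\<^sup>2 / (h t)\<^sup>2))) * indicator {0..1} t) \<in> borel_measurable borel"
    by measurable
  also have "(\<lambda>t. (if h t = 0 \<and> V t $ i3 \<noteq> 0 then \<infinity>
      else ennreal (sqrt ((V t $ i1)\<^sup>2 + (mid (V t))\<^sup>2 + (V t $ i3)\<^sup>2 / (h t)\<^sup>2))) * indicator {0..1} t) = speed \<gamma>"
    by (auto simp: fun_eq_iff h_def V_def length_element_def indicator_def)
  finally show ?thesis .
qed

lemma speed_join:
  assumes g: "admissible \<gamma>1" "admissible \<gamma>2"
  shows "AE t in lborel. speed (\<gamma>1 +++ \<gamma>2) t = 2 * speed \<gamma>1 (2 * t) + 2 * speed \<gamma>2 (2 * t - 1)"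
proof -
  obtain S1 where S1: "finite S1" "{0, 1} \<subseteq> S1"
    "\<And>t. t \<in> {0..1} - S1 \<Longrightarrow> (\<gamma>1 has_vector_derivative vector_derivative \<gamma>1 (at t)) (at t)"
    using valid_path_derivative g(1) unfolding admissible_def by metis
  obtain S2 where S2: "finite S2" "{0, 1} \<subseteq> S2"
    "\<And>t. t \<in> {0..1} - S2 \<Longrightarrow> (\<gamma>2 has_vector_derivative vector_derivative \<gamma>2 (at t)) (at t)"
    using valid_path_derivative g(2) unfolding admissible_def by metis
  \<comment> \<open>The joining time and the rescaled exceptional times of both paths. Off this
    finite set the chain rule applies and only one of the two summands is active.\<close>
  define X where "X = {1/2} \<union> (\<lambda>s. s / 2) ` S1 \<union> (\<lambda>s. (s + 1) / 2) ` S2"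
  have X: "finite X" using S1 S2 by (auto simp: X_def)
  have "AE t in lborel. t \<notin> X"
    using X by (intro AE_not_in finite_imp_null_set_lborel)
  then show ?thesis
  proof eventually_elim
    case (elim t)
    have t1: "2 * t \<notin> S1"
    proof
      assume "2 * t \<in> S1"
      then have "(2 * t) / 2 \<in> X" unfolding X_def by blast
      then show False using elim by simp
    qed
    have t2: "2 * t - 1 \<notin> S2"
    proof
      assume "2 * t - 1 \<in> S2"
      then have "(2 * t - 1 + 1) / 2 \<in> X" unfolding X_def by blast
      then show False using elim by simp
    qed
    have half: "t \<noteq> 1 / 2" using elim by (auto simp: X_def)
    consider "t < 0" | "0 \<le> t" "t < 1 / 2" | "1 / 2 < t" "t \<le> 1" | "1 < t" using half by linarith
    then show ?case
    proof cases
      case 2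
      have "((\<gamma>1 \<circ> (\<lambda>t. 2 * t)) has_vector_derivative 2 *\<^sub>R vector_derivative \<gamma>1 (at (2 * t))) (at t)"
        using S1(3)[of "2 * t"] t1 2
        by (intro vector_diff_chain_at) (auto intro!: derivative_eq_intros)
      then have "((\<gamma>1 +++ \<gamma>2) has_vector_derivative 2 *\<^sub>R vector_derivative \<gamma>1 (at (2 * t))) (at t)"
        by (rule has_vector_derivative_transform_within_open[of _ _ _ "{..<1/2}"])
           (use 2 in \<open>auto simp: joinpaths_def\<close>)
      then have "vector_derivative (\<gamma>1 +++ \<gamma>2) (at t) = 2 *\<^sub>R vector_derivative \<gamma>1 (at (2 * t))"
        by (rule vector_derivative_at)
      then show ?thesis using 2
        by (simp add: length_element_scaleR joinpaths_def mult.assoc)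
    next
      case 3
      have "((\<gamma>2 \<circ> (\<lambda>t. 2 * t - 1)) has_vector_derivative 2 *\<^sub>R vector_derivative \<gamma>2 (at (2 * t - 1))) (at t)"
        using S2(3)[of "2 * t - 1"] t2 3
        by (intro vector_diff_chain_at) (auto intro!: derivative_eq_intros)
      then have "((\<gamma>1 +++ \<gamma>2) has_vector_derivative 2 *\<^sub>R vector_derivative \<gamma>2 (at (2 * t - 1))) (at t)"
        by (rule has_vector_derivative_transform_within_open[of _ _ _ "{1/2<..}"])
           (use 3 in \<open>auto simp: joinpaths_def\<close>)
      then have "vector_derivative (\<gamma>1 +++ \<gamma>2) (at t) = 2 *\<^sub>R vector_derivative \<gamma>2 (at (2 * t - 1))"
        by (rule vector_derivative_at)
      then show ?thesis using 3
        by (simp add: length_element_scaleR joinpaths_def mult.assoc)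
    qed (simp_all add: indicator_def)
  qed
qed

lemma curve_length_join:
  assumes g: "admissible \<gamma>1" "admissible \<gamma>2"
  shows "curve_length F i1 i3 (\<gamma>1 +++ \<gamma>2) = curve_length F i1 i3 \<gamma>1 + curve_length F i1 i3 \<gamma>2"
proof -
  note [measurable] = measurable_speed[OF g(1)] measurable_speed[OF g(2)]
  have "curve_length F i1 i3 (\<gamma>1 +++ \<gamma>2) = (\<integral>\<^sup>+t. 2 * speed \<gamma>1 (2 * t) + 2 * speed \<gamma>2 (2 * t - 1) \<partial>lborel)"
    unfolding curve_length_def by (intro nn_integral_cong_AE speed_join g)
  also have "\<dots> = 2 * (\<integral>\<^sup>+t. speed \<gamma>1 (2 * t) \<partial>lborel) + 2 * (\<integral>\<^sup>+t. speed \<gamma>2 (2 * t - 1) \<partial>lborel)"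
    using measurable_compose[of "\<lambda>t. 2 * t" borel borel "speed \<gamma>1"] measurable_compose[of "\<lambda>t. 2 * t - 1" borel borel "speed \<gamma>2"]
       measurable_speed[OF g(1)] measurable_speed[OF g(2)]
    by (subst nn_integral_add) (auto simp: nn_integral_cmult)
  also have "2 * (\<integral>\<^sup>+t. speed \<gamma>1 (2 * t) \<partial>lborel) = curve_length F i1 i3 \<gamma>1"
    unfolding curve_length_def
    using nn_integral_real_affine[OF measurable_speed[OF g(1)], of 2 0] by simp
  also have "2 * (\<integral>\<^sup>+t. speed \<gamma>2 (2 * t - 1) \<partial>lborel) = curve_length F i1 i3 \<gamma>2"
    unfolding curve_length_def
    using nn_integral_real_affine[OF measurable_speed[OF g(2)], of 2 "-1"] by simp
  finally show ?thesis .
qed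

section \<open>Upper bounds for the distance from explicit paths\<close>

lemma control_dist_triangle: "d x z \<le> d x y + d y z"
proof (cases "d x y < \<infinity> \<and> d y z < \<infinity>")
  case False then show ?thesis by (auto simp: less_top[symmetric] top_unique)
next
  case True
  show ?thesis
  proof (rule ennreal_le_epsilon)
    fix e :: real assume e: "0 < e"
    have "d x y < d x y + ennreal (e / 2)" "d y z < d y z + ennreal (e / 2)"
      using True e by (auto simp: ennreal_add_left_cancel_less[of _ 0, simplified])
    then obtain \<gamma>1 \<gamma>2 where
      1: "admissible \<gamma>1" "pathstart \<gamma>1 = x" "pathfinish \<gamma>1 = y" "curve_length F i1 i3 \<gamma>1 < d x y + ennreal (e / 2)" and
      2: "admissible \<gamma>2" "pathstart \<gamma>2 = y" "pathfinish \<gamma>2 = z" "curve_length F i1 i3 \<gamma>2 < d y z + ennreal (e / 2)"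
      by (meson control_dist_lessD)
    have "admissible (\<gamma>1 +++ \<gamma>2)"
      using 1 2 by (auto simp: admissible_def valid_path_join path_image_join)
    then have "d x z \<le> curve_length F i1 i3 \<gamma>1 + curve_length F i1 i3 \<gamma>2"
      using control_dist_le[of "\<gamma>1 +++ \<gamma>2" x z] 1 2 by (simp add: curve_length_join)
    also have "\<dots> \<le> (d x y + ennreal (e / 2)) + (d y z + ennreal (e / 2))"
      using 1 2 by (intro add_mono) auto
    also have "\<dots> = d x y + d y z + (ennreal (e / 2) + ennreal (e / 2))" by (simp add: ac_simps)
    also have "ennreal (e / 2) + ennreal (e / 2) = ennreal e" using e by (simp flip: ennreal_plus)
    finally show "d x z \<le> d x y + d y z + ennreal e" .
  qed
qed

lemma control_dist_linepath:
  assumes "x \<in> strip" "y \<in> strip"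
    and L: "\<And>t. t \<in> {0..1} \<Longrightarrow> length_element F i1 i3 (linepath x y t) (y - x) \<le> L"
  shows "d x y \<le> L"
proof -
  have "d x y \<le> curve_length F i1 i3 (linepath x y)"
    using assms(1,2) by (intro control_dist_le)
      (auto simp: admissible_def path_image_linepath closed_segment_subset convex_strip)
  also have "\<dots> \<le> (\<integral>\<^sup>+t. L * indicator {0..1::real} t \<partial>lborel)"
    unfolding curve_length_def by (intro nn_integral_mono) (auto simp: indicator_def L)
  also have "\<dots> = L" by (subst nn_integral_cmult_indicator) auto
  finally show ?thesis .
qed

lemma control_dist_horizontal:
  assumes "x \<in> strip" "y \<in> strip" "x $ i3 = y $ i3"
  shows "d x y \<le> ennreal (sqrt ((y $ i1 - x $ i1)\<^sup>2 + (mid (y - x))\<^sup>2))"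
  using assms by (intro control_dist_linepath) (auto simp: length_element_def)

lemma control_dist_vertical:
  assumes "x \<in> strip" "\<And>i. i \<noteq> i3 \<Longrightarrow> x $ i = y $ i" "x $ i1 \<noteq> 0"
  shows "d x y \<le> ennreal (\<bar>y $ i3 - x $ i3\<bar> / f (x $ i1))"
proof (rule control_dist_linepath)
  have e: "x $ i1 = y $ i1" using assms(2) i13 by simp
  show "y \<in> strip" using assms(1) e by (simp add: strip_def)
  have "mid (y - x) = 0"
    using assms(2) by (simp add: mid_norm_def)
  then show "length_element F i1 i3 (linepath x y t) (y - x) \<le> ennreal (\<bar>y $ i3 - x $ i3\<bar> / f (x $ i1))" for t
    using assms(3) e f_nonneg[of "x $ i1"] by (auto simp: length_element_def linepath_def real_sqrt_divide
      scaleR_conv_of_real algebra_simps)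
qed (rule assms)

text \<open>The vertical move is made last, at the first coordinate of y. In the cone y lies farther
  from the degenerate hyperplane than x, so vertical motion is cheaper there.\<close>

lemma control_dist_corner:
  assumes "x \<in> strip" "y \<in> strip" "y $ i1 \<noteq> 0"
  shows "d x y \<le> ennreal (sqrt ((y $ i1 - x $ i1)\<^sup>2 + (mid (y - x))\<^sup>2) + \<bar>y $ i3 - x $ i3\<bar> / f (y $ i1))"
proof -
  define w where "w = (\<chi> i. if i = i3 then x $ i3 else y $ i)"
  have w: "w \<in> strip" "w $ i1 = y $ i1" "w $ i3 = x $ i3" "mid (w - x) = mid (y - x)"
    using assms i13 by (auto simp: w_def strip_def mid_norm_def intro!: sum.cong)
  have "d x y \<le> d x w + d w y" by (rule control_dist_triangle)
  also have "\<dots> \<le> ennreal (sqrt ((y $ i1 - x $ i1)\<^sup>2 + (mid (y - x))\<^sup>2)) + ennreal (\<bar>y $ i3 - x $ i3\<bar> / f (y $ i1))"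
    using control_dist_horizontal[of x w] control_dist_vertical[of w y] assms w
    by (intro add_mono) (auto simp: w_def)
  finally show ?thesis using f_nonneg by (simp add: ennreal_plus)
qed

text \<open>Both endpoints may lie on the degenerate hyperplane, where vertical motion is
  impossible; the vertical move is made at an auxiliary coordinate q off it. This gives finiteness
  of d and its smallness near the diagonal.\<close>

lemma control_dist_detour:
  assumes "x \<in> strip" "y \<in> strip" "q \<noteq> 0" "\<bar>q\<bar> < R"
  shows "d x y \<le> ennreal (sqrt ((q - x $ i1)\<^sup>2 + (mid (y - x))\<^sup>2) + \<bar>y $ i3 - x $ i3\<bar> / f q + \<bar>y $ i1 - q\<bar>)"
proof -
  define w where "w = (\<chi> i. if i = i1 then q else y $ i)"
  have w: "w \<in> strip" "w $ i1 = q" "w $ i3 = y $ i3" "mid (w - x) = mid (y - x)" "mid (y - w) = 0"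
    using assms i13 by (auto simp: w_def strip_def mid_norm_def intro!: sum.cong)
  have "d x y \<le> d x w + d w y" by (rule control_dist_triangle)
  also have "\<dots> \<le> ennreal (sqrt ((q - x $ i1)\<^sup>2 + (mid (y - x))\<^sup>2) + \<bar>y $ i3 - x $ i3\<bar> / f q) + ennreal \<bar>y $ i1 - q\<bar>"
    using control_dist_horizontal[of w y] control_dist_corner[of x w] assms w by (intro add_mono) auto
  finally show ?thesis using f_nonneg by (simp add: ennreal_plus[symmetric] del: ennreal_plus)
qed

lemma control_dist_finite: "x \<in> strip \<Longrightarrow> y \<in> strip \<Longrightarrow> d x y < \<infinity>"
  using control_dist_detour[of x y "R / 2"] R_pos by (auto intro: le_less_trans)

lemma control_dist_small:
  assumes x: "x \<in> strip" and e: "0 < e"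
  shows "eventually (\<lambda>y. y \<in> strip \<and> d x y < ennreal e \<and> d y x < ennreal e) (nhds x)"
proof -
  \<comment> \<open>Even for y = x the detour costs twice the distance from q to the first
    coordinate of x, hence the bound e / 2.\<close>
  obtain q where q: "q \<noteq> 0" "\<bar>q\<bar> < R" "\<bar>q - x $ i1\<bar> < e / 2"
  proof (cases "x $ i1 = 0")
    case True then show ?thesis using e R_pos that[of "min (e / 4) (R / 2)"] by auto
  next
    case False then show ?thesis using x e that[of "x $ i1"] by (auto simp: strip_def)
  qed
  define g where "g y = sqrt ((q - x $ i1)\<^sup>2 + (mid (y - x))\<^sup>2) + \<bar>y $ i3 - x $ i3\<bar> / f q + \<bar>y $ i1 - q\<bar>" for y
  define h where "h y = sqrt ((q - y $ i1)\<^sup>2 + (mid (x - y))\<^sup>2) + \<bar>x $ i3 - y $ i3\<bar> / f q + \<bar>x $ i1 - q\<bar>" for y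
  have "isCont g x" "isCont h x"
    unfolding g_def h_def mid_norm_def using q by (intro continuous_intros; simp)+
  then have "(g \<longlongrightarrow> g x) (nhds x)" "(h \<longlongrightarrow> h x) (nhds x)"
    by (auto simp: isCont_def tendsto_at_iff_tendsto_nhds)
  moreover have "g x < e" "h x < e" using q by (auto simp: g_def h_def mid_norm_def abs_minus_commute)
  ultimately have "eventually (\<lambda>y. g y < e) (nhds x)" "eventually (\<lambda>y. h y < e) (nhds x)"
    by (auto intro: order_tendstoD)
  moreover have "eventually (\<lambda>y. y \<in> strip) (nhds x)"
    using open_strip x by (rule eventually_nhds_in_open)
  ultimately show ?thesis
  proof eventually_elim
    case (elim y)
    then have "d x y \<le> ennreal (g y)" "d y x \<le> ennreal (h y)"
      using control_dist_detour[OF x _ q(1,2), of y] control_dist_detour[OF _ x q(1,2), of y]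
      by (auto simp: g_def h_def)
    moreover have "ennreal (g y) < ennreal e" "ennreal (h y) < ennreal e"
      using elim e by (auto intro: ennreal_lessI)
    ultimately show ?case using elim by (auto intro: le_less_trans)
  qed
qed

text \<open>This is joint upper semicontinuity of d. It makes the balls open and d jointly Borel,
  and follows from the triangle inequality and \<open>control_dist_small\<close> at both
  endpoints.\<close>

lemma open_control_dist_less: "open {(x, y). d x y < c}"
proof (subst open_subopen, intro ballI)
  fix z assume "z \<in> {(x, y). d x y < c}"
  then obtain x y where z: "z = (x, y)" "d x y < c" by auto
  have "d x y < \<infinity>" using z(2) by (auto intro: less_le_trans)
  then have xy: "x \<in> strip" "y \<in> strip" using control_dist_strip by auto
  obtain D where D: "d x y = ennreal D" "0 \<le> D" using \<open>d x y < \<infinity>\<close> by (cases "d x y") auto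
  have "\<exists>e>0. ennreal (D + 2 * e) \<le> c"
  proof (cases c)
    case (real c')
    then show ?thesis using z(2) D by (intro exI[of _ "(c' - D) / 2"]) (auto simp: ennreal_less_iff field_simps simp del: ennreal_plus)
  qed (auto intro: exI[of _ 1])
  then obtain e where e: "0 < e" "ennreal (D + 2 * e) \<le> c" by blast
  obtain U where U: "open U" "x \<in> U" "\<And>x'. x' \<in> U \<Longrightarrow> d x' x < ennreal e"
    using control_dist_small[OF xy(1) e(1)] unfolding eventually_nhds by blast
  obtain V where V: "open V" "y \<in> V" "\<And>y'. y' \<in> V \<Longrightarrow> d y y' < ennreal e"
    using control_dist_small[OF xy(2) e(1)] unfolding eventually_nhds by blast
  show "\<exists>T. open T \<and> z \<in> T \<and> T \<subseteq> {(x, y). d x y < c}"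
  proof (intro exI conjI)
    show "open (U \<times> V)" using U V by (intro open_Times)
    show "z \<in> U \<times> V" using U V z by simp
    show "U \<times> V \<subseteq> {(x, y). d x y < c}"
    proof clarify
      fix x' y' assume "x' \<in> U" "y' \<in> V"
      have "d x' y' \<le> d x' x + (d x y + d y y')"
        by (meson add_left_mono control_dist_triangle order_trans)
      also have "\<dots> < ennreal e + (ennreal D + ennreal e)"
        unfolding D(1) using U(3)[OF \<open>x' \<in> U\<close>] V(3)[OF \<open>y' \<in> V\<close>]
        by (intro add_strict_mono ennreal_add_left_cancel_less[THEN iffD2]) auto
      also have "\<dots> = ennreal (D + 2 * e)" using D e by (simp flip: ennreal_plus)
      finally show "d x' y' < c" using e by simp
    qed
  qed
qed

lemma measurable_control_dist [measurable]: "(\<lambda>(x, y). d x y) \<in> borel_measurable (borel \<Otimes>\<^sub>M borel)"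
  unfolding borel_prod
proof (rule borel_measurableI_less)
  fix c
  have "{z. (case z of (x, y) \<Rightarrow> d x y) < c} = {(x, y). d x y < c}" by auto
  then show "{z \<in> space borel. (case z of (x, y) \<Rightarrow> d x y) < c} \<in> sets borel"
    using open_control_dist_less[of c] by simp
qed

lemma control_dist_component:
  assumes "d x y < ennreal D" "i \<noteq> i3"
  shows "\<bar>y $ i - x $ i\<bar> < D"
proof -
  obtain \<gamma> where g: "admissible \<gamma>" "pathstart \<gamma> = x" "pathfinish \<gamma> = y" "curve_length F i1 i3 \<gamma> < D"
    using assms(1) by (rule control_dist_lessD)
  have "ennreal \<bar>y $ i - x $ i\<bar> \<le> (\<integral>\<^sup>+s\<in>{0..1}. ennreal \<bar>vector_derivative \<gamma> (at s) $ i\<bar> \<partial>lborel)"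
    using path_component_bound[of \<gamma> 1 i] g by (simp add: admissible_def pathstart_def pathfinish_def)
  also have "\<dots> \<le> curve_length F i1 i3 \<gamma>"
    unfolding curve_length_def using assms(2)
    by (intro nn_integral_mono mult_right_mono abs_component_le_length_element) auto
  finally show ?thesis using g(4) by (auto simp: ennreal_less_iff dest: le_less_trans)
qed

text \<open>A path of length less than D cannot leave the slab where the first coordinate is at most
  \<open>\<bar>x $ i1\<bar> + D\<close> in absolute value. There f is at most its value at the edge,
  and the vertical velocity is at most f times the speed.\<close>

lemma control_dist_vertical_bound:
  assumes "d x y < ennreal D" "\<bar>x $ i1\<bar> + D < R"
  shows "\<bar>y $ i3 - x $ i3\<bar> \<le> D * f (\<bar>x $ i1\<bar> + D)"
proof -
  have D: "0 < D" using assms(1) by (cases "0 < D") (auto simp: ennreal_neg)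
  obtain \<gamma> where g: "admissible \<gamma>" "pathstart \<gamma> = x" "pathfinish \<gamma> = y" "curve_length F i1 i3 \<gamma> < D"
    using assms(1) by (rule control_dist_lessD)
  have f: "f (\<gamma> t $ i1) \<le> f (\<bar>x $ i1\<bar> + D)" if "t \<in> {0..1}" for t
  proof (rule f_mono_abs)
    have "ennreal \<bar>\<gamma> t $ i1 - x $ i1\<bar> \<le> (\<integral>\<^sup>+s\<in>{0..1}. ennreal \<bar>vector_derivative \<gamma> (at s) $ i1\<bar> \<partial>lborel)"
      using path_component_bound[of \<gamma> t i1] g that by (simp add: admissible_def pathstart_def)
    also have "\<dots> \<le> curve_length F i1 i3 \<gamma>"
      unfolding curve_length_def using i13
      by (intro nn_integral_mono mult_right_mono abs_component_le_length_element) auto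
    finally have "\<bar>\<gamma> t $ i1 - x $ i1\<bar> < D" using g(4) by (auto simp: ennreal_less_iff dest: le_less_trans)
    then show "\<bar>\<gamma> t $ i1\<bar> \<le> \<bar>x $ i1\<bar> + D" by linarith
  qed (rule assms)
  have fp: "0 < f (\<bar>x $ i1\<bar> + D)" using D by (intro f_pos) auto
  have "ennreal \<bar>y $ i3 - x $ i3\<bar> \<le> (\<integral>\<^sup>+s\<in>{0..1}. ennreal \<bar>vector_derivative \<gamma> (at s) $ i3\<bar> \<partial>lborel)"
    using path_component_bound[of \<gamma> 1 i3] g by (simp add: admissible_def pathstart_def pathfinish_def)
  also have "\<dots> \<le> (\<integral>\<^sup>+s. ennreal (f (\<bar>x $ i1\<bar> + D)) * speed \<gamma> s \<partial>lborel)"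
    using abs_vertical_le_length_element[OF f fp, where v = "vector_derivative \<gamma> (at _)"]
    by (intro nn_integral_mono) (auto simp: indicator_def)
  also have "\<dots> = ennreal (f (\<bar>x $ i1\<bar> + D)) * curve_length F i1 i3 \<gamma>"
    unfolding curve_length_def using measurable_speed[OF g(1)] by (intro nn_integral_cmult) simp
  also have "\<dots> \<le> ennreal (f (\<bar>x $ i1\<bar> + D)) * ennreal D"
    using g(4) by (intro mult_left_mono) auto
  finally show ?thesis using fp D by (simp add: ennreal_mult[symmetric] mult.commute)
qed

end

section \<open>Volumes of control balls\<close>

lemma content_cbox_center:
  fixes c w :: "'n::finite \<Rightarrow> real"
  assumes "\<And>i. 0 \<le> w i"
  shows "measure lborel (cbox (\<chi> i. c i - w i) (\<chi> i. c i + w i)) = (\<Prod>i\<in>UNIV. 2 * w i)"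
proof -
  have "(\<chi> i. c i) \<in> cbox (\<chi> i. c i - w i) (\<chi> i. c i + w i)"
    using assms by (simp add: mem_box_cart)
  then show ?thesis by (subst content_cbox_cart) auto
qed

lemma mem_cbox_center:
  fixes y :: "real^'n::finite"
  shows "y \<in> cbox (\<chi> i. c i - w i) (\<chi> i. c i + w i) \<longleftrightarrow> (\<forall>i. \<bar>y $ i - c i\<bar> \<le> w i)"
  by (auto simp: mem_box_cart abs_le_iff algebra_simps)

lemma prod_UNIV_split2:
  fixes g :: "'n::finite \<Rightarrow> real"
  assumes "i1 \<noteq> i3" "\<And>i. i \<noteq> i1 \<Longrightarrow> i \<noteq> i3 \<Longrightarrow> g i = c"
  shows "(\<Prod>i\<in>UNIV. g i) = g i1 * g i3 * c ^ (CARD('n) - 2)"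
proof -
  have "(\<Prod>i\<in>UNIV. g i) = g i1 * (g i3 * (\<Prod>i\<in>UNIV - {i1} - {i3}. g i))"
    using assms(1) by (simp add: prod.remove[of UNIV i1] prod.remove[of "UNIV - {i1}" i3])
  also have "(\<Prod>i\<in>UNIV - {i1} - {i3}. g i) = (\<Prod>i\<in>UNIV - {i1} - {i3}. c)"
    using assms(2) by (intro prod.cong) auto
  also have "\<dots> = c ^ (CARD('n) - 2)"
    using assms(1) by (simp add: card_Diff_singleton_if numeral_2_eq_2)
  finally show ?thesis by simp
qed

lemma sqrt_add_le: "0 < t \<Longrightarrow> 0 \<le> M \<Longrightarrow> sqrt (t\<^sup>2 + M) \<le> t + M / (2 * t)"
  by (rule real_le_lsqrt) (auto simp: power2_sum field_simps power2_eq_square)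

context degenerate_metric
begin

abbreviation dball :: "real^'n \<Rightarrow> real \<Rightarrow> (real^'n) set" where "dball \<equiv> control_ball F R i1 i3"

lemma n_ge_2: "2 \<le> CARD('n)"
proof -
  have "card {i1, i3} \<le> CARD('n)" by (intro card_mono) auto
  then show ?thesis using i13 by simp
qed

lemma mem_dball: "y \<in> dball x D \<longleftrightarrow> d x y < ennreal D"
  by (simp add: control_ball_def)

lemma open_ball: "open (dball x D)"
proof -
  have "dball x D = (\<lambda>y. (x, y)) -` {(x, y). d x y < ennreal D}" by (auto simp: mem_dball)
  then show ?thesis
    using open_vimage[OF open_control_dist_less[of "ennreal D"], of "\<lambda>y. (x, y)"] by (simp add: continuous_intros)
qed

lemma sets_ball [measurable]: "dball x D \<in> sets borel"
  using open_ball by simp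

lemma ball_subset_cbox:
  assumes "0 < D" "\<bar>x $ i1\<bar> + D < R"
  shows "dball x D \<subseteq> cbox (\<chi> i. x $ i - (if i = i3 then D * f (\<bar>x $ i1\<bar> + D) else D))
    (\<chi> i. x $ i + (if i = i3 then D * f (\<bar>x $ i1\<bar> + D) else D))"
proof
  fix y assume "y \<in> dball x D"
  then have "d x y < ennreal D" by (simp add: mem_dball)
  then have "\<bar>y $ i - x $ i\<bar> \<le> (if i = i3 then D * f (\<bar>x $ i1\<bar> + D) else D)" for i
    using control_dist_component[of x y D i] control_dist_vertical_bound[of x y D] assms by auto
  then show "y \<in> cbox (\<chi> i. x $ i - (if i = i3 then D * f (\<bar>x $ i1\<bar> + D) else D))
    (\<chi> i. x $ i + (if i = i3 then D * f (\<bar>x $ i1\<bar> + D) else D))"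
    unfolding mem_cbox_center by blast
qed

lemma emeasure_ball_finite:
  assumes "0 < D" "\<bar>x $ i1\<bar> + D < R"
  shows "emeasure lborel (dball x D) < \<infinity>"
  using emeasure_mono[OF ball_subset_cbox[OF assms], of lborel] emeasure_lborel_cbox_finite
  by (auto intro: le_less_trans)

lemma measure_ball_le:
  assumes "0 < D" "\<bar>x $ i1\<bar> + D < R"
  shows "measure lborel (dball x D) \<le> (2 * D) ^ CARD('n) * f (\<bar>x $ i1\<bar> + D)"
proof -
  let ?w = "\<lambda>i. if i = i3 then D * f (\<bar>x $ i1\<bar> + D) else D"
  have "measure lborel (dball x D) \<le> measure lborel (cbox (\<chi> i. x $ i - ?w i) (\<chi> i. x $ i + ?w i))"
    using ball_subset_cbox[OF assms] emeasure_lborel_cbox_finite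
    by (intro measure_mono_fmeasurable) (auto simp: fmeasurable_def)
  also have "\<dots> = (\<Prod>i\<in>UNIV. 2 * ?w i)"
    using assms f_nonneg by (intro content_cbox_center) auto
  also have "\<dots> = (2 * D) * (2 * (D * f (\<bar>x $ i1\<bar> + D))) * (2 * D) ^ (CARD('n) - 2)"
    using i13 by (subst prod_UNIV_split2[of i1 i3 _ "2 * D"]) auto
  also have "\<dots> = (2 * D) ^ Suc (Suc (CARD('n) - 2)) * f (\<bar>x $ i1\<bar> + D)" by simp
  finally show ?thesis using n_ge_2 by (simp add: Suc_diff_Suc numeral_2_eq_2)
qed

text \<open>This is \<open>d_hat\<close> as a function of \<open>\<xi> = \<bar>x $ i1\<bar>\<close>
  and the distance D. It also measures the thickness of the outer layer of the ball on which f is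
  comparable to its maximum.\<close>

definition trunc :: "real \<Rightarrow> real \<Rightarrow> real" where
  "trunc \<xi> D = min D (1 / p (\<xi> + D))"

lemma trunc_pos: "0 \<le> \<xi> \<Longrightarrow> 0 < D \<Longrightarrow> \<xi> + D < R \<Longrightarrow> 0 < trunc \<xi> D"
  using p_pos[of "\<xi> + D"] by (simp add: trunc_def)

lemma trunc_le: "trunc \<xi> D \<le> D"
  by (simp add: trunc_def)

lemma trunc_mono: "0 \<le> \<xi> \<Longrightarrow> 0 < t \<Longrightarrow> t \<le> D \<Longrightarrow> \<xi> + D < R \<Longrightarrow> trunc \<xi> t \<le> trunc \<xi> D"
  using p_anti[of "\<xi> + t" "\<xi> + D"] p_pos[of "\<xi> + D"] by (auto simp: trunc_def min_def frac_le intro: order_trans)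

text \<open>The loss in \<open>measure_ball_ge\<close>: 2 / 64 from two sides proportional to
  \<open>trunc \<xi> D / 8\<close>, \<open>exp (- (3/2))\<close> from the variation of f over the
  layer, and \<open>1 / (2 * sqrt n)\<close> from each middle direction.\<close>

definition vol_const :: real where
  "vol_const = exp (- (3/2)) / 32 * (1 / (2 * sqrt CARD('n))) ^ (CARD('n) - 2)"

lemma vol_const_pos: "0 < vol_const"
  by (simp add: vol_const_def)

text \<open>Move away from the hyperplane \<open>x\<^sub>1 = 0\<close> by nearly \<open>D\<close>, leaving just enough length to
  travel vertically where \<open>f\<close> is comparable to its largest value.\<close>

lemma measure_ball_ge:
  assumes x: "x $ i1 \<noteq> 0" and D: "0 < D" and \<xi>: "\<xi> = \<bar>x $ i1\<bar>" and r: "\<xi> + D < r0"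
  shows "vol_const * (f (\<xi> + D) * (trunc \<xi> D)\<^sup>2 * sqrt (D * trunc \<xi> D) ^ (CARD('n) - 2)) \<le> measure lborel (dball x D)"
proof -
  let ?h = "trunc \<xi> D"
  \<comment> \<open>The unit of a length budget. The horizontal leg advances between
    \<open>D - 3 * \<eta>\<close> and \<open>D - 2 * \<eta>\<close>, the middle displacement adds at
    most \<open>\<eta> / 2\<close> and the vertical leg at most \<open>\<eta>\<close>, in total at
    most \<open>D - \<eta> / 2\<close>.\<close>
  define \<eta> where "\<eta> = ?h / 8"
  \<comment> \<open>A sideways displacement costs only its square divided by the length travelled,
    so it may be of size \<open>sqrt (D * \<eta>)\<close> rather than \<open>\<eta>\<close>; the
    divisor shares this among the middle coordinates.\<close>
  define m where "m = sqrt (D * \<eta> / (2 * CARD('n)))"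
  define \<sigma> where "\<sigma> = sgn (x $ i1)"
  define c where "c i = (if i = i1 then x $ i1 + \<sigma> * (D - 5 / 2 * \<eta>) else x $ i)" for i
  define w where "w i = (if i = i1 then \<eta> / 2 else if i = i3 then \<eta> * (exp (- (3/2)) * f (\<xi> + D)) else m)" for i
  have \<xi>pos: "0 < \<xi>" using x \<xi> by simp
  have R: "\<xi> + D < R" using r r0 by simp
  have \<eta>: "0 < \<eta>" "\<eta> \<le> D / 8" "\<eta> * p (\<xi> + D) \<le> 1 / 8"
    using trunc_pos[of \<xi> D] \<xi>pos D R trunc_le[of \<xi> D] p_pos[of "\<xi> + D"]
    by (auto simp: \<eta>_def trunc_def min_def field_simps split: if_splits)
  \<comment> \<open>The inner edge of the layer. As \<open>(\<xi> + D) / u\<close> is at most 2,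
    doubling gives \<open>p u\<close> at most four times \<open>p (\<xi> + D)\<close>, and f loses
    at most \<open>exp (3 / 2)\<close> across the layer.\<close>
  define u where "u = \<xi> + D - 3 * \<eta>"
  have u: "0 < u" "(\<xi> + D) / u \<le> 2" "u \<le> \<xi> + D" using \<eta> \<xi>pos D by (auto simp: u_def field_simps)
  have "p u \<le> ((\<xi> + D) / u)\<^sup>2 * p (\<xi> + D)" using u r by (intro p_double) auto
  also have "\<dots> \<le> 2\<^sup>2 * p (\<xi> + D)"
    using u p_pos[of "\<xi> + D"] \<xi>pos D R by (intro mult_right_mono power_mono) auto
  finally have "3 * \<eta> * p u \<le> 3 * \<eta> * (4 * p (\<xi> + D))" using \<eta> by (intro mult_left_mono) auto
  also have "3 * \<eta> * (4 * p (\<xi> + D)) = 12 * (\<eta> * p (\<xi> + D))" by simp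
  also have "\<dots> \<le> 3 / 2" using \<eta>(3) by simp
  finally have pu: "3 * \<eta> * p u \<le> 3 / 2" .
  have "f (\<xi> + D) \<le> exp (3 * \<eta> * p u) * f u"
    using f_ratio[of u "\<xi> + D"] u R by (simp add: u_def)
  also have "\<dots> \<le> exp (3 / 2) * f u" using pu f_nonneg by (intro mult_right_mono) auto
  finally have fu: "exp (- (3/2)) * f (\<xi> + D) \<le> f u" by (simp add: exp_minus field_simps)
  have fpos: "0 < f (\<xi> + D)" using \<xi>pos D by (intro f_pos) auto
  have m: "0 \<le> m" "real CARD('n) * m\<^sup>2 = D * \<eta> / 2" using D \<eta> n_ge_2 by (auto simp: m_def)
  have w0: "0 \<le> w i" for i using \<eta> fpos m by (simp add: w_def)
  have sub: "cbox (\<chi> i. c i - w i) (\<chi> i. c i + w i) \<subseteq> dball x D"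
  proof
    fix y assume "y \<in> cbox (\<chi> i. c i - w i) (\<chi> i. c i + w i)"
    then have y: "\<bar>y $ i - c i\<bar> \<le> w i" for i by (simp only: mem_cbox_center)
    define \<tau> where "\<tau> = \<bar>y $ i1\<bar> - \<xi>"
    have y1: "\<bar>y $ i1 - (x $ i1 + \<sigma> * (D - 5 / 2 * \<eta>))\<bar> \<le> \<eta> / 2"
      using y[of i1] by (simp add: c_def w_def)
    have \<tau>: "D - 3 * \<eta> \<le> \<tau>" "\<tau> \<le> D - 2 * \<eta>" "(y $ i1 - x $ i1)\<^sup>2 = \<tau>\<^sup>2"
      using y1 x \<eta> D by (auto simp: \<tau>_def \<xi> \<sigma>_def sgn_if abs_if power2_eq_square algebra_simps split: if_splits)
    have y1R: "u \<le> \<bar>y $ i1\<bar>" "\<bar>y $ i1\<bar> < R" using \<tau> \<eta> R by (auto simp: \<tau>_def u_def)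
    have "(mid (y - x))\<^sup>2 = (\<Sum>i\<in>UNIV - {i1, i3}. (y $ i - x $ i)\<^sup>2)" by (simp add: mid_norm_power2)
    also have "\<dots> \<le> (\<Sum>i\<in>UNIV - {i1, i3}. m\<^sup>2)"
    proof (intro sum_mono)
      fix i assume "i \<in> UNIV - {i1, i3}"
      then show "(y $ i - x $ i)\<^sup>2 \<le> m\<^sup>2" using y[of i] m by (simp add: c_def w_def power2_le_iff_abs_le)
    qed
    also have "\<dots> \<le> real CARD('n) * m\<^sup>2" by (simp add: mult_right_mono card_mono)
    finally have M: "(mid (y - x))\<^sup>2 \<le> D * \<eta> / 2" using m by simp
    have \<tau>D: "D / 2 \<le> \<tau>" using \<tau> \<eta> by simp
    have "sqrt ((y $ i1 - x $ i1)\<^sup>2 + (mid (y - x))\<^sup>2) \<le> \<tau> + (mid (y - x))\<^sup>2 / (2 * \<tau>)"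
      unfolding \<tau>(3) using \<tau>D D by (intro sqrt_add_le) auto
    also have "(mid (y - x))\<^sup>2 / (2 * \<tau>) \<le> (D * \<eta> / 2) / (2 * (D / 2))"
      using M \<tau>D D \<eta> by (intro frac_le) auto
    also have "\<dots> = \<eta> / 2" using D by simp
    finally have 1: "sqrt ((y $ i1 - x $ i1)\<^sup>2 + (mid (y - x))\<^sup>2) \<le> D - 3 / 2 * \<eta>" using \<tau> by simp
    have "f u \<le> f (y $ i1)" using f_mono[of u "\<bar>y $ i1\<bar>"] u y1R by simp
    then have fy: "exp (- (3/2)) * f (\<xi> + D) \<le> f (y $ i1)" using fu by simp
    have "\<bar>y $ i3 - x $ i3\<bar> \<le> \<eta> * (exp (- (3/2)) * f (\<xi> + D))"
      using y[of i3] i13 by (simp add: c_def w_def)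
    also have "\<dots> \<le> \<eta> * f (y $ i1)" using fy \<eta> by (intro mult_left_mono) auto
    finally have 2: "\<bar>y $ i3 - x $ i3\<bar> / f (y $ i1) \<le> \<eta>"
      using fy fpos f_pos[of "y $ i1"] y1R u by (auto simp: field_simps)
    have "d x y \<le> ennreal (sqrt ((y $ i1 - x $ i1)\<^sup>2 + (mid (y - x))\<^sup>2) + \<bar>y $ i3 - x $ i3\<bar> / f (y $ i1))"
      using x \<xi> R D y1R u by (intro control_dist_corner) (auto simp: strip_def)
    also have "\<dots> < ennreal D" using 1 2 \<eta> D by (intro ennreal_lessI) auto
    finally show "y \<in> dball x D" by (simp add: mem_dball)
  qed
  have "\<xi> + D < R" "\<bar>x $ i1\<bar> + D < R" using R \<xi> by auto
  then have "measure lborel (cbox (\<chi> i. c i - w i) (\<chi> i. c i + w i)) \<le> measure lborel (dball x D)"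
    using sub emeasure_ball_finite[of D x] D by (intro measure_mono_fmeasurable) (auto simp: fmeasurable_def)
  also have "measure lborel (cbox (\<chi> i. c i - w i) (\<chi> i. c i + w i)) = (\<Prod>i\<in>UNIV. 2 * w i)"
    by (intro content_cbox_center w0)
  also have "\<dots> = \<eta> * (2 * (\<eta> * (exp (- (3/2)) * f (\<xi> + D)))) * (2 * m) ^ (CARD('n) - 2)"
    using i13 by (subst prod_UNIV_split2[of i1 i3 _ "2 * m"]) (auto simp: w_def)
  also have "2 * m = sqrt (D * ?h) * (1 / (2 * sqrt CARD('n)))"
  proof -
    have "(2::real) = sqrt 4" by simp
    then have "2 * m = sqrt (4 * (D * \<eta> / (2 * CARD('n))))" unfolding m_def by (metis real_sqrt_mult)
    also have "4 * (D * \<eta> / (2 * CARD('n))) = D * ?h * (1 / (4 * CARD('n)))" by (simp add: \<eta>_def)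
    also have "sqrt \<dots> = sqrt (D * ?h) * (1 / (2 * sqrt CARD('n)))" by (simp add: real_sqrt_mult real_sqrt_divide)
    finally show ?thesis .
  qed
  also have "\<eta> * (2 * (\<eta> * (exp (- (3/2)) * f (\<xi> + D)))) * (sqrt (D * ?h) * (1 / (2 * sqrt CARD('n)))) ^ (CARD('n) - 2)
    = vol_const * (f (\<xi> + D) * ?h\<^sup>2 * sqrt (D * ?h) ^ (CARD('n) - 2))"
    unfolding power_mult_distrib by (simp add: vol_const_def \<eta>_def power2_eq_square)
  finally show ?thesis .
qed

end

section \<open>Turning points of geodesics\<close>

text \<open>The densities below are singular at the turning point, where division by zero makes
  their value 0, so comparisons hold only on the open interval.\<close>

lemma integral_le_Ioo:
  fixes g h :: "real \<Rightarrow> real"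
  assumes "g integrable_on {a..b}" "h integrable_on {a..b}" "\<And>u. u \<in> {a<..<b} \<Longrightarrow> g u \<le> h u"
  shows "integral {a..b} g \<le> integral {a..b} h"
proof -
  have "(g has_integral integral {a..b} g) {a<..<b}" "(h has_integral integral {a..b} h) {a<..<b}"
    using assms(1,2) by (auto simp: has_integral_Icc_iff_Ioo[symmetric] integrable_integral)
  then show ?thesis using assms(3) by (rule has_integral_le)
qed

context degenerate_geometry
begin

text \<open>Length per unit of the first coordinate along the plane geodesic whose tangent becomes
  vertical at b; \<open>height_density\<close> is its vertical rise.\<close>

definition arc_density :: "real \<Rightarrow> real \<Rightarrow> real" where
  "arc_density b u = f b / sqrt ((f b)\<^sup>2 - (f u)\<^sup>2)"

definition height_density :: "real \<Rightarrow> real \<Rightarrow> real" where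
  "height_density b u = (f u)\<^sup>2 / sqrt ((f b)\<^sup>2 - (f u)\<^sup>2)"

text \<open>The length of the geodesic from x up to its turning point x + s, so that
  \<open>r_star F R x\<close> inverts \<open>arc x\<close>.\<close>

definition arc :: "real \<Rightarrow> real \<Rightarrow> real" where
  "arc x s = integral {x..x + s} (arc_density (x + s))"

lemma f_sq_less: "0 \<le> u \<Longrightarrow> u < b \<Longrightarrow> b < R \<Longrightarrow> (f u)\<^sup>2 < (f b)\<^sup>2"
  using f_strict_mono[of u b] f_nonneg by (intro power_strict_mono) auto

lemma continuous_on_sqrt_diff:
  assumes "0 \<le> x" "b < R"
  shows "continuous_on {x..b} (\<lambda>u. sqrt ((f b)\<^sup>2 - (f u)\<^sup>2))"
  using assms by (intro continuous_intros continuous_on_subset[OF continuous_on_f]) auto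

text \<open>As f' = f p, the weight p turns the height density into an exact derivative. The
  unweighted integrals are then estimated by comparing p with its smallest value
  \<open>p b\<close>.\<close>

lemma height_density_p_integral:
  assumes "0 < x" "x < b" "b < R"
  shows "((\<lambda>u. height_density b u * p u) has_integral sqrt ((f b)\<^sup>2 - (f x)\<^sup>2)) {x..b}"
proof -
  have "((\<lambda>u. height_density b u * p u) has_integral
      (- sqrt ((f b)\<^sup>2 - (f b)\<^sup>2) - (- sqrt ((f b)\<^sup>2 - (f x)\<^sup>2)))) {x..b}"
  proof (rule fundamental_theorem_of_calculus_interior)
    show "continuous_on {x..b} (\<lambda>u. - sqrt ((f b)\<^sup>2 - (f u)\<^sup>2))"
      using assms by (intro continuous_on_minus continuous_on_sqrt_diff) auto
    fix u assume u: "u \<in> {x<..<b}"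
    then have "(f u)\<^sup>2 < (f b)\<^sup>2" using assms by (intro f_sq_less) auto
    then have "((\<lambda>u. - sqrt ((f b)\<^sup>2 - (f u)\<^sup>2)) has_real_derivative height_density b u * p u) (at u)"
      using u assms by (auto intro!: derivative_eq_intros f_deriv simp: height_density_def field_simps power2_eq_square)
    then show "((\<lambda>u. - sqrt ((f b)\<^sup>2 - (f u)\<^sup>2)) has_vector_derivative height_density b u * p u) (at u)"
      by (simp add: has_real_derivative_iff_has_vector_derivative)
  qed (use assms in simp)
  then show ?thesis by simp
qed

lemma continuous_on_densities:
  assumes "0 < x" "x < b" "b < R"
  shows "continuous_on {x<..<b} (height_density b)" "continuous_on {x<..<b} (arc_density b)"
proof -
  have "sqrt ((f b)\<^sup>2 - (f u)\<^sup>2) \<noteq> 0" if "u \<in> {x<..<b}" for u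
    using f_sq_less[of u b] that assms by auto
  moreover have "continuous_on {x<..<b} (\<lambda>u. sqrt ((f b)\<^sup>2 - (f u)\<^sup>2))"
    using continuous_on_sqrt_diff[of x b] assms by (auto elim: continuous_on_subset)
  moreover have "continuous_on {x<..<b} f"
    using assms by (auto intro: continuous_on_subset[OF continuous_on_f])
  ultimately show "continuous_on {x<..<b} (height_density b)" "continuous_on {x<..<b} (arc_density b)"
    unfolding height_density_def[abs_def] arc_density_def[abs_def] by (auto intro!: continuous_intros)
qed

lemma height_density_nonneg: "0 \<le> u \<Longrightarrow> u \<le> b \<Longrightarrow> b < R \<Longrightarrow> 0 \<le> height_density b u"
  using f_mono[of u b] f_nonneg by (auto simp: height_density_def intro!: divide_nonneg_nonneg power_mono)

lemma arc_density_nonneg: "0 \<le> u \<Longrightarrow> u \<le> b \<Longrightarrow> b < R \<Longrightarrow> 0 \<le> arc_density b u"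
  using f_mono[of u b] f_nonneg by (auto simp: arc_density_def intro!: divide_nonneg_nonneg power_mono)

lemma integrable_if_dominated_Ioo:
  fixes g h :: "real \<Rightarrow> real"
  assumes "continuous_on {x<..<b} g" "h integrable_on {x..b}" "\<And>u. u \<in> {x<..<b} \<Longrightarrow> \<bar>g u\<bar> \<le> h u"
  shows "g integrable_on {x..b}"
proof -
  have "g integrable_on {x<..<b}"
  proof (rule measurable_bounded_by_integrable_imp_integrable)
    show "g \<in> borel_measurable (lebesgue_on {x<..<b})"
      using assms(1) by (intro continuous_imp_measurable_on_sets_lebesgue) auto
    show "h integrable_on {x<..<b}"
      using assms(2) by (simp add: integrable_on_Icc_iff_Ioo)
  qed (use assms in auto)
  then show ?thesis by (simp add: integrable_on_Icc_iff_Ioo)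
qed

lemma height_density_le:
  assumes "0 < x" "x < b" "b < R" "u \<in> {x<..<b}"
  shows "height_density b u \<le> height_density b u * p u / p b"
proof -
  have "p b \<le> p u" using assms by (intro p_anti) auto
  then have "1 \<le> p u / p b" using p_pos[of b] assms by simp
  then have "height_density b u * 1 \<le> height_density b u * (p u / p b)"
    using assms by (intro mult_left_mono height_density_nonneg) auto
  then show ?thesis by simp
qed

lemma height_density_integrable:
  assumes "0 < x" "x < b" "b < R"
  shows "height_density b integrable_on {x..b}"
proof (rule integrable_if_dominated_Ioo)
  show "(\<lambda>u. height_density b u * p u / p b) integrable_on {x..b}"
    using height_density_p_integral[OF assms] by (intro integrable_on_divide) blast
qed (use continuous_on_densities[OF assms] height_density_le[OF assms] assms height_density_nonneg in auto)

lemma h_star_eq: "h_star F x s = integral {x..x + s} (height_density (x + s))"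
  by (simp add: h_star_def height_density_def[abs_def])

lemma h_star_le:
  assumes "0 < x" "0 < s" "x + s < R"
  shows "h_star F x s \<le> sqrt ((f (x + s))\<^sup>2 - (f x)\<^sup>2) / p (x + s)"
proof -
  have x: "x < x + s" using assms by simp
  have "h_star F x s \<le> integral {x..x + s} (\<lambda>u. height_density (x + s) u * p u / p (x + s))"
    unfolding h_star_eq
    using height_density_integrable[OF assms(1) x assms(3)] height_density_p_integral[OF assms(1) x assms(3)]
      height_density_le[OF assms(1) x assms(3)]
    by (intro integral_le_Ioo integrable_on_divide) auto
  also have "\<dots> = sqrt ((f (x + s))\<^sup>2 - (f x)\<^sup>2) / p (x + s)"
    using has_integral_divide[OF height_density_p_integral[OF assms(1) x assms(3)], of "p (x + s)"]
    by (rule integral_unique)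
  finally show ?thesis .
qed

lemma h_star_le_simple:
  assumes "0 < x" "0 < s" "x + s < R"
  shows "h_star F x s \<le> f (x + s) / p (x + s)"
proof -
  have "sqrt ((f (x + s))\<^sup>2 - (f x)\<^sup>2) \<le> sqrt ((f (x + s))\<^sup>2)" by (intro real_sqrt_le_mono) auto
  then have "sqrt ((f (x + s))\<^sup>2 - (f x)\<^sup>2) / p (x + s) \<le> f (x + s) / p (x + s)"
    using p_pos[of "x + s"] assms f_nonneg[of "x + s"] by (intro divide_right_mono) auto
  then show ?thesis using h_star_le[OF assms] by simp
qed

text \<open>With q the square root in the denominator, \<open>f b * (f b - q)\<close> is at most
  \<open>(f b + q) * (f b - q)\<close>, which is the square of \<open>f u\<close>. So the excess of
  arc length over s is controlled by the height.\<close>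

lemma arc_density_bounds:
  assumes "0 < x" "x < b" "b < R" "u \<in> {x<..<b}"
  shows "1 \<le> arc_density b u" "arc_density b u \<le> 1 + height_density b u / f b"
proof -
  define q where "q = sqrt ((f b)\<^sup>2 - (f u)\<^sup>2)"
  have q: "0 < q" "q\<^sup>2 = (f b)\<^sup>2 - (f u)\<^sup>2" using f_sq_less[of u b] assms by (auto simp: q_def)
  have fb: "0 < f b" using assms by (intro f_pos) auto
  have qb: "q \<le> f b" unfolding q_def using fb by (intro real_le_lsqrt) auto
  show "1 \<le> arc_density b u" using q qb by (simp add: arc_density_def q_def[symmetric])
  have "f b * (f b - q) \<le> (f b + q) * (f b - q)" using q qb by (intro mult_right_mono) auto
  also have "\<dots> = (f u)\<^sup>2" using q(2) by (simp add: power2_eq_square algebra_simps)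
  finally have "f b * f b \<le> f b * q + (f u)\<^sup>2" by (simp add: algebra_simps)
  then show "arc_density b u \<le> 1 + height_density b u / f b"
    using q(1) fb by (simp add: arc_density_def height_density_def q_def[symmetric] divide_simps)
      (simp add: algebra_simps)
qed

lemma arc_density_integrable:
  assumes "0 < x" "x < b" "b < R"
  shows "arc_density b integrable_on {x..b}"
proof (rule integrable_if_dominated_Ioo)
  show "(\<lambda>u. 1 + height_density b u / f b) integrable_on {x..b}"
    using height_density_integrable[OF assms] by (intro integrable_add integrable_on_divide) auto
qed (use continuous_on_densities[OF assms] arc_density_bounds[OF assms] in fastforce)+

lemma arc_has_integral:
  assumes "0 < x" "0 < s" "x + s < R"
  shows "(arc_density (x + s) has_integral arc x s) {x..x + s}"
  unfolding arc_def using assms arc_density_integrable[of x "x + s"] by (intro integrable_integral) auto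

lemma arc_le:
  assumes "0 < x" "0 < s" "x + s < R"
  shows "arc x s \<le> s + h_star F x s / f (x + s)"
proof -
  have x: "x < x + s" using assms by simp
  note h = height_density_integrable[OF assms(1) x assms(3)]
  have i: "(\<lambda>u. 1 + height_density (x + s) u / f (x + s)) integrable_on {x..x + s}"
    by (intro integrable_add integrable_on_divide h) auto
  have "arc x s \<le> integral {x..x + s} (\<lambda>u. 1 + height_density (x + s) u / f (x + s))"
    unfolding arc_def
    using arc_density_integrable[OF assms(1) x assms(3)] i arc_density_bounds(2)[OF assms(1) x assms(3)]
    by (intro integral_le_Ioo) auto
  also have "\<dots> = integral {x..x + s} (\<lambda>u. 1) + integral {x..x + s} (\<lambda>u. height_density (x + s) u / f (x + s))"
    by (intro integral_add integrable_on_divide h) auto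
  also have "\<dots> = s + h_star F x s / f (x + s)"
    using x by (simp add: h_star_eq)
  finally show ?thesis .
qed

text \<open>A radius exceeds its turning point by at most 1 / p there; this fixes the thickness of
  the cells.\<close>

lemma arc_le_simple:
  assumes "0 < x" "0 < s" "x + s < R"
  shows "arc x s \<le> s + 1 / p (x + s)"
proof -
  have "h_star F x s / f (x + s) \<le> f (x + s) / p (x + s) / f (x + s)"
    using h_star_le_simple[OF assms] f_nonneg by (intro divide_right_mono) auto
  also have "\<dots> = 1 / p (x + s)" using f_pos[of "x + s"] assms by simp
  finally show ?thesis using arc_le[OF assms] by simp
qed

text \<open>Unlike \<open>arc_le_simple\<close>, this bound tends to 0 with s. It comes from 1 -
  exp(-2h) <= 2h with h the drop of F, and it yields small arcs for existence and a lower bound for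
  \<open>r_star\<close>.\<close>

lemma arc_le_sqrt:
  assumes "0 < x" "0 < s" "x + s < R"
  shows "arc x s \<le> s + sqrt (2 * (s * p x)) / p (x + s)"
proof -
  let ?b = "x + s"
  have fb: "0 < f ?b" using assms by (intro f_pos) auto
  have "f x = f ?b * exp (- (F x - F ?b))" using assms by (simp add: f_eq mult_exp_exp)
  then have "(f x)\<^sup>2 = (f ?b)\<^sup>2 * exp (- 2 * (F x - F ?b))"
    by (simp add: power_mult_distrib exp_double[symmetric] power2_eq_square mult_exp_exp)
  then have "(f ?b)\<^sup>2 - (f x)\<^sup>2 = (f ?b)\<^sup>2 * (1 - exp (- 2 * (F x - F ?b)))"
    by (simp add: right_diff_distrib)
  also have "\<dots> \<le> (f ?b)\<^sup>2 * (2 * (F x - F ?b))"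
    using exp_ge_add_one_self[of "- 2 * (F x - F ?b)"] by (intro mult_left_mono) (linarith, simp)
  also have "\<dots> \<le> (f ?b)\<^sup>2 * (2 * (s * p x))"
    using F_diff_bounds(2)[of x ?b] assms by (intro mult_left_mono) auto
  finally have "sqrt ((f ?b)\<^sup>2 - (f x)\<^sup>2) \<le> f ?b * sqrt (2 * (s * p x))"
    using fb by (metis (no_types, lifting) abs_of_pos real_sqrt_abs real_sqrt_le_mono real_sqrt_mult)
  then have "h_star F x s \<le> f ?b * sqrt (2 * (s * p x)) / p ?b"
    using p_pos[of ?b] assms by (intro order_trans[OF h_star_le[OF assms]] divide_right_mono) auto
  then have "h_star F x s / f ?b \<le> sqrt (2 * (s * p x)) / p ?b"
    using fb by (simp add: field_simps)
  then show ?thesis using arc_le[OF assms] by simp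
qed

text \<open>Measuring from the turning point makes the density monotone in the position of that point.\<close>

lemma arc_density_shift:
  assumes "0 < v" "v < b" "b < R"
  shows "arc_density b (b - v) = 1 / sqrt (1 - exp (- 2 * (F (b - v) - F b)))"
proof -
  have fb: "0 < f b" using assms by (intro f_pos) auto
  have "f (b - v) = f b * exp (- (F (b - v) - F b))" using assms by (simp add: f_eq mult_exp_exp)
  then have "(f b)\<^sup>2 - (f (b - v))\<^sup>2 = (f b)\<^sup>2 * (1 - exp (- 2 * (F (b - v) - F b)))"
    by (simp add: power_mult_distrib power2_eq_square mult_exp_exp algebra_simps)
  then have "sqrt ((f b)\<^sup>2 - (f (b - v))\<^sup>2) = f b * sqrt (1 - exp (- 2 * (F (b - v) - F b)))"
    using fb by (simp add: real_sqrt_mult)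
  then show ?thesis using fb assms by (simp add: arc_density_def)
qed

lemma F_increment_anti:
  assumes "0 < v" "v < b" "b \<le> b'" "b' < R"
  shows "F (b' - v) - F b' \<le> F (b - v) - F b"
proof (rule DERIV_nonpos_imp_nonincreasing[OF assms(3), where f = "\<lambda>b. F (b - v) - F b"])
  fix y assume y: "b \<le> y" "y \<le> b'"
  have "((\<lambda>b. F (b - v) - F b) has_real_derivative (- p (y - v) - - p y)) (at y)"
  proof (rule DERIV_diff)
    have "((\<lambda>b. F (b - v)) has_real_derivative - p (y - v) * 1) (at y)"
      using y assms by (intro DERIV_chain2[OF F_deriv]) (auto intro!: derivative_eq_intros)
    then show "((\<lambda>b. F (b - v)) has_real_derivative - p (y - v)) (at y)" by simp
    show "(F has_real_derivative - p y) (at y)" using y assms by (intro F_deriv) auto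
  qed
  moreover have "p y \<le> p (y - v)" using y assms by (intro p_anti) auto
  ultimately show "\<exists>z. ((\<lambda>b. F (b - v) - F b) has_real_derivative z) (at y) \<and> z \<le> 0"
    by (intro exI[of _ "- p (y - v) - - p y"]) auto
qed

lemma arc_density_shift_mono:
  assumes "0 < v" "v < b" "b \<le> b'" "b' < R"
  shows "arc_density b (b - v) \<le> arc_density b' (b' - v)"
proof -
  have "0 < v * p b'" using p_pos[of b'] assms by simp
  then have "F b' < F (b' - v)" using F_diff_bounds(1)[of "b' - v" b'] assms by simp
  then show ?thesis
    using F_increment_anti[OF assms] assms
    by (auto simp: arc_density_shift intro!: frac_le)
qed

lemma arc_has_integral_shift:
  assumes "0 < x" "0 < s" "x + s < R"
  shows "((\<lambda>v. arc_density (x + s) (x + s - v)) has_integral arc x s) {0..s}"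
proof -
  have "((\<lambda>v. arc_density (x + s) ((-1) *\<^sub>R v + (x + s))) has_integral (1 / \<bar>-1\<bar> ^ DIM(real)) *\<^sub>R arc x s)
      ((\<lambda>v. (1 / (-1)) *\<^sub>R v + - ((1 / (-1)) *\<^sub>R (x + s))) ` cbox x (x + s))"
    using arc_has_integral[OF assms] by (intro has_integral_affinity) auto
  moreover have "(\<lambda>v. (1 / (-1)) *\<^sub>R v + - ((1 / (-1)) *\<^sub>R (x + s))) ` cbox x (x + s) = {0..s}"
    by (auto simp: image_iff intro!: bexI[of _ "x + s - _"])
  ultimately show ?thesis by (simp add: algebra_simps)
qed

text \<open>Measured from the turning point, the density increases as that point moves right, and it
  is at least 1 on the added piece. Growth in s makes \<open>r_star\<close> unique; growth in x
  makes \<open>arc\<close> measurable in the base point.\<close>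

lemma arc_mono:
  assumes "0 < x" "0 < s" "s \<le> s'" "x \<le> x'" "x' + s' < R"
  shows "arc x s + (s' - s) \<le> arc x' s'"
proof -
  let ?g = "\<lambda>v. arc_density (x + s) (x + s - v)" and ?h = "\<lambda>v. arc_density (x' + s') (x' + s' - v)"
  have g: "(?g has_integral arc x s) {0..s}" using assms by (intro arc_has_integral_shift) auto
  have h: "(?h has_integral arc x' s') {0..s'}" using assms by (intro arc_has_integral_shift) auto
  have h1: "?h integrable_on {0..s}" "?h integrable_on {s..s'}"
    using h assms by (auto intro: integrable_on_subinterval)
  have "arc x' s' = integral {0..s} ?h + integral {s..s'} ?h"
    using Henstock_Kurzweil_Integration.integral_combine[OF _ _ has_integral_integrable[OF h], of s] h assms by (simp add: integral_unique)
  moreover have "arc x s \<le> integral {0..s} ?h"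
  proof -
    have "integral {0..s} ?g \<le> integral {0..s} ?h"
      using g h1(1) assms by (intro integral_le_Ioo arc_density_shift_mono) auto
    then show ?thesis using g by (simp add: integral_unique)
  qed
  moreover have "s' - s \<le> integral {s..s'} ?h"
  proof -
    have "integral {s..s'} (\<lambda>v. 1) \<le> integral {s..s'} ?h"
      using h1(2) assms by (intro integral_le_Ioo arc_density_bounds(1)[of x']) auto
    then show ?thesis using assms by simp
  qed
  ultimately show ?thesis by simp
qed

lemma arc_strict_mono: "0 < x \<Longrightarrow> 0 < s \<Longrightarrow> s < s' \<Longrightarrow> x + s' < R \<Longrightarrow> arc x s < arc x s'"
  using arc_mono[of x s s' x] by simp

lemma arc_ge: "0 < x \<Longrightarrow> 0 < s \<Longrightarrow> x + s < R \<Longrightarrow> s \<le> arc x s"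
proof -
  assume s: "0 < x" "0 < s" "x + s < R"
  have "integral {x..x + s} (\<lambda>v. 1) \<le> integral {x..x + s} (arc_density (x + s))"
    using arc_has_integral[OF s] s by (intro integral_le_Ioo arc_density_bounds(1)[of x]) auto
  then show ?thesis using s by (simp add: arc_def)
qed

text \<open>Dominated convergence: by \<open>arc_density_shift_mono\<close> the density of a
  slightly larger turning point \<open>s2\<close> majorises all nearby ones.\<close>

lemma arc_continuous:
  assumes x: "0 < x" and s: "0 < s" "x + s < R"
  shows "isCont (arc x) s"
proof (subst continuous_at_sequentially, intro allI impI)
  fix X :: "nat \<Rightarrow> real" assume X: "X \<longlonglongrightarrow> s"
  define s2 where "s2 = (s + (R - x)) / 2"
  define Y where "Y k = max (s / 2) (min (X k) s2)" for k
  have s2: "s < s2" "x + s2 < R" using s by (auto simp: s2_def field_simps)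
  have Y: "0 < Y k" "Y k \<le> s2" for k using s s2 by (auto simp: Y_def)
  have "Y \<longlonglongrightarrow> max (s / 2) (min s s2)"
    unfolding Y_def by (intro tendsto_intros X)
  then have Ylim: "Y \<longlonglongrightarrow> s" using s s2 by simp
  \<comment> \<open>The point v = s is removed because the integrands may jump there as the moving
    endpoint passes it; a single point does not change the integral.\<close>
  define g where "g \<sigma> v = (if 0 < v \<and> v < \<sigma> \<and> v \<noteq> s then arc_density (x + \<sigma>) (x + \<sigma> - v) else 0)" for \<sigma> v
  define h where "h v = (if 0 < v \<and> v < s2 then arc_density (x + s2) (x + s2 - v) else 0)" for v
  have g: "(g \<sigma> has_integral arc x \<sigma>) {0..s2}" if \<sigma>: "0 < \<sigma>" "\<sigma> \<le> s2" for \<sigma>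
  proof -
    have "((\<lambda>v. arc_density (x + \<sigma>) (x + \<sigma> - v)) has_integral arc x \<sigma>) {0..\<sigma>}"
      using \<sigma> s2 x by (intro arc_has_integral_shift) auto
    then have "(g \<sigma> has_integral arc x \<sigma>) {0..\<sigma>}"
      by (rule has_integral_spike_finite[rotated 2, where S = "{0, s, \<sigma>}"]) (auto simp: g_def)
    then show ?thesis
      by (rule has_integral_on_superset) (use \<sigma> in \<open>auto simp: g_def\<close>)
  qed
  have h: "h integrable_on {0..s2}"
  proof -
    have "((\<lambda>v. arc_density (x + s2) (x + s2 - v)) has_integral arc x s2) {0..s2}"
      using s s2 x by (intro arc_has_integral_shift) auto
    then have "(h has_integral arc x s2) {0..s2}"
      by (rule has_integral_spike_finite[rotated 2, where S = "{0, s2}"]) (auto simp: h_def)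
    then show ?thesis by blast
  qed
  have gh: "norm (g (Y k) v) \<le> h v" for k v
  proof (cases "0 < v \<and> v < Y k \<and> v \<noteq> s")
    case True
    then have "arc_density (x + Y k) (x + Y k - v) \<le> arc_density (x + s2) (x + s2 - v)"
      using Y[of k] x s2 by (intro arc_density_shift_mono) auto
    moreover have "0 \<le> arc_density (x + Y k) (x + Y k - v)"
      using True x Y[of k] s2 by (intro arc_density_nonneg) auto
    ultimately show ?thesis using True Y[of k] by (auto simp: g_def h_def)
  next
    case False
    then show ?thesis using x s2 by (auto simp: g_def h_def intro!: arc_density_nonneg)
  qed
  have "(\<lambda>k. integral {0..s2} (g (Y k))) \<longlonglongrightarrow> integral {0..s2} (g s)"
  proof (rule dominated_convergence(2)[OF _ h gh])
    show "g (Y k) integrable_on {0..s2}" for k using g Y by blast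
    fix v assume v: "v \<in> {0..s2}"
    consider "v \<le> 0 \<or> v = s" | "0 < v" "v < s" | "s < v" using v by fastforce
    then show "(\<lambda>k. g (Y k) v) \<longlonglongrightarrow> g s v"
    proof cases
      case 1 then show ?thesis by (auto simp: g_def)
    next
      case 2
      have "eventually (\<lambda>k. v < Y k) sequentially" using Ylim 2 by (intro order_tendstoD(1)) auto
      then have ev: "eventually (\<lambda>k. arc_density (x + Y k) (x + Y k - v) = g (Y k) v) sequentially"
        by eventually_elim (use 2 in \<open>auto simp: g_def\<close>)
      have cf: "isCont f y" if "0 < y" "y < R" for y
        using that by (intro DERIV_isCont[OF f_deriv])
      have f1: "(\<lambda>k. f (x + Y k)) \<longlonglongrightarrow> f (x + s)"
        using cf[of "x + s"] x s by (intro isCont_tendsto_compose[of _ f] tendsto_intros Ylim) auto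
      have f2: "(\<lambda>k. f (x + Y k - v)) \<longlonglongrightarrow> f (x + s - v)"
        using cf[of "x + s - v"] x s 2 by (intro isCont_tendsto_compose[of _ f] tendsto_intros Ylim) auto
      have ne: "sqrt ((f (x + s))\<^sup>2 - (f (x + s - v))\<^sup>2) \<noteq> 0"
        using f_sq_less[of "x + s - v" "x + s"] 2 x s by auto
      have "(\<lambda>k. arc_density (x + Y k) (x + Y k - v)) \<longlonglongrightarrow> arc_density (x + s) (x + s - v)"
        unfolding arc_density_def by (intro tendsto_intros f1 f2 ne)
      then have "(\<lambda>k. g (Y k) v) \<longlonglongrightarrow> arc_density (x + s) (x + s - v)"
        using ev by (rule Lim_transform_eventually)
      then show ?thesis using 2 by (simp add: g_def)
    next
      case 3
      have "eventually (\<lambda>k. Y k < v) sequentially" using Ylim 3 by (intro order_tendstoD(2)) auto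
      then have "eventually (\<lambda>k. g s v = g (Y k) v) sequentially"
        by eventually_elim (use 3 in \<open>auto simp: g_def\<close>)
      then show ?thesis by (rule Lim_transform_eventually[OF tendsto_const])
    qed
  qed
  moreover have "integral {0..s2} (g (Y k)) = arc x (Y k)" for k
    using g[OF Y] by (rule integral_unique)
  moreover have "integral {0..s2} (g s) = arc x s"
    using g[of s] s s2 by (simp add: integral_unique)
  ultimately have lim: "(\<lambda>k. arc x (Y k)) \<longlonglongrightarrow> arc x s" by simp
  have "eventually (\<lambda>k. X k > s / 2) sequentially" "eventually (\<lambda>k. X k < s2) sequentially"
    using order_tendstoD(1)[OF X, of "s / 2"] order_tendstoD(2)[OF X, of s2] s s2 by auto
  then have "eventually (\<lambda>k. arc x (Y k) = (arc x \<circ> X) k) sequentially"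
    by eventually_elim (auto simp: Y_def)
  then show "(arc x \<circ> X) \<longlonglongrightarrow> arc x s" by (rule Lim_transform_eventually[OF lim])
qed

text \<open>Intermediate value theorem: \<open>arc x\<close> is small near 0 by
  \<open>arc_le_sqrt\<close> and at least \<rho> at s = \<rho>.\<close>

lemma arc_surj:
  assumes x: "0 < x" and \<rho>: "0 < \<rho>" "x + \<rho> < R"
  shows "\<exists>s. 0 < s \<and> s \<le> \<rho> \<and> arc x s = \<rho>"
proof -
  define c where "c = p (x + \<rho>)"
  have c: "0 < c" using x \<rho> by (auto simp: c_def intro: p_pos)
  define h where "h s = s + sqrt (2 * (s * p x)) / c" for s
  have "isCont h 0" unfolding h_def using c by (intro continuous_intros) auto
  then have "(h \<longlongrightarrow> 0) (at_right 0)"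
    by (auto simp: isCont_def h_def intro: filterlim_at_split[THEN iffD1, THEN conjunct2])
  then have "eventually (\<lambda>s. h s < \<rho>) (at_right 0)" using \<rho> by (intro order_tendstoD) auto
  moreover have "eventually (\<lambda>s. s \<in> {0<..<\<rho>}) (at_right 0)" using \<rho> by (intro eventually_at_right_real)
  ultimately have "eventually (\<lambda>s. h s < \<rho> \<and> s \<in> {0<..<\<rho>}) (at_right 0)" by eventually_elim auto
  then obtain s0 where s0: "h s0 < \<rho>" "0 < s0" "s0 < \<rho>"
    using eventually_happens'[OF trivial_limit_at_right_real] by force
  have "arc x s0 \<le> s0 + sqrt (2 * (s0 * p x)) / p (x + s0)"
    using x s0 \<rho> by (intro arc_le_sqrt) auto
  also have "\<dots> \<le> h s0"
    unfolding h_def c_def using x s0 \<rho> p_anti[of "x + s0" "x + \<rho>"] p_pos[of "x + \<rho>"] p_pos[of x]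
    by (intro add_left_mono divide_left_mono mult_pos_pos) auto
  finally have "arc x s0 \<le> \<rho>" using s0 by simp
  moreover have "\<rho> \<le> arc x \<rho>" using x \<rho> by (intro arc_ge)
  ultimately obtain s where "s0 \<le> s" "s \<le> \<rho>" "arc x s = \<rho>"
    using IVT[of "arc x" s0 \<rho> \<rho>] arc_continuous[OF x] s0 \<rho> by force
  then show ?thesis using s0 by (intro exI[of _ s]) auto
qed

lemma r_star_predicate:
  assumes "0 < x"
  shows "(0 < s \<and> x + s < R \<and>
     ((\<lambda>u. f (x + s) / sqrt ((f (x + s))\<^sup>2 - (f u)\<^sup>2)) has_integral r) {x..x + s})
    \<longleftrightarrow> 0 < s \<and> x + s < R \<and> arc x s = r"
  using arc_has_integral[OF assms, of s] has_integral_unique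
  unfolding arc_density_def[abs_def] by blast

lemma r_star_eq:
  assumes "0 < x" "0 < s" "x + s < R"
  shows "r_star F R x (arc x s) = s"
  unfolding r_star_def r_star_predicate[OF assms(1)]
proof (rule the_equality)
  fix s' assume "0 < s' \<and> x + s' < R \<and> arc x s' = arc x s"
  then show "s' = s"
    using arc_strict_mono[of x s s'] arc_strict_mono[of x s' s] assms by (cases s s' rule: linorder_cases) auto
qed (use assms in simp)

lemma r_star_props:
  assumes "0 < x" "0 < \<rho>" "x + \<rho> < R"
  shows "0 < r_star F R x \<rho>" "r_star F R x \<rho> \<le> \<rho>" "arc x (r_star F R x \<rho>) = \<rho>"
proof -
  obtain s where "0 < s" "s \<le> \<rho>" "arc x s = \<rho>" using arc_surj[OF assms] by blast
  moreover from this have "r_star F R x \<rho> = s" using r_star_eq[of x s] assms by simp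
  ultimately show "0 < r_star F R x \<rho>" "r_star F R x \<rho> \<le> \<rho>" "arc x (r_star F R x \<rho>) = \<rho>" by auto
qed

lemma abs_deriv_F: "0 < x \<Longrightarrow> x < R \<Longrightarrow> \<bar>deriv F x\<bar> = p x"
  using F'_neg[of x] by (simp add: p_def)

lemma next_radius_eq: "0 < x \<Longrightarrow> x < R \<Longrightarrow>
    next_radius F R x \<rho> = (if 1 / p x \<le> \<rho> then r_star F R x \<rho> else \<rho> / 2)"
  by (simp add: next_radius_def abs_deriv_F)

lemma next_radius_bounds:
  assumes "0 < x" "0 < \<rho>" "x + \<rho> < R"
  shows "0 < next_radius F R x \<rho>" "next_radius F R x \<rho> \<le> \<rho>"
  using assms r_star_props[of x \<rho>] by (auto simp: next_radius_eq)

lemma radius_seq_Suc: "radius_seq F R x r (Suc k) = next_radius F R x (radius_seq F R x r k)"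
  by (simp add: radius_seq_def)

lemma radius_seq_bounds:
  assumes "0 < x" "0 < r" "x + r < R"
  shows "0 < radius_seq F R x r k \<and> radius_seq F R x r k \<le> r"
proof (induction k)
  case 0 then show ?case using assms by (simp add: radius_seq_def)
next
  case (Suc k)
  then show ?case using next_radius_bounds[of x "radius_seq F R x r k"] assms by (auto simp: radius_seq_Suc)
qed

text \<open>For base points with \<open>x + r \<ge> R\<close> the turning point need not exist and \<open>r_star\<close> is then
  an unspecified constant; the cells of such a radius are empty nevertheless.\<close>

lemma radius_seq_forward:
  assumes x: "0 < x" "x < R" and k: "1 \<le> k"
    and t: "next_radius F R x (radius_seq F R x r k) \<le> t" "t < radius_seq F R x r k"
  shows "0 < t"
proof -
  \<comment> \<open>The description operator returns this same value for every radius without a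
    turning point.\<close>
  define j where "j = (THE s::real. False)"
  have no: "r_star F R x \<rho> = j" if "\<nexists>s. 0 < s \<and> x + s < R \<and> arc x s = \<rho>" for \<rho>
  proof -
    have "(\<lambda>s. 0 < s \<and> x + s < R \<and> arc x s = \<rho>) = (\<lambda>s. False)" using that by blast
    then show ?thesis unfolding r_star_def r_star_predicate[OF x(1)] j_def by simp
  qed
  \<comment> \<open>Every value of \<open>next_radius\<close> is good, whatever the previous radius,
    and this is where k >= 1 matters. A good radius subject to the \<open>r_star\<close> rule but
    without a turning point must be j, a fixed point of the recursion, so its cell is empty.\<close>
  define good where "good \<rho> \<longleftrightarrow> (1 / p x \<le> \<rho> \<longrightarrow> \<rho> = j \<or> (\<exists>s. 0 < s \<and> x + s < R \<and> arc x s = \<rho>))" for \<rho>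
  have step: "good (next_radius F R x \<rho>)" for \<rho>
  proof (cases "1 / p x \<le> \<rho>")
    case True
    then have nx: "next_radius F R x \<rho> = r_star F R x \<rho>" using x by (simp add: next_radius_eq)
    show ?thesis
    proof (cases "\<exists>s. 0 < s \<and> x + s < R \<and> arc x s = \<rho>")
      case True
      then obtain s where s: "0 < s" "x + s < R" "arc x s = \<rho>" by blast
      then have "r_star F R x \<rho> = s" using r_star_eq x by blast
      obtain s' where "0 < s'" "s' \<le> s" "arc x s' = s" using arc_surj[of x s] s x by blast
      then have "0 < s' \<and> x + s' < R \<and> arc x s' = s" using s by simp
      then show ?thesis unfolding nx good_def \<open>r_star F R x \<rho> = s\<close> by blast
    qed (use no nx in \<open>simp add: good_def\<close>)
  next
    case False
    moreover have "0 < 1 / p x" using x p_pos by simp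
    ultimately have "\<not> 1 / p x \<le> \<rho> / 2" by linarith
    then show ?thesis using False x by (simp add: next_radius_eq good_def)
  qed
  define \<rho> where "\<rho> = radius_seq F R x r k"
  obtain k' where "k = Suc k'" using k by (cases k) auto
  then have g: "good \<rho>" using step by (simp add: \<rho>_def radius_seq_Suc)
  show ?thesis
  proof (cases "1 / p x \<le> \<rho>")
    case True
    then have nx: "next_radius F R x \<rho> = r_star F R x \<rho>" using x by (simp add: next_radius_eq)
    have "\<exists>s. 0 < s \<and> x + s < R \<and> arc x s = \<rho>"
    proof (rule ccontr)
      assume "\<not> ?thesis"
      then have "r_star F R x \<rho> = \<rho>" using no g True unfolding good_def by blast
      then show False using t nx by (simp add: \<rho>_def)
    qed
    then obtain s where s: "0 < s" "x + s < R" "arc x s = \<rho>" by blast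
    have "r_star F R x \<rho> = s" using r_star_eq[OF x(1) s(1,2)] s(3) by simp
    then have "0 < r_star F R x \<rho>" using s(1) by simp
    then show ?thesis using t nx by (simp add: \<rho>_def)
  next
    case False
    then show ?thesis using t x by (simp add: next_radius_eq \<rho>_def[symmetric])
  qed
qed

section \<open>Width and height of the cells\<close>

definition ratio_const :: real where "ratio_const = 1 + 400 / e0"
text \<open>From \<open>(\<rho> + s) * (\<rho> - s)\<close> with s the next radius:
  \<open>ratio_const\<close> enters once through each factor, and the sum gives the 2.\<close>

definition width_const :: real where "width_const = 2 * ratio_const\<^sup>2"
text \<open>\<open>exp 1\<close> is the growth of f over a length 1 / p, and the square is doubling
  of p over the ratio 1 + 1 / \<open>e0\<close> of the first coordinates.\<close>

definition height_const :: real where "height_const = exp 1 * (1 + 1 / e0)\<^sup>2"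

lemma ratio_const_ge: "401 \<le> ratio_const"
  using e0 by (simp add: ratio_const_def field_simps)

lemma width_const_ge: "4 \<le> width_const"
  using ratio_const_ge power_mono[of 401 ratio_const 2] by (simp add: width_const_def)

lemma height_const_ge: "4 * exp 1 \<le> height_const" "1 \<le> height_const"
proof -
  have "2 \<le> 1 + 1 / e0" using e0 by (simp add: field_simps)
  then have "2\<^sup>2 \<le> (1 + 1 / e0)\<^sup>2" by (intro power_mono) auto
  then show 1: "4 * exp 1 \<le> height_const" by (simp add: height_const_def)
  have "(1::real) \<le> exp 1" by simp
  then show "1 \<le> height_const" using 1 by linarith
qed

text \<open>If s were far below \<open>1 / p x\<close>, then \<open>arc_le_sqrt\<close> would force
  \<open>\<rho> < 1 / p x\<close>. So s is at least a multiple of \<open>1 / p x\<close>, which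
  makes \<open>1 / p (x + s)\<close> at most a multiple of s, and \<open>arc_le_simple\<close>
  concludes.\<close>

lemma r_star_ge:
  assumes x: "0 < x" and \<rho>: "x + \<rho> < r0" "1 / p x \<le> \<rho>" and \<rho>0: "0 < \<rho>"
  shows "\<rho> \<le> ratio_const * r_star F R x \<rho>"
proof -
  define s where "s = r_star F R x \<rho>"
  have px: "0 < p x" using x \<rho> \<rho>0 r0 by (intro p_pos) auto
  have s: "0 < s" "s \<le> \<rho>" "arc x s = \<rho>"
    using r_star_props[of x \<rho>] x \<rho> \<rho>0 r0 by (auto simp: s_def)
  have R: "x + s < r0" "x + s < R" using s \<rho> r0 by auto
  have ps: "0 < p (x + s)" using x s R by (intro p_pos) auto
  \<comment> \<open>Small enough that s < c / p x implies s <= x, hence doubling by 4, and that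
    sqrt(2c) <= 1/6, so the arc stays below (1/100 + 4/6) / p x.\<close>
  define c where "c = e0 / 100"
  have c: "0 < c" "c \<le> 1 / 100" using e0 by (auto simp: c_def)
  have sc: "c / p x \<le> s"
  proof (rule ccontr)
    assume "\<not> ?thesis"
    then have sp: "s * p x < c" using px by (simp add: field_simps)
    have "c / p x \<le> e0 / p x" using px e0 by (intro divide_right_mono) (auto simp: c_def)
    also have "\<dots> \<le> x" using p_ge[of x] x R s px by (simp add: field_simps)
    finally have "s \<le> x" using \<open>\<not> c / p x \<le> s\<close> by simp
    then have "(x + s) / x \<le> 2" using x by (simp add: field_simps)
    then have "((x + s) / x)\<^sup>2 \<le> 2\<^sup>2" using x s by (intro power_mono) auto
    then have "((x + s) / x)\<^sup>2 * p (x + s) \<le> 4 * p (x + s)" using ps by (intro mult_right_mono) auto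
    then have "p x \<le> 4 * p (x + s)" using p_double[of x "x + s"] x s R by simp
    then have "1 / p (x + s) \<le> 4 / p x" using ps px by (simp add: field_simps)
    have "sqrt (2 * (s * p x)) \<le> sqrt ((1/6)\<^sup>2)" using sp c by (intro real_sqrt_le_mono) (simp add: power2_eq_square)
    then have sq: "sqrt (2 * (s * p x)) \<le> 1 / 6" by simp
    have "\<rho> \<le> s + sqrt (2 * (s * p x)) / p (x + s)" using arc_le_sqrt[of x s] x s R by simp
    also have "sqrt (2 * (s * p x)) / p (x + s) = sqrt (2 * (s * p x)) * (1 / p (x + s))" by simp
    also have "\<dots> \<le> 1 / 6 * (4 / p x)" using sq \<open>1 / p (x + s) \<le> 4 / p x\<close> ps px by (intro mult_mono) auto
    also have "s + 1 / 6 * (4 / p x) < 1 / p x"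
    proof -
      have "s < 1 / 100 / p x" using sp c px by (simp add: field_simps)
      then have "s + 1 / 6 * (4 / p x) < (1 / 100 + 4 / 6) / p x" by (simp add: add_divide_distrib)
      also have "\<dots> \<le> 1 / p x" using px by (intro divide_right_mono) auto
      finally show ?thesis .
    qed
    finally show False using \<rho> by simp
  qed
  \<comment> \<open>For s <= x doubling moves p from x to x + s; for larger s, x + s is at most 2 s
    and \<open>inverse_p_le\<close> suffices.\<close>
  have c2: "1 / p (x + s) \<le> 4 / c * s"
  proof (cases "s \<le> x")
    case True
    then have "(x + s) / x \<le> 2" using x by (simp add: field_simps)
    then have "((x + s) / x)\<^sup>2 \<le> 2\<^sup>2" using x s by (intro power_mono) auto
    then have "((x + s) / x)\<^sup>2 * p (x + s) \<le> 4 * p (x + s)" using ps by (intro mult_right_mono) auto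
    then have "p x \<le> 4 * p (x + s)" using p_double[of x "x + s"] x s R by simp
    then have "1 / p (x + s) \<le> 4 / c * (c / p x)" using ps px c by (simp add: field_simps)
    also have "\<dots> \<le> 4 / c * s" using sc c by (intro mult_left_mono) auto
    finally show ?thesis .
  next
    case False
    have "1 / p (x + s) \<le> (x + s) / e0" using x s R by (intro inverse_p_le) auto
    also have "\<dots> \<le> 2 * s / e0" using False e0 by (intro divide_right_mono) auto
    also have "\<dots> \<le> 4 / c * s" using e0 s by (simp add: c_def field_simps)
    finally show ?thesis .
  qed
  have "\<rho> \<le> s + 1 / p (x + s)" using arc_le_simple[of x s] x s R by simp
  also have "\<dots> \<le> s + 4 / c * s" using c2 by simp
  also have "\<dots> = ratio_const * s" using e0 by (simp add: ratio_const_def c_def field_simps)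
  finally show ?thesis by (simp add: s_def)
qed

text \<open>Trades the radius of a cell for the gap t of a point in it. Under halving, \<rho> < 1 /
  p x makes t the smaller entry of the minimum. Under the \<open>r_star\<close> rule, \<rho> - s is
  bounded by 1 / p (x + t) through \<open>arc_le_simple\<close> and by a multiple of t through
  \<open>r_star_ge\<close>.\<close>

lemma next_radius_gap:
  assumes x: "0 < x" and \<rho>: "0 < \<rho>" "x + \<rho> < r0"
    and t: "next_radius F R x \<rho> \<le> t" "t < \<rho>"
  shows "0 < t"
    and "\<rho>\<^sup>2 - (next_radius F R x \<rho>)\<^sup>2 \<le> width_const * (t * min t (1 / p (x + t)))"
    and "h_star F x \<rho> \<le> height_const * (f (x + t) / p (x + t))"
proof -
  have R: "x + \<rho> < R" using \<rho> r0 by simp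
  have nb: "0 < next_radius F R x \<rho>" using next_radius_bounds[of x \<rho>] x \<rho> R by simp
  show t0: "0 < t" using nb t by simp
  have px: "0 < p x" and pt: "0 < p (x + t)" and pb: "0 < p (x + \<rho>)"
    using x t0 t \<rho> R by (auto intro!: p_pos)
  have pxt: "p (x + t) \<le> p x" using x t0 t R by (intro p_anti) auto
  have ft: "0 < f (x + t)" using x t0 by (intro f_pos) auto
  have frat: "f (x + \<rho>) \<le> exp 1 * f (x + t)" if "(\<rho> - t) * p (x + t) \<le> 1"
  proof -
    have "f (x + \<rho>) \<le> exp ((\<rho> - t) * p (x + t)) * f (x + t)"
      using f_ratio[of "x + t" "x + \<rho>"] x t0 t R by simp
    also have "\<dots> \<le> exp 1 * f (x + t)" using that ft by (intro mult_right_mono) auto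
    finally show ?thesis .
  qed
  \<comment> \<open>Moves f and p from the end x + \<rho> of the cell back to x + t: f by
    \<open>f_ratio\<close> over a length at most 1 / p, and p by doubling.\<close>
  have hh: "h_star F x \<rho> \<le> height_const * (f (x + t) / p (x + t))"
    if "(\<rho> - t) * p (x + t) \<le> 1" "(x + \<rho>) / (x + t) \<le> 1 + 1 / e0"
  proof -
    have "p (x + t) \<le> ((x + \<rho>) / (x + t))\<^sup>2 * p (x + \<rho>)" using x t0 t \<rho> by (intro p_double) auto
    also have "\<dots> \<le> (1 + 1 / e0)\<^sup>2 * p (x + \<rho>)"
      using that(2) x t0 \<rho> pb by (intro mult_right_mono power_mono) auto
    finally have "1 / p (x + \<rho>) \<le> (1 + 1 / e0)\<^sup>2 / p (x + t)" using pt pb by (simp add: field_simps)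
    then have "f (x + \<rho>) * (1 / p (x + \<rho>)) \<le> (exp 1 * f (x + t)) * ((1 + 1 / e0)\<^sup>2 / p (x + t))"
      using frat[OF that(1)] f_nonneg pb ft by (intro mult_mono) auto
    then show ?thesis using h_star_le_simple[OF x \<rho>(1) R] by (simp add: height_const_def mult_ac)
  qed
  have "\<rho>\<^sup>2 - (next_radius F R x \<rho>)\<^sup>2 \<le> width_const * (t * min t (1 / p (x + t))) \<and> h_star F x \<rho> \<le> height_const * (f (x + t) / p (x + t))"
  proof (cases "1 / p x \<le> \<rho>")
    case False
    then have nx: "next_radius F R x \<rho> = \<rho> / 2" using x \<rho> R by (simp add: next_radius_eq)
    have \<rho>t: "\<rho> \<le> 2 * t" using t nx by simp
    have \<rho>p: "\<rho> * p x \<le> 1" using False px by (simp add: field_simps)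
    have "t * p (x + t) \<le> \<rho> * p x" using t t0 pt pxt by (intro mult_mono) auto
    then have "t \<le> 1 / p (x + t)" using \<rho>p pt by (simp add: field_simps)
    then have mt: "min t (1 / p (x + t)) = t" by simp
    have "\<rho>\<^sup>2 \<le> (2 * t)\<^sup>2" using \<rho>t \<rho> by (intro power_mono) auto
    also have "\<dots> = 4 * (t * t)" by (simp add: power2_eq_square)
    also have "\<dots> \<le> width_const * (t * t)" using width_const_ge by (intro mult_right_mono) auto
    finally have 1: "\<rho>\<^sup>2 - (next_radius F R x \<rho>)\<^sup>2 \<le> width_const * (t * min t (1 / p (x + t)))"
      unfolding mt using zero_le_power2[of "next_radius F R x \<rho>"] by linarith
    have "(\<rho> - t) * p (x + t) \<le> \<rho> * p x" using t t0 pt pxt \<rho> by (intro mult_mono) auto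
    then have 2: "(\<rho> - t) * p (x + t) \<le> 1" using \<rho>p by simp
    have "(x + \<rho>) / (x + t) \<le> 2" using x t0 \<rho>t by (simp add: field_simps)
    also have "2 \<le> 1 + 1 / e0" using e0 by (simp add: field_simps)
    finally show ?thesis using 1 hh[OF 2] by simp
  next
    case True
    define s where "s = r_star F R x \<rho>"
    have nx: "next_radius F R x \<rho> = s" using x \<rho> R True by (simp add: next_radius_eq s_def)
    have s: "0 < s" "s \<le> \<rho>" "arc x s = \<rho>" using r_star_props[of x \<rho>] x \<rho> R by (auto simp: s_def)
    have st: "s \<le> t" using t nx by simp
    have \<rho>C: "\<rho> \<le> ratio_const * t"
    proof -
      have "ratio_const * s \<le> ratio_const * t" using st ratio_const_ge by (intro mult_left_mono) auto
      then show ?thesis using r_star_ge[OF x \<rho>(2) True \<rho>(1)] by (simp add: s_def)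
    qed
    have "\<rho> - s \<le> 1 / p (x + s)" using arc_le_simple[of x s] x s R by simp
    also have "\<dots> \<le> 1 / p (x + t)" using x s st t R pt by (intro divide_left_mono p_anti mult_pos_pos p_pos) auto
    finally have gap: "\<rho> - s \<le> 1 / p (x + t)" .
    have gap': "\<rho> - s \<le> ratio_const * min t (1 / p (x + t))"
    proof -
      have "1 / p (x + t) \<le> ratio_const * (1 / p (x + t))" using ratio_const_ge pt by (simp add: field_simps)
      moreover have "ratio_const * min t (1 / p (x + t)) = t * ratio_const \<or> ratio_const * min t (1 / p (x + t)) = ratio_const * (1 / p (x + t))"
        by (auto simp: min_def)
      ultimately show ?thesis using gap \<rho>C s by (auto simp: mult.commute)
    qed
    have "\<rho>\<^sup>2 - s\<^sup>2 = (\<rho> + s) * (\<rho> - s)" by (simp add: power2_eq_square algebra_simps)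
    also have "\<dots> \<le> (2 * (ratio_const * t)) * (ratio_const * min t (1 / p (x + t)))"
      using \<rho>C gap' s ratio_const_ge t0 by (intro mult_mono) auto
    also have "\<dots> = width_const * (t * min t (1 / p (x + t)))" by (simp add: width_const_def power2_eq_square)
    finally have 1: "\<rho>\<^sup>2 - s\<^sup>2 \<le> width_const * (t * min t (1 / p (x + t)))" .
    have gt: "\<rho> - t \<le> 1 / p (x + t)" using gap st by simp
    then have 2: "(\<rho> - t) * p (x + t) \<le> 1" using pt by (simp add: field_simps)
    have "x + \<rho> \<le> (x + t) + (x + t) / e0" using gt inverse_p_le[of "x + t"] x t0 t R by simp
    also have "\<dots> = (x + t) * (1 + 1 / e0)" by (simp add: algebra_simps)
    finally have "(x + \<rho>) / (x + t) \<le> 1 + 1 / e0" using x t0 by (simp add: field_simps)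
    then show ?thesis using 1 hh[OF 2] nx by simp
  qed
  then show "\<rho>\<^sup>2 - (next_radius F R x \<rho>)\<^sup>2 \<le> width_const * (t * min t (1 / p (x + t)))"
    "h_star F x \<rho> \<le> height_const * (f (x + t) / p (x + t))" by auto
qed

section \<open>Measurable dependence of the cells on the base point\<close>

definition near :: "real \<Rightarrow> real measure" where "near r = restrict_space borel {0<..<r}"

lemma space_near [simp]: "space (near r) = {0<..<r}"
  by (simp add: near_def space_restrict_space)

lemma measurable_near_borel: "g \<in> borel_measurable borel \<Longrightarrow> g \<in> borel_measurable (near r)"
  unfolding near_def by (rule measurable_restrict_space1)

lemma measurable_p_near: "r \<le> R \<Longrightarrow> p \<in> borel_measurable (near r)"
  unfolding near_def
  by (intro borel_measurable_continuous_on_restrict continuous_on_subset[OF continuous_on_p]) auto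

lemma measurable_arc_near:
  assumes "0 < s" "r + s \<le> R"
  shows "(\<lambda>x. arc x s) \<in> borel_measurable (near r)"
  unfolding near_def
proof (intro borel_measurable_mono_on_fnc mono_onI)
  fix x x' assume "x \<in> {0<..<r}" "x' \<in> {0<..<r}" "x \<le> x'"
  then show "arc x s \<le> arc x' s" using arc_mono[of x s s x'] assms by auto
qed

text \<open>The description operator is removed by passing to sublevel sets:
  \<open>r_star F R x \<rho> < c\<close> holds exactly when \<rho> < \<open>arc x c\<close>, and
  \<open>arc x c\<close> is monotone in x.\<close>

lemma measurable_radius_seq:
  assumes r: "0 < r" "r + r < R"
  shows "(\<lambda>x. radius_seq F R x r k) \<in> borel_measurable (near r)"
proof (induction k)
  case 0 show ?case by (simp add: radius_seq_def)
next
  case (Suc k)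
  note [measurable] = Suc measurable_p_near[of r]
  have pm[measurable]: "p \<in> borel_measurable (near r)" using r by (intro measurable_p_near) auto
  show ?case
  proof (rule borel_measurableI_less)
    fix c :: real
    let ?\<rho> = "\<lambda>x. radius_seq F R x r k"
    have \<rho>: "0 < ?\<rho> x" "?\<rho> x \<le> r" if "x \<in> {0<..<r}" for x
      using radius_seq_bounds[of x r k] that r by auto
    consider "c \<le> 0" | "r < c" | "0 < c" "c \<le> r" by linarith
    then show "{x \<in> space (near r). radius_seq F R x r (Suc k) < c} \<in> sets (near r)"
    proof cases
      case 1
      have "{x \<in> space (near r). radius_seq F R x r (Suc k) < c} = {}"
        using radius_seq_bounds[of _ r "Suc k"] r 1 by force
      then show ?thesis by (metis sets.empty_sets)
    next
      case 2
      have "{x \<in> space (near r). radius_seq F R x r (Suc k) < c} = space (near r)"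
        using radius_seq_bounds[of _ r "Suc k"] r 2 by force
      then show ?thesis by (metis sets.top)
    next
      case 3
      have [measurable]: "(\<lambda>x. arc x c) \<in> borel_measurable (near r)"
        using 3 r by (intro measurable_arc_near) auto
      have "radius_seq F R x r (Suc k) < c \<longleftrightarrow>
          (1 / p x \<le> ?\<rho> x \<and> ?\<rho> x < arc x c) \<or> (\<not> 1 / p x \<le> ?\<rho> x \<and> ?\<rho> x / 2 < c)"
        if x: "x \<in> space (near r)" for x
      proof -
        have x': "0 < x" "x < r" using x by auto
        have \<rho>x: "0 < ?\<rho> x" "?\<rho> x \<le> r" using \<rho>[of x] x by auto
        define s where "s = r_star F R x (?\<rho> x)"
        have s: "0 < s" "s \<le> ?\<rho> x" "arc x s = ?\<rho> x"
          using r_star_props[of x "?\<rho> x"] x' \<rho>x r by (auto simp: s_def)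
        have "s < c \<longleftrightarrow> ?\<rho> x < arc x c"
          using arc_strict_mono[of x s c] arc_strict_mono[of x c s] s x' \<rho>x r 3
          by (cases s c rule: linorder_cases) auto
        then show ?thesis using x' r by (simp add: radius_seq_Suc next_radius_eq s_def[symmetric])
      qed
      then have "{x \<in> space (near r). radius_seq F R x r (Suc k) < c}
        = {x \<in> space (near r). (1 / p x \<le> ?\<rho> x \<and> ?\<rho> x < arc x c) \<or> (\<not> 1 / p x \<le> ?\<rho> x \<and> ?\<rho> x / 2 < c)}"
        by blast
      also have "\<dots> \<in> sets (near r)" by measurable
      finally show ?thesis .
    qed
  qed
qed

text \<open>As a nonnegative parameter integral, the height becomes measurable in the base point
  through Tonelli.\<close>

lemma h_star_nn_integral:
  assumes "0 < x" "0 < s" "x + s < R"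
  shows "h_star F x s = enn2real (\<integral>\<^sup>+u. ennreal (indicator {x<..<x + s} u * height_density (x + s) u) \<partial>lborel)"
proof -
  have "(height_density (x + s) has_integral h_star F x s) {x<..<x + s}"
    using height_density_integrable[of x "x + s"] assms
    by (simp add: has_integral_Icc_iff_Ioo[symmetric] h_star_eq integrable_integral)
  then have "(\<integral>\<^sup>+u. ennreal (indicator {x<..<x + s} u * height_density (x + s) u) \<partial>lborel) = ennreal (h_star F x s)"
    using assms by (intro nn_integral_has_integral_lebesgue height_density_nonneg) auto
  moreover have "0 \<le> h_star F x s"
    unfolding h_star_eq using height_density_integrable[of x "x + s"] assms
    by (intro integral_nonneg height_density_nonneg) auto
  ultimately show ?thesis by simp
qed

lemma measurable_h_star:
  assumes r: "0 < r" "r + r < R" and \<rho>[measurable]: "\<rho> \<in> borel_measurable (near r)"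
    and b: "\<And>x. x \<in> {0<..<r} \<Longrightarrow> 0 < \<rho> x \<and> \<rho> x \<le> r"
  shows "(\<lambda>x. h_star F x (\<rho> x)) \<in> borel_measurable (near r)"
proof -
  define fb where "fb u = indicator {-R<..<R} u *\<^sub>R f u" for u :: real
  have fbm[measurable]: "fb \<in> borel_measurable borel"
    unfolding fb_def[abs_def] by (intro borel_measurable_continuous_on_indicator continuous_on_f) auto
  have xm[measurable]: "(\<lambda>x. x) \<in> borel_measurable (near r)"
    by (rule measurable_near_borel) simp
  define g where "g x u = (if x < u \<and> u < x + \<rho> x then (fb u)\<^sup>2 / sqrt ((fb (x + \<rho> x))\<^sup>2 - (fb u)\<^sup>2) else 0)" for x u
  have "(\<lambda>(x, u). g x u) \<in> borel_measurable (near r \<Otimes>\<^sub>M lborel)"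
    unfolding g_def by measurable
  then have "(\<lambda>(x, u). ennreal (g x u)) \<in> borel_measurable (near r \<Otimes>\<^sub>M lborel)" by measurable
  then have m: "(\<lambda>x. enn2real (\<integral>\<^sup>+u. ennreal (g x u) \<partial>lborel)) \<in> borel_measurable (near r)"
    by measurable
  have "h_star F x (\<rho> x) = enn2real (\<integral>\<^sup>+u. ennreal (g x u) \<partial>lborel)" if x: "x \<in> space (near r)" for x
  proof -
    have x': "0 < x" "0 < \<rho> x" "x + \<rho> x < R" using b[of x] x r by auto
    show ?thesis unfolding h_star_nn_integral[OF x']
      by (intro arg_cong[where f = enn2real] nn_integral_cong)
        (use x' in \<open>auto simp: g_def fb_def height_density_def indicator_def\<close>)
  qed
  then show ?thesis using m by (subst measurable_cong) auto
qed

end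

section \<open>The kernel on the cones\<close>

lemma reflect_nth [simp]: "reflect i1 x $ i = (if i = i1 then - (x $ i) else x $ i)"
  by (simp add: reflect_def)

lemma mid_norm_reflect [simp]: "mid_norm i1 i3 (reflect i1 y - reflect i1 x) = mid_norm i1 i3 (y - x)"
  by (auto simp: mid_norm_def intro!: arg_cong[where f = sqrt] sum.cong)

lemma measurable_reflect [measurable]: "reflect i1 \<in> borel_measurable (borel :: (real^'n::finite) measure)"
proof (intro borel_measurable_continuous_onI)
  have "continuous_on UNIV (\<lambda>x::real^'n. \<chi> i. if i = i1 then - (x $ i) else x $ i)"
  proof (intro continuous_on_vec_lambda)
    fix i show "continuous_on UNIV (\<lambda>x::real^'n. if i = i1 then - (x $ i) else x $ i)"
      by (cases "i = i1") (auto intro!: continuous_intros)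
  qed
  then show "continuous_on UNIV (reflect i1 :: real^'n \<Rightarrow> real^'n)"
    by (simp add: reflect_def[abs_def])
qed

context degenerate_metric
begin

text \<open>The three summands bound, in units of r, the first-coordinate, middle and vertical parts
  of the corner path from the vertex to a point of the cone.\<close>

definition dist_const :: real where "dist_const = 1 + sqrt width_const + height_const / e0"

lemma dist_const_ge: "1 \<le> dist_const"
  using width_const_ge height_const_ge(2) e0 by (simp add: dist_const_def)

text \<open>Guarantees that balls about x of radius up to \<open>dist_const * r\<close> stay below
  \<open>r0\<close>, where doubling of p holds, whenever the first coordinate of x is less than r in
  absolute value.\<close>

definition small :: "real \<Rightarrow> bool" where "small r \<longleftrightarrow> 0 < r \<and> (dist_const + 2) * r < r0"

lemma smallD:
  assumes "small r"
  shows "0 < r" "r + r < r0" "r + r < R" "r + dist_const * r < r0" "r < r0"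
proof -
  have r: "0 < r" "dist_const * r + 2 * r < r0" using assms by (auto simp: small_def algebra_simps)
  moreover have "r \<le> dist_const * r" using dist_const_ge r by simp
  ultimately show "0 < r" "r + r < r0" "r + r < R" "r + dist_const * r < r0" "r < r0" using r0 by linarith+
qed

abbreviation cone :: "real \<Rightarrow> real^'n \<Rightarrow> (real^'n) set" where
  "cone r x \<equiv> Gamma_tilde F R i1 i3 x r"

lemma trunc_eq: "\<xi> + t = y \<Longrightarrow> trunc \<xi> t = min t (1 / p y)"
  by (simp add: trunc_def)

text \<open>At first only y is known to be close to the hyperplane.
  \<open>radius_seq_forward\<close> places x below y, and only then are all the radii known to come
  from turning points or halving.\<close>

lemma Gamma_pos_bounds:
  assumes r: "small r" and y: "y \<in> Gamma_pos F R i1 i3 x r" "y $ i1 < r" and x: "0 < x $ i1" "x $ i1 < R"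
  shows "x $ i1 < y $ i1"
    and "(mid (y - x))\<^sup>2 \<le> width_const * ((y $ i1 - x $ i1) * trunc (x $ i1) (y $ i1 - x $ i1))"
    and "\<bar>y $ i3 - x $ i3\<bar> \<le> height_const * (f (y $ i1) / p (y $ i1))"
proof -
  obtain k where k: "1 \<le> k" "y \<in> E_tilde F R i1 i3 x (radius_seq F R (x $ i1) r k)"
    using y(1) by (auto simp: Gamma_pos_def)
  define \<rho> where "\<rho> = radius_seq F R (x $ i1) r k"
  define t where "t = y $ i1 - x $ i1"
  have E: "next_radius F R (x $ i1) \<rho> \<le> t" "t < \<rho>"
     "mid (y - x) < sqrt (\<rho>\<^sup>2 - (next_radius F R (x $ i1) \<rho>)\<^sup>2)"
     "\<bar>y $ i3 - x $ i3\<bar> < h_star F (x $ i1) \<rho>"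
    using k(2) by (auto simp: E_tilde_def \<rho>_def t_def)
  have t: "0 < t" using radius_seq_forward[OF x k(1), of r t] E by (simp add: \<rho>_def)
  then show "x $ i1 < y $ i1" by (simp add: t_def)
  then have xr: "x $ i1 < r" using y by simp
  have \<rho>: "0 < \<rho>" "\<rho> \<le> r" using radius_seq_bounds[of "x $ i1" r k] x xr smallD[OF r] by (auto simp: \<rho>_def)
  note gap = next_radius_gap[OF x(1) \<rho>(1) _ E(1,2)]
  have b: "x $ i1 + \<rho> < r0" using xr \<rho> smallD[OF r] by simp
  have "0 < sqrt (\<rho>\<^sup>2 - (next_radius F R (x $ i1) \<rho>)\<^sup>2)"
    using E(3) mid_norm_nonneg[of i1 i3 "y - x"] by linarith
  then have "(mid (y - x))\<^sup>2 \<le> \<rho>\<^sup>2 - (next_radius F R (x $ i1) \<rho>)\<^sup>2"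
    using E(3) mid_norm_nonneg[of i1 i3 "y - x"] power_mono[of "mid (y - x)" "sqrt (\<rho>\<^sup>2 - (next_radius F R (x $ i1) \<rho>)\<^sup>2)" 2]
    by simp
  then show "(mid (y - x))\<^sup>2 \<le> width_const * ((y $ i1 - x $ i1) * trunc (x $ i1) (y $ i1 - x $ i1))"
    using gap(2)[OF b] by (simp add: trunc_def t_def[symmetric])
  show "\<bar>y $ i3 - x $ i3\<bar> \<le> height_const * (f (y $ i1) / p (y $ i1))"
    using gap(3)[OF b] E(4) by (simp add: t_def)
qed

lemma cone_bounds:
  assumes r: "small r" and y: "y \<in> cone r x" "\<bar>y $ i1\<bar> < r" and x: "\<bar>x $ i1\<bar> < R"
  defines "\<xi> \<equiv> \<bar>x $ i1\<bar>" and "t \<equiv> \<bar>y $ i1 - x $ i1\<bar>"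
  shows "0 < \<xi>" "0 < t" "\<xi> + t = \<bar>y $ i1\<bar>"
    and "(mid (y - x))\<^sup>2 \<le> width_const * (t * trunc \<xi> t)"
    and "\<bar>y $ i3 - x $ i3\<bar> \<le> height_const * (f (y $ i1) / p \<bar>y $ i1\<bar>)"
proof -
  have "0 < \<xi> \<and> 0 < t \<and> \<xi> + t = \<bar>y $ i1\<bar> \<and> (mid (y - x))\<^sup>2 \<le> width_const * (t * trunc \<xi> t) \<and>
    \<bar>y $ i3 - x $ i3\<bar> \<le> height_const * (f (y $ i1) / p \<bar>y $ i1\<bar>)"
  proof (cases "x $ i1" "0 :: real" rule: linorder_cases)
    case greater
    then have "y \<in> Gamma_pos F R i1 i3 x r" using y by (simp add: Gamma_tilde_def)
    note h = Gamma_pos_bounds[OF r this _ greater]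
    have *: "y $ i1 < r" "x $ i1 < R" using y x by auto
    have "\<xi> = x $ i1" "t = y $ i1 - x $ i1" "\<bar>y $ i1\<bar> = y $ i1"
      using greater h(1)[OF *] by (auto simp: \<xi>_def t_def)
    then show ?thesis using greater h[OF *] by simp
  next
    case equal then show ?thesis using y by (simp add: Gamma_tilde_def)
  next
    case less
    then have "reflect i1 y \<in> Gamma_pos F R i1 i3 (reflect i1 x) r" using y by (simp add: Gamma_tilde_def)
    note g = Gamma_pos_bounds[OF r this]
    have *: "reflect i1 y $ i1 < r" "0 < reflect i1 x $ i1" "reflect i1 x $ i1 < R" using less y x by auto
    have h: "- (x $ i1) < - (y $ i1)"
      "(mid (y - x))\<^sup>2 \<le> width_const * ((- (y $ i1) - - (x $ i1)) * trunc (- (x $ i1)) (- (y $ i1) - - (x $ i1)))"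
      "\<bar>y $ i3 - x $ i3\<bar> \<le> height_const * (f (- (y $ i1)) / p (- (y $ i1)))"
      using g[OF *] i13 by (simp_all del: minus_diff_minus)
    have "\<xi> = - (x $ i1)" "t = - (y $ i1) - - (x $ i1)" "\<bar>y $ i1\<bar> = - (y $ i1)" "f (y $ i1) = f (- (y $ i1))"
      using less h(1) by (auto simp: \<xi>_def t_def geom_f_def)
    then show ?thesis using less h by simp
  qed
  then show "0 < \<xi>" "0 < t" "\<xi> + t = \<bar>y $ i1\<bar>" "(mid (y - x))\<^sup>2 \<le> width_const * (t * trunc \<xi> t)"
    "\<bar>y $ i3 - x $ i3\<bar> \<le> height_const * (f (y $ i1) / p \<bar>y $ i1\<bar>)" by auto
qed

definition real_dist :: "real^'n \<Rightarrow> real^'n \<Rightarrow> real" where "real_dist x y = enn2real (d x y)"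

lemma d_eq_dr: "x \<in> strip \<Longrightarrow> y \<in> strip \<Longrightarrow> d x y = ennreal (real_dist x y)"
  using control_dist_finite[of x y] by (simp add: real_dist_def less_top)

lemma cone_dist_le:
  assumes r: "small r" and y: "y \<in> cone r x" "\<bar>y $ i1\<bar> < r" and x: "\<bar>x $ i1\<bar> < R"
  shows "real_dist x y \<le> dist_const * r"
proof -
  define \<xi> where "\<xi> = \<bar>x $ i1\<bar>"
  define t where "t = \<bar>y $ i1 - x $ i1\<bar>"
  note b = cone_bounds[OF assms, folded \<xi>_def t_def]
  have st: "x \<in> strip" "y \<in> strip" using x y smallD[OF r] by (auto simp: strip_def)
  have tr: "t \<le> r" using b y by simp
  have y0: "0 < \<bar>y $ i1\<bar>" "\<bar>y $ i1\<bar> < R" using b y smallD[OF r] by auto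
  have fy: "0 < f (y $ i1)" using y0 by (intro f_pos) auto
  have "(mid (y - x))\<^sup>2 \<le> width_const * (t * t)"
    using width_const_ge trunc_le[of \<xi> t] b(2) by (intro order_trans[OF b(4)] mult_left_mono) auto
  then have "sqrt ((mid (y - x))\<^sup>2) \<le> sqrt (width_const * t\<^sup>2)" by (intro real_sqrt_le_mono) (simp add: power2_eq_square)
  then have m: "mid (y - x) \<le> sqrt width_const * t" using b(2) mid_norm_nonneg[of i1 i3 "y - x"] by (simp add: real_sqrt_mult)
  have "sqrt ((y $ i1 - x $ i1)\<^sup>2 + (mid (y - x))\<^sup>2) \<le> t + mid (y - x)"
    using sqrt_sum_squares_le_sum_abs[of "y $ i1 - x $ i1" "mid (y - x)"] mid_norm_nonneg[of i1 i3 "y - x"]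
    by (simp add: t_def)
  also have "\<dots> \<le> (1 + sqrt width_const) * t" using m by (simp add: algebra_simps)
  also have "\<dots> \<le> (1 + sqrt width_const) * r" using tr width_const_ge by (intro mult_left_mono) auto
  finally have 1: "sqrt ((y $ i1 - x $ i1)\<^sup>2 + (mid (y - x))\<^sup>2) \<le> (1 + sqrt width_const) * r" .
  have "\<bar>y $ i3 - x $ i3\<bar> / f (y $ i1) \<le> height_const * (1 / p \<bar>y $ i1\<bar>)"
    using b(5) fy by (simp add: field_simps)
  also have "\<dots> \<le> height_const * (\<bar>y $ i1\<bar> / e0)" using height_const_ge y0 by (intro mult_left_mono inverse_p_le) auto
  also have "\<dots> \<le> height_const * (r / e0)" using height_const_ge y e0 by (intro mult_left_mono divide_right_mono) auto
  finally have 2: "\<bar>y $ i3 - x $ i3\<bar> / f (y $ i1) \<le> height_const / e0 * r" by simp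
  have "d x y \<le> ennreal (sqrt ((y $ i1 - x $ i1)\<^sup>2 + (mid (y - x))\<^sup>2) + \<bar>y $ i3 - x $ i3\<bar> / f (y $ i1))"
    using st y0 by (intro control_dist_corner) auto
  also have "\<dots> \<le> ennreal (dist_const * r)" using 1 2 by (intro ennreal_leI) (simp add: dist_const_def algebra_simps)
  finally show ?thesis
    using d_eq_dr[OF st] smallD[OF r] dist_const_ge by (simp add: ennreal_le_iff)
qed

lemma abs_diff_le_dr:
  assumes "x \<in> strip" "y \<in> strip" "i \<noteq> i3"
  shows "\<bar>y $ i - x $ i\<bar> \<le> real_dist x y"
proof (rule ccontr)
  assume "\<not> ?thesis"
  moreover have "0 \<le> real_dist x y" by (simp add: real_dist_def)
  ultimately have "d x y < ennreal \<bar>y $ i - x $ i\<bar>"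
    unfolding d_eq_dr[OF assms(1,2)] by (intro ennreal_lessI) auto
  from control_dist_component[OF this assms(3)] show False by simp
qed

text \<open>\<open>control_dist_vertical_bound\<close> needs a radius strictly above the distance;
  the radius is let decrease to it, using continuity of f.\<close>

lemma vertical_le_dr:
  assumes "x \<in> strip" "y \<in> strip" "\<bar>x $ i1\<bar> + real_dist x y < R"
  shows "\<bar>y $ i3 - x $ i3\<bar> \<le> real_dist x y * f (\<bar>x $ i1\<bar> + real_dist x y)"
proof -
  let ?D = "real_dist x y" and ?\<xi> = "\<bar>x $ i1\<bar>"
  have D0: "0 \<le> ?D" by (simp add: real_dist_def)
  have "isCont f (?\<xi> + ?D)"
    using continuous_on_f assms(3) D0 by (auto simp: continuous_on_eq_continuous_at)
  then have "isCont (\<lambda>D. f (?\<xi> + D)) ?D"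
    by (intro isCont_o2[where g = f and f = "\<lambda>D. ?\<xi> + D"] continuous_intros)
  then have "isCont (\<lambda>D. D * f (?\<xi> + D)) ?D"
    by (intro continuous_intros)
  then have "((\<lambda>D. D * f (?\<xi> + D)) \<longlongrightarrow> ?D * f (?\<xi> + ?D)) (at_right ?D)"
    by (auto simp: isCont_def intro: filterlim_at_split[THEN iffD1, THEN conjunct2])
  moreover have "eventually (\<lambda>D. \<bar>y $ i3 - x $ i3\<bar> \<le> D * f (?\<xi> + D)) (at_right ?D)"
  proof -
    have "eventually (\<lambda>D. D \<in> {?D<..<R - ?\<xi>}) (at_right ?D)"
      using assms(3) by (intro eventually_at_right_real) simp
    then show ?thesis
    proof eventually_elim
      case (elim D)
      then have "d x y < ennreal D" unfolding d_eq_dr[OF assms(1,2)] using D0 by (intro ennreal_lessI) auto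
      then show ?case using control_dist_vertical_bound[of x y D] elim by simp
    qed
  qed
  ultimately show ?thesis by (rule tendsto_lowerbound) simp
qed

lemma kernel_nonneg: "0 \<le> kernel F R i1 i3 r x y"
  by (auto simp: kernel_def d_hat_def Let_def)

text \<open>A default value: the distance is infinite, \<open>enn2real\<close> turns it into 0, and
  \<open>d_hat\<close> is then 0.\<close>

lemma kernel_outside_strip: "x \<notin> strip \<Longrightarrow> kernel F R i1 i3 r x y = 0"
proof -
  assume "x \<notin> strip"
  then have "d x y = \<infinity>" using control_dist_strip[of x y] by (auto simp: less_top[symmetric])
  then show ?thesis by (simp add: kernel_def d_hat_def)
qed

text \<open>The quotient \<open>d_hat / |B|\<close> is bounded by a decreasing function of the distance, so lower
  bounds for the distance suffice: the horizontal gap \<open>t\<close>, and the vertical gap over \<open>f\<close>.\<close>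

lemma kernel_le:
  assumes r: "small r" and y: "y \<in> cone r x" "\<bar>y $ i1\<bar> < r" and x: "\<bar>x $ i1\<bar> < R"
  defines "\<xi> \<equiv> \<bar>x $ i1\<bar>" and "t \<equiv> \<bar>y $ i1 - x $ i1\<bar>"
  shows "kernel F R i1 i3 r x y \<le> 1 / (vol_const *
    max (f (y $ i1) * trunc \<xi> t) (\<bar>y $ i3 - x $ i3\<bar> / height_const) * sqrt (t * trunc \<xi> t) ^ (CARD('n) - 2))"
proof -
  note b = cone_bounds[OF r y x, folded \<xi>_def t_def]
  have st: "x \<in> strip" "y \<in> strip" using x y smallD[OF r] by (auto simp: strip_def)
  let ?D = "real_dist x y" and ?z = "\<bar>y $ i3 - x $ i3\<bar>"
  have tD: "t \<le> ?D" using abs_diff_le_dr[OF st i13] by (simp add: t_def)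
  have \<xi>r: "\<xi> < r" using b y by simp
  have \<xi>D: "\<xi> + ?D < r0" using cone_dist_le[OF r y x] smallD[OF r] \<xi>r by simp
  have R: "\<xi> + ?D < R" using \<xi>D r0 by simp
  have D: "0 < ?D" using tD b by simp
  have T: "0 < trunc \<xi> ?D" "0 < trunc \<xi> t" using b D tD R by (auto intro!: trunc_pos)
  have Tm: "trunc \<xi> t \<le> trunc \<xi> ?D" using b tD R by (intro trunc_mono) auto
  have fm: "f (y $ i1) \<le> f (\<xi> + ?D)"
    using b(3) tD R by (intro f_mono_abs) auto
  have fy: "0 < f (y $ i1)" using b by (intro f_pos) auto
  have py: "0 < p \<bar>y $ i1\<bar>" using b y smallD[OF r] by (intro p_pos) auto
  have pD: "0 < p (\<xi> + ?D)" using b D R by (intro p_pos) auto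
  \<comment> \<open>The numerator \<open>trunc \<xi> ?D\<close> cancels one of the two such factors
    in the volume bound; Q is f times the other.\<close>
  define Q where "Q = f (\<xi> + ?D) * trunc \<xi> ?D"
  have Q0: "0 < Q" using fm fy T by (simp add: Q_def)
  have Q1: "f (y $ i1) * trunc \<xi> t \<le> Q" unfolding Q_def using fm Tm T f_nonneg by (intro mult_mono) auto
  \<comment> \<open>For short distances Q is f times the distance, which bounds any vertical
    displacement. For long ones Q is f / p at \<xi> + D, which dominates f / p at \<open>y_1\<close>
    and hence the height of the cone.\<close>
  have Q2: "?z / height_const \<le> Q"
  proof (cases "?D \<le> 1 / p (\<xi> + ?D)")
    case True
    then have "trunc \<xi> ?D = ?D" by (simp add: trunc_def)
    then have "?z \<le> Q" using vertical_le_dr[OF st] R by (simp add: Q_def \<xi>_def mult.commute)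
    moreover have "?z / height_const \<le> ?z / 1" using height_const_ge by (intro divide_left_mono) auto
    ultimately show ?thesis by simp
  next
    case False
    then have T': "trunc \<xi> ?D = 1 / p (\<xi> + ?D)" by (simp add: trunc_def)
    have "p (\<xi> + ?D) \<le> p \<bar>y $ i1\<bar>" using b tD R by (intro p_anti) auto
    then have "f (y $ i1) / p \<bar>y $ i1\<bar> \<le> f (\<xi> + ?D) / p (\<xi> + ?D)"
      using fm f_nonneg pD by (intro frac_le) auto
    also have "\<dots> = Q" by (simp add: Q_def T')
    finally have "height_const * (f (y $ i1) / p \<bar>y $ i1\<bar>) \<le> height_const * Q" using height_const_ge by (intro mult_left_mono) auto
    then have "?z \<le> height_const * Q" using b(5) by simp
    then show ?thesis using height_const_ge by (simp add: field_simps)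
  qed
  define V where "V = measure lborel (dball x ?D)"
  have V: "vol_const * (f (\<xi> + ?D) * (trunc \<xi> ?D)\<^sup>2 * sqrt (?D * trunc \<xi> ?D) ^ (CARD('n) - 2)) \<le> V"
    unfolding V_def using b(1) D \<xi>D by (intro measure_ball_ge) (auto simp: \<xi>_def)
  define W where "W = vol_const * Q * sqrt (?D * trunc \<xi> ?D) ^ (CARD('n) - 2)"
  have W0: "0 < W" using vol_const_pos Q0 D T by (simp add: W_def)
  have "trunc \<xi> ?D * W \<le> V" using V by (simp add: W_def Q_def power2_eq_square mult_ac)
  have V0: "0 < V" using \<open>trunc \<xi> ?D * W \<le> V\<close> mult_pos_pos[OF T(1) W0] by linarith
  have "d_hat F R i1 i3 x y = trunc \<xi> ?D"
    using abs_deriv_F[of "\<xi> + ?D"] b D R by (simp add: d_hat_def Let_def trunc_def real_dist_def[symmetric] \<xi>_def)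
  then have "kernel F R i1 i3 r x y = trunc \<xi> ?D / V"
    using y by (simp add: kernel_def V_def real_dist_def)
  also have "\<dots> \<le> 1 / W"
    using \<open>trunc \<xi> ?D * W \<le> V\<close> V0 W0 by (simp add: field_simps)
  also have "\<dots> \<le> 1 / (vol_const * max (f (y $ i1) * trunc \<xi> t) (?z / height_const) * sqrt (t * trunc \<xi> t) ^ (CARD('n) - 2))"
  proof (rule divide_left_mono)
    have mx: "0 < max (f (y $ i1) * trunc \<xi> t) (?z / height_const)" using fy T by (auto simp: less_max_iff_disj)
    have "sqrt (t * trunc \<xi> t) \<le> sqrt (?D * trunc \<xi> ?D)"
      using tD Tm T b D by (intro real_sqrt_le_mono mult_mono) auto
    then show "vol_const * max (f (y $ i1) * trunc \<xi> t) (?z / height_const) * sqrt (t * trunc \<xi> t) ^ (CARD('n) - 2) \<le> W"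
      unfolding W_def using Q1 Q2 vol_const_pos T b Q0 mx by (intro mult_mono power_mono) (auto intro: less_imp_le)
    show "0 < W * (vol_const * max (f (y $ i1) * trunc \<xi> t) (?z / height_const) * sqrt (t * trunc \<xi> t) ^ (CARD('n) - 2))"
      using W0 vol_const_pos T b mx by (intro mult_pos_pos zero_less_power) auto
  qed simp
  finally show ?thesis .
qed

lemma measurable_dr [measurable]: "(\<lambda>(x, y). real_dist x y) \<in> borel_measurable (borel \<Otimes>\<^sub>M borel)"
proof -
  have "(\<lambda>z. enn2real ((\<lambda>(x, y). d x y) z)) \<in> borel_measurable (borel \<Otimes>\<^sub>M borel)"
    by (intro measurable_compose[OF measurable_control_dist]) simp
  then show ?thesis by (simp add: real_dist_def case_prod_unfold)
qed

text \<open>The ball with variable centre and radius is a section of a Borel set of triples, so its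
  volume is measurable by Tonelli.\<close>

lemma measurable_ball_volume:
  "(\<lambda>(x, y). measure lborel (dball x (real_dist x y))) \<in> borel_measurable (borel \<Otimes>\<^sub>M borel)"
proof -
  define Q where "Q = {w \<in> space ((borel \<Otimes>\<^sub>M borel) \<Otimes>\<^sub>M lborel).
    (\<lambda>(x, z). d x z) (fst (fst w), snd w) < ennreal ((\<lambda>(x, y). real_dist x y) (fst w))}"
  have "Q \<in> sets ((borel \<Otimes>\<^sub>M borel) \<Otimes>\<^sub>M lborel)"
    unfolding Q_def
  proof (intro borel_measurable_less)
    show "(\<lambda>w. (\<lambda>(x, z). d x z) (fst (fst w), snd w)) \<in> borel_measurable ((borel \<Otimes>\<^sub>M borel) \<Otimes>\<^sub>M lborel)"
      by (rule measurable_compose[OF _ measurable_control_dist]) measurable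
    show "(\<lambda>w. ennreal ((\<lambda>(x, y). real_dist x y) (fst w))) \<in> borel_measurable ((borel \<Otimes>\<^sub>M borel) \<Otimes>\<^sub>M lborel)"
      by (rule measurable_compose[OF _ measurable_ennreal], rule measurable_compose[OF measurable_fst measurable_dr])
  qed
  from lborel.measurable_emeasure_Pair[OF this]
  have m: "(\<lambda>w. enn2real (emeasure lborel (Pair w -` Q))) \<in> borel_measurable (borel \<Otimes>\<^sub>M borel)"
    by (intro measurable_compose[OF _ borel_measurable_enn2real]) auto
  have "Pair (x, y) -` Q = dball x (real_dist x y)" for x y
    by (auto simp: Q_def mem_dball space_pair_measure)
  then have "(\<lambda>w. enn2real (emeasure lborel (Pair w -` Q))) = (\<lambda>(x, y). measure lborel (dball x (real_dist x y)))"
    by (auto simp: fun_eq_iff measure_def)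
  then show ?thesis using m by simp
qed

lemma measurable_indicator_near:
  assumes "g \<in> borel_measurable (near r)"
  shows "(\<lambda>x. indicator {0<..<r} x *\<^sub>R (g x :: real)) \<in> borel_measurable borel"
  using assms by (simp add: near_def borel_measurable_restrict_space_iff)

lemma pred_Gamma_pos:
  assumes r: "0 < r" "r + r < R"
  shows "Measurable.pred (borel \<Otimes>\<^sub>M borel) (\<lambda>(x, y). 0 < x $ i1 \<and> x $ i1 < r \<and> y \<in> Gamma_pos F R i1 i3 x r)"
proof -
  define \<rho> where "\<rho> k x = indicator {0<..<r} x *\<^sub>R radius_seq F R x r k" for k x
  define h where "h k x = indicator {0<..<r} x *\<^sub>R h_star F x (radius_seq F R x r k)" for k x
  have [measurable]: "\<rho> k \<in> borel_measurable borel" for k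
    unfolding \<rho>_def[abs_def] by (intro measurable_indicator_near measurable_radius_seq r)
  have [measurable]: "h k \<in> borel_measurable borel" for k
    unfolding h_def[abs_def]
  proof (intro measurable_indicator_near measurable_h_star measurable_radius_seq r)
    fix x assume "x \<in> {0<..<r}"
    then show "0 < radius_seq F R x r k \<and> radius_seq F R x r k \<le> r"
      using r by (intro radius_seq_bounds) auto
  qed
  have "(\<lambda>(x, y). 0 < x $ i1 \<and> x $ i1 < r \<and> y \<in> Gamma_pos F R i1 i3 x r)
    = (\<lambda>w. 0 < fst w $ i1 \<and> fst w $ i1 < r \<and> (\<exists>k\<in>{1..}.
        \<rho> (Suc k) (fst w $ i1) \<le> snd w $ i1 - fst w $ i1 \<and> snd w $ i1 - fst w $ i1 < \<rho> k (fst w $ i1) \<and>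
        mid (snd w - fst w) < sqrt ((\<rho> k (fst w $ i1))\<^sup>2 - (\<rho> (Suc k) (fst w $ i1))\<^sup>2) \<and>
        \<bar>snd w $ i3 - fst w $ i3\<bar> < h k (fst w $ i1)))"
    by (auto simp: fun_eq_iff Gamma_pos_def E_tilde_def \<rho>_def h_def radius_seq_Suc)
  moreover have "Measurable.pred (borel \<Otimes>\<^sub>M borel) \<dots>" by measurable
  ultimately show ?thesis by simp
qed

lemma pred_cone:
  assumes r: "0 < r" "r + r < R"
  shows "Measurable.pred (borel \<Otimes>\<^sub>M borel) (\<lambda>(x, y). \<bar>x $ i1\<bar> < r \<and> y \<in> cone r x)"
proof -
  let ?P = "\<lambda>(x, y). 0 < x $ i1 \<and> x $ i1 < r \<and> y \<in> Gamma_pos F R i1 i3 x r"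
  note [measurable] = pred_Gamma_pos[OF r]
  have "Measurable.pred (borel \<Otimes>\<^sub>M borel) (\<lambda>w. ?P (reflect i1 (fst w), reflect i1 (snd w)))"
    by (rule measurable_compose[OF _ pred_Gamma_pos[OF r]]) measurable
  then have P: "Measurable.pred (borel \<Otimes>\<^sub>M borel) (\<lambda>w. ?P w \<or> ?P (reflect i1 (fst w), reflect i1 (snd w)))"
    using pred_Gamma_pos[OF r] by (intro pred_intros_logic)
  have eq: "(\<lambda>w. ?P w \<or> ?P (reflect i1 (fst w), reflect i1 (snd w))) = (\<lambda>(x, y). \<bar>x $ i1\<bar> < r \<and> y \<in> cone r x)"
    using r by (auto simp: fun_eq_iff Gamma_tilde_def)
  show ?thesis
    by (rule back_subst[where P = "Measurable.pred (borel \<Otimes>\<^sub>M borel)", OF P eq])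
qed

definition center_ball :: "real \<Rightarrow> (real^'n) set" where "center_ball r = dball 0 r"

lemma center_ball_nth: "y \<in> center_ball r \<Longrightarrow> i \<noteq> i3 \<Longrightarrow> \<bar>y $ i\<bar> < r"
  using control_dist_component[of 0 y r i] by (simp add: center_ball_def mem_dball)

lemma kernel_measurable:
  assumes r: "small r"
  shows "(\<lambda>(x, y). indicator (center_ball r) y * kernel F R i1 i3 r x y) \<in> borel_measurable borel"
proof -
  note r' = smallD[OF r]
  \<comment> \<open>The derivative of F is arbitrary outside (0, R), so p is cut off to obtain a
    Borel function on the line.\<close>
  define q where "q u = indicator {0<..<R} u *\<^sub>R p u" for u
  have qm: "q \<in> borel_measurable borel"
    unfolding q_def[abs_def] by (intro borel_measurable_continuous_on_indicator continuous_on_p) auto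
  \<comment> \<open>Restricting to first coordinates of x below r in absolute value loses nothing:
    if y lies in the central ball and in the cone of x, then \<open>cone_bounds\<close> puts x
    closer to the hyperplane than y, and outside the strip the kernel vanishes.\<close>
  define K where "K w = (if (\<bar>fst w $ i1\<bar> < r \<and> snd w \<in> cone r (fst w)) \<and> snd w \<in> center_ball r
    then min (real_dist (fst w) (snd w)) (1 / q (\<bar>fst w $ i1\<bar> + real_dist (fst w) (snd w))) / measure lborel (dball (fst w) (real_dist (fst w) (snd w)))
    else 0)" for w :: "(real^'n) \<times> (real^'n)"
  have eq: "indicator (center_ball r) y * kernel F R i1 i3 r x y = K (x, y)" for x y
  proof (cases "y \<in> center_ball r \<and> y \<in> cone r x \<and> \<bar>x $ i1\<bar> < R")
    case True
    then have y: "\<bar>y $ i1\<bar> < r" using center_ball_nth[of y r i1] i13 by simp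
    have b: "0 < \<bar>x $ i1\<bar>" "\<bar>x $ i1\<bar> < r"
      using cone_bounds(1-3)[of r y x] r y True by auto
    have D: "0 \<le> real_dist x y" "real_dist x y \<le> dist_const * r" using cone_dist_le[OF r _ y, of x] True by (auto simp: real_dist_def)
    then have "\<bar>x $ i1\<bar> + real_dist x y < R" using b r' r0 by simp
    then have "\<bar>deriv F (\<bar>x $ i1\<bar> + real_dist x y)\<bar> = q (\<bar>x $ i1\<bar> + real_dist x y)"
      using b D by (subst abs_deriv_F) (auto simp: q_def)
    then show ?thesis using True b by (simp add: K_def kernel_def d_hat_def Let_def real_dist_def[symmetric])
  next
    case False
    then consider "y \<notin> center_ball r" | "y \<notin> cone r x" | "x \<notin> strip" by (auto simp: strip_def)
    then show ?thesis
    proof cases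
      case 3
      then show ?thesis using r' kernel_outside_strip[OF 3] by (auto simp: K_def strip_def)
    qed (auto simp: K_def kernel_def)
  qed
  have c: "Measurable.pred (borel \<Otimes>\<^sub>M borel) (\<lambda>w. \<bar>fst w $ i1\<bar> < r \<and> snd w \<in> cone r (fst w))"
    using pred_cone[of r] r' by (simp add: case_prod_unfold)
  have dm: "(\<lambda>w. real_dist (fst w) (snd w)) \<in> borel_measurable (borel \<Otimes>\<^sub>M borel)"
    using measurable_dr by (simp add: case_prod_unfold)
  have vm: "(\<lambda>w. measure lborel (dball (fst w) (real_dist (fst w) (snd w)))) \<in> borel_measurable (borel \<Otimes>\<^sub>M borel)"
    using measurable_ball_volume by (simp add: case_prod_unfold)
  have [measurable]: "center_ball r \<in> sets borel" by (simp add: center_ball_def)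
  have bm: "Measurable.pred (borel \<Otimes>\<^sub>M borel) (\<lambda>w::(real^'n) \<times> (real^'n). snd w \<in> center_ball r)" by measurable
  have sm: "(\<lambda>w. \<bar>fst w $ i1\<bar> + real_dist (fst w) (snd w)) \<in> borel_measurable (borel \<Otimes>\<^sub>M borel)"
    by (intro borel_measurable_add dm) measurable
  have cb: "Measurable.pred (borel \<Otimes>\<^sub>M borel) (\<lambda>w. (\<bar>fst w $ i1\<bar> < r \<and> snd w \<in> cone r (fst w)) \<and> snd w \<in> center_ball r)"
    by (intro pred_intros_logic c bm)
  have "K \<in> borel_measurable (borel \<Otimes>\<^sub>M borel)"
    unfolding K_def
    by (intro measurable_If cb[unfolded pred_def] borel_measurable_divide borel_measurable_min dm vm
      borel_measurable_const measurable_compose[OF sm qm])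
  then show ?thesis
    unfolding eq by (simp add: borel_prod)
qed

end

section \<open>Integration of the kernel\<close>

text \<open>Tonelli for integrands that become products of one-variable functions once coordinate k
  is fixed. Lebesgue measure is the image of the product measure over \<open>Basis\<close>, whose
  elements e indexes by coordinates.\<close>

lemma nn_integral_prod_fibers:
  fixes g :: "'n::finite \<Rightarrow> real \<Rightarrow> real \<Rightarrow> ennreal" and k :: 'n
  assumes g: "\<And>i. (\<lambda>(s, u). g i s u) \<in> borel_measurable (borel \<Otimes>\<^sub>M borel)"
  shows "(\<integral>\<^sup>+x. (\<Prod>i\<in>UNIV - {k}. g i (x $ k) (x $ i)) \<partial>(lborel :: (real^'n) measure))
    = (\<integral>\<^sup>+s. (\<Prod>i\<in>UNIV - {k}. \<integral>\<^sup>+u. g i s u \<partial>lborel) \<partial>lborel)"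
proof -
  interpret product_sigma_finite "\<lambda>b::real^'n. lborel :: real measure" ..
  define e :: "'n \<Rightarrow> real^'n" where "e i = axis i 1" for i
  have inj: "inj e" by (auto simp: inj_def e_def axis_eq_axis)
  have Basis: "Basis = range e" by (auto simp: Basis_vec_def e_def)
  define I where "I = Basis - {e k}"
  have I: "finite I" "e k \<notin> I" "Basis = insert (e k) I" "I = e ` (UNIV - {k})"
    using inj by (auto simp: I_def Basis inj_image_mem_iff dest: injD)
  define idx where "idx = inv e"
  have idx: "idx (e i) = i" for i using inj by (simp add: idx_def inv_f_f)
  have gm: "(\<lambda>x. g i (h x) (h' x)) \<in> borel_measurable M"
    if "h \<in> borel_measurable M" "h' \<in> borel_measurable M" for i M and h h' :: "_ \<Rightarrow> real"
    using measurable_compose[OF measurable_Pair[OF that] g[of i]] by simp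
  have nth: "(\<Sum>b\<in>Basis. w b *\<^sub>R b) $ i = w (e i)" for w :: "real^'n \<Rightarrow> real" and i
  proof -
    have "(\<Sum>b\<in>Basis. w b *\<^sub>R b) $ i = (\<Sum>b\<in>Basis. w b *\<^sub>R b) \<bullet> e i"
      by (simp add: e_def inner_axis)
    also have "\<dots> = w (e i)" by (intro inner_sum_left_Basis) (auto simp: Basis)
    finally show ?thesis .
  qed
  have prod_idx: "(\<Prod>i\<in>UNIV - {k}. h i (e i)) = (\<Prod>b\<in>I. h (idx b) b)" for h :: "'n \<Rightarrow> real^'n \<Rightarrow> ennreal"
    unfolding I(4) using inj by (subst prod.reindex) (auto simp: idx inj_on_def dest: injD)
  have "(\<integral>\<^sup>+x. (\<Prod>i\<in>UNIV - {k}. g i (x $ k) (x $ i)) \<partial>(lborel :: (real^'n) measure))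
    = (\<integral>\<^sup>+w. (\<Prod>i\<in>UNIV - {k}. g i (w (e k)) (w (e i))) \<partial>(\<Pi>\<^sub>M b\<in>Basis. lborel))"
  proof (subst lborel_eq, subst nn_integral_distr)
    show "(\<lambda>f. \<Sum>b\<in>Basis. f b *\<^sub>R (b::real^'n)) \<in> borel_measurable (\<Pi>\<^sub>M b\<in>Basis. lborel)"
      by simp
    show "(\<lambda>x. \<Prod>i\<in>UNIV - {k}. g i (x $ k) (x $ i)) \<in> borel_measurable
       (distr (\<Pi>\<^sub>M b\<in>Basis. lborel) borel (\<lambda>f. \<Sum>b\<in>Basis. f b *\<^sub>R (b::real^'n)))"
      by (intro borel_measurable_prod_ennreal gm) (simp_all add: measurable_vec_nth)
  qed (simp only: nth)
  also have "\<dots> = (\<integral>\<^sup>+w. (\<Prod>b\<in>I. g (idx b) (w (e k)) (w b)) \<partial>(\<Pi>\<^sub>M b\<in>insert (e k) I. lborel))"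
    unfolding I(3) by (intro nn_integral_cong) (rule prod_idx)
  also have "\<dots> = (\<integral>\<^sup>+s. (\<integral>\<^sup>+w. (\<Prod>b\<in>I. g (idx b) s (w b)) \<partial>(\<Pi>\<^sub>M b\<in>I. lborel)) \<partial>lborel)"
  proof -
    have "(\<lambda>w. \<Prod>b\<in>I. g (idx b) (w (e k)) (w b)) \<in> borel_measurable (\<Pi>\<^sub>M b\<in>insert (e k) I. lborel)"
      by (intro borel_measurable_prod_ennreal gm) (auto intro!: measurable_component_singleton[where M = "\<lambda>_. lborel", simplified])
    from product_nn_integral_insert_rev[OF I(1,2) this] show ?thesis
      by (simp only:) (intro nn_integral_cong prod.cong refl, use I(2) in auto)
  qed
  also have "\<dots> = (\<integral>\<^sup>+s. (\<Prod>b\<in>I. \<integral>\<^sup>+u. g (idx b) s u \<partial>lborel) \<partial>lborel)"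
    using I by (intro nn_integral_cong product_nn_integral_prod) (auto intro!: gm)
  also have "\<dots> = (\<integral>\<^sup>+s. (\<Prod>i\<in>UNIV - {k}. \<integral>\<^sup>+u. g i s u \<partial>lborel) \<partial>lborel)"
    by (intro nn_integral_cong prod_idx[symmetric])
  finally show ?thesis .
qed

lemma nn_integral_abs_powr:
  fixes c \<delta> H :: real
  assumes "0 < \<delta>" "0 \<le> H"
  shows "(\<integral>\<^sup>+u. ennreal (\<bar>u - c\<bar> powr (\<delta> - 1)) * indicator {c - H..c + H} u \<partial>lborel) = ennreal (2 * (H powr \<delta> / \<delta>))"
proof -
  define h where "h u = ennreal (u powr (\<delta> - 1)) * indicator {0..H} u" for u :: real
  have hm: "h \<in> borel_measurable borel" unfolding h_def by measurable
  have "((\<lambda>u. u powr (\<delta> - 1)) has_integral (H powr (\<delta> - 1 + 1) / (\<delta> - 1 + 1))) {0..H}"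
    using assms by (intro has_integral_powr_from_0) auto
  then have "(\<integral>\<^sup>+u. ennreal (indicator {0..H} u * u powr (\<delta> - 1)) \<partial>lborel) = ennreal (H powr \<delta> / \<delta>)"
    by (intro nn_integral_has_integral_lebesgue) auto
  then have h: "(\<integral>\<^sup>+u. h u \<partial>lborel) = ennreal (H powr \<delta> / \<delta>)"
    by (simp add: h_def ennreal_mult' ennreal_indicator mult.commute)
  have "(\<integral>\<^sup>+u. ennreal (\<bar>u - c\<bar> powr (\<delta> - 1)) * indicator {c - H..c + H} u \<partial>lborel)
    = (\<integral>\<^sup>+u. h (- c + 1 * u) + h (c + (- 1) * u) \<partial>lborel)"
  proof (intro nn_integral_cong_AE eventually_mono[OF AE_lborel_singleton[of c]])
    fix u assume "u \<noteq> c"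
    then show "ennreal (\<bar>u - c\<bar> powr (\<delta> - 1)) * indicator {c - H..c + H} u = h (- c + 1 * u) + h (c + (- 1) * u)"
      by (cases "u < c") (auto simp: h_def indicator_def)
  qed
  also have "\<dots> = (\<integral>\<^sup>+u. h (- c + 1 * u) \<partial>lborel) + (\<integral>\<^sup>+u. h (c + (- 1) * u) \<partial>lborel)"
    by (intro nn_integral_add measurable_compose[OF _ hm]) simp_all
  also have "\<dots> = (\<integral>\<^sup>+u. h u \<partial>lborel) + (\<integral>\<^sup>+u. h u \<partial>lborel)"
    using nn_integral_real_affine[OF hm, of 1 "- c"] nn_integral_real_affine[OF hm, of "- 1" c] by simp
  also have "\<dots> = ennreal (2 * (H powr \<delta> / \<delta>))"
    unfolding h mult_2 using assms by (intro ennreal_plus[symmetric]) auto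
  finally show ?thesis .
qed

lemma AE_component_neq: "AE x in (lborel :: (real^'n::finite) measure). x $ i \<noteq> c"
proof -
  have "negligible {x::real^'n. axis i 1 \<bullet> x = c}" by (rule negligible_hyperplane) (simp add: axis_eq_0_iff)
  then have "negligible {x::real^'n. x $ i = c}" by (simp add: inner_axis')
  then have "{x::real^'n. x $ i = c} \<in> null_sets lebesgue" by (simp add: negligible_iff_null_sets)
  then have "AE x in lebesgue. (x::real^'n) $ i \<noteq> c" by (rule AE_I') auto
  then show ?thesis by (simp add: AE_completion_iff)
qed

section \<open>The logarithm of the kernel\<close>

locale orlicz_geometry = degenerate_metric F R r0 e0 a i1 i3 for F R r0 e0 a and i1 i3 :: "'n::finite" +
  fixes N C :: real
  assumes N: "1 < N" and C: "0 < C" and aN: "a * N < 1"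
begin

definition \<phi> :: "real \<Rightarrow> real" where "\<phi> r = C * p r powr N * r powr (N + 1)"

lemma \<phi>_eq: "0 < r \<Longrightarrow> r < R \<Longrightarrow> \<phi> r = C * r * (r * p r) powr N"
  using p_pos[of r] by (simp add: \<phi>_def powr_mult powr_add)

lemma \<phi>_pos: "0 < r \<Longrightarrow> r < R \<Longrightarrow> 0 < \<phi> r"
  using p_pos[of r] C by (simp add: \<phi>_eq)

text \<open>The logarithm of the constant left in the ratio of \<open>log_ratio_bound\<close> after
  r p(r) has been replaced by its lower bound \<open>e0\<close>.\<close>

definition volume_log :: real where "volume_log = ln (2 ^ CARD('n) / (vol_const * C * e0 powr N))"

text \<open>The summands account for \<open>volume_log\<close>, for the drop of F, for the powers of
  r / \<tau>, and for the threshold 2 N built into \<open>Phi N\<close>.\<close>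

definition log_const :: real where
  "log_const = \<bar>volume_log\<bar> / e0 + 1 / a + real (CARD('n) - 1) * (1 + 2 / (a * e0)) + 2 * N / e0"

text \<open>By \<open>p_growth\<close>, -F' is dominated by a multiple of u^(-1-a). Subtracting the
  corresponding multiple of u^(-a) from F therefore leaves a nondecreasing function, and the
  subtracted term at r may be dropped.\<close>

lemma F_growth:
  assumes "0 < y" "y < r" "r < r0"
  shows "F y - F r \<le> r * p r * ((r / y) powr a / a)"
proof -
  define P where "P = r * p r * r powr a / a"
  define h where "h u = F u - P * u powr (- a)" for u
  have "h y \<le> h r"
  proof (rule DERIV_nonneg_imp_nondecreasing[where f = h])
    fix u assume u: "y \<le> u" "u \<le> r"
    have u0: "0 < u" "u < R" using u assms r0 by auto
    have "(h has_real_derivative (- p u - P * (- a * u powr (- a - 1)))) (at u)"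
      unfolding h_def using u0
      by (auto intro!: derivative_eq_intros F_deriv)
    moreover have "p u \<le> P * a * u powr (- a - 1)"
    proof -
      have "p u \<le> p r * (r / u) powr (1 + a)" using u u0 assms by (intro p_growth) auto
      also have "\<dots> = p r * (r * r powr a * u powr (- a - 1))"
        using u0 assms by (simp add: powr_divide powr_add powr_minus powr_diff field_simps)
      also have "\<dots> = P * a * u powr (- a - 1)" using a by (simp add: P_def)
      finally show ?thesis .
    qed
    ultimately show "\<exists>D. (h has_real_derivative D) (at u) \<and> 0 \<le> D"
      by (intro exI[of _ "- p u - P * (- a * u powr (- a - 1))"]) auto
  qed (use assms in simp)
  moreover have "0 \<le> P * r powr (- a)" using assms a p_pos[of r] r0 by (simp add: P_def)
  ultimately have "F y - F r \<le> P * y powr (- a)" by (simp add: h_def)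
  also have "\<dots> = r * p r * ((r / y) powr a / a)"
    using assms by (simp add: P_def powr_divide powr_minus field_simps)
  finally show ?thesis .
qed

lemma ln_le_powr: "1 \<le> z \<Longrightarrow> ln z \<le> z powr a / a"
  using ln_powr_bound[of z a] a by simp

lemma log_ratio_bound:
  assumes r: "0 < r" "r < r0" and t: "0 < t" "t \<le> y" "y < r"
  defines "\<tau> \<equiv> min t (1 / p y)"
  shows "ln ((2 * r) ^ CARD('n) * f r / (vol_const * f y * \<tau> ^ (CARD('n) - 1) * \<phi> r)) \<le> log_const * (r * p r) * (r / t) powr a"
    and "2 * N \<le> log_const * (r * p r) * (r / t) powr a"
proof -
  let ?n = "CARD('n)"
  define P where "P = r * p r"
  define \<theta> where "\<theta> = (r / t) powr a"
  have R: "r < R" "y < R" "0 < y" using r t r0 by auto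
  have P: "e0 \<le> P" using p_ge[of r] r R by (simp add: P_def)
  then have P0: "0 < P" using e0 by simp
  have rt: "1 < r / t" using t by simp
  have \<theta>: "1 \<le> \<theta>" using rt a by (simp add: \<theta>_def ge_one_powr_ge_zero)
  \<comment> \<open>P \<theta> is the common yardstick: P >= \<open>e0\<close> and \<theta> >= 1
    absorb constants into it, and ln(r / t) <= \<theta> / a absorbs powers of r / t.\<close>
  have "P * 1 \<le> P * \<theta>" using P0 \<theta> by (intro mult_left_mono) auto
  then have P\<theta>: "P \<le> P * \<theta>" "e0 \<le> P * \<theta>" "e0 * \<theta> \<le> P * \<theta>"
    using P \<theta> mult_right_mono[OF P, of \<theta>] by auto
  have py: "0 < p y" using R by (intro p_pos)
  have \<tau>: "0 < \<tau>" using t py by (simp add: \<tau>_def)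
  have fr: "0 < f r" "0 < f y" using r R by (auto intro: f_pos)
  \<comment> \<open>A crude polynomial bound is enough, since only its logarithm is used.\<close>
  have r\<tau>: "r / \<tau> \<le> (1 + P) * (r / t)\<^sup>2"
  proof (cases "t \<le> 1 / p y")
    case True
    then have "r / \<tau> = 1 * (r / t)" by (simp add: \<tau>_def)
    also have "\<dots> \<le> (1 + P) * (r / t)\<^sup>2" using P0 rt by (intro mult_mono self_le_power) auto
    finally show ?thesis .
  next
    case False
    then have "r / \<tau> = r * p y" by (simp add: \<tau>_def)
    also have "\<dots> \<le> r * ((r / y)\<^sup>2 * p r)" using r t R by (intro mult_left_mono p_double) auto
    also have "\<dots> = P * (r / y)\<^sup>2" by (simp add: P_def)
    also have "\<dots> \<le> (1 + P) * (r / t)\<^sup>2"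
      using P0 r t R by (intro mult_mono power_mono divide_left_mono) auto
    finally show ?thesis .
  qed
  have lr: "ln (r / \<tau>) \<le> P * \<theta> * (1 + 2 / (a * e0))"
  proof -
    have "ln (r / \<tau>) \<le> ln ((1 + P) * (r / t)\<^sup>2)"
      using r\<tau> r \<tau> by (intro ln_mono) auto
    also have "\<dots> = ln (1 + P) + 2 * ln (r / t)" using P0 r t by (simp add: ln_mult ln_realpow)
    also have "ln (1 + P) \<le> P" using P0 by (intro ln_add_one_self_le_self) auto
    also have "P \<le> P * \<theta>" by (rule P\<theta>)
    also have "ln (r / t) \<le> \<theta> / a" unfolding \<theta>_def using rt by (intro ln_le_powr) auto
    also have "\<theta> / a \<le> (P * \<theta>) / (a * e0)" using P\<theta>(3) a e0 by (simp add: field_simps)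
    finally show ?thesis by (simp add: algebra_simps)
  qed
  have Ff: "F y - F r \<le> P * \<theta> * (1 / a)"
  proof -
    have "F y - F r \<le> P * ((r / y) powr a / a)" using F_growth[of y r] R r t by (simp add: P_def)
    also have "\<dots> \<le> P * (\<theta> / a)" unfolding \<theta>_def
      using P0 R r t a by (intro mult_left_mono divide_right_mono powr_mono2 divide_left_mono) auto
    finally show ?thesis by simp
  qed
  have volume_log: "volume_log \<le> P * \<theta> * (\<bar>volume_log\<bar> / e0)"
  proof -
    have "\<bar>volume_log\<bar> * e0 \<le> \<bar>volume_log\<bar> * (P * \<theta>)" using P\<theta> by (intro mult_left_mono) auto
    then have "\<bar>volume_log\<bar> \<le> P * \<theta> * (\<bar>volume_log\<bar> / e0)" using e0 by (simp add: field_simps)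
    then show ?thesis by linarith
  qed
  define X where "X = (2 * r) ^ ?n * f r / (vol_const * f y * \<tau> ^ (?n - 1) * \<phi> r)"
  have n: "?n = Suc (?n - 1)" using n_ge_2 by simp
  have "X = 2 ^ ?n / (vol_const * C * P powr N) * (f r / f y) * (r / \<tau>) ^ (?n - 1)"
  proof -
    have "(2 * r) ^ ?n = 2 ^ ?n * (r * r ^ (?n - 1))"
      by (subst power_mult_distrib) (metis n power_Suc)
    then show ?thesis
      unfolding X_def \<phi>_eq[OF r(1) R(1)] P_def[symmetric] using r \<tau> by (simp add: power_divide field_simps)
  qed
  also have "\<dots> \<le> 2 ^ ?n / (vol_const * C * e0 powr N) * (f r / f y) * (r / \<tau>) ^ (?n - 1)"
    using P e0 N vol_const_pos C fr r \<tau>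
    by (intro mult_right_mono divide_left_mono mult_left_mono powr_mono2 mult_pos_pos) auto
  finally have "ln X \<le> ln (2 ^ ?n / (vol_const * C * e0 powr N) * (f r / f y) * (r / \<tau>) ^ (?n - 1))"
    using vol_const_pos fr r \<tau> \<phi>_pos[of r] R by (intro ln_mono) (auto simp: X_def)
  also have "\<dots> = volume_log + ln (f r / f y) + real (?n - 1) * ln (r / \<tau>)"
  proof -
    have pos: "0 < 2 ^ ?n / (vol_const * C * e0 powr N)" "0 < f r / f y" "0 < (r / \<tau>) ^ (?n - 1)" "0 < r / \<tau>"
      using vol_const_pos C e0 fr r \<tau> by auto
    show ?thesis
      unfolding ln_mult_pos[OF mult_pos_pos[OF pos(1,2)] pos(3)] ln_mult_pos[OF pos(1,2)] ln_realpow volume_log_def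
      by (rule refl)
  qed
  also have "ln (f r / f y) = F y - F r" using r R by (simp add: f_eq ln_div)
  also have "volume_log + (F y - F r) + real (?n - 1) * ln (r / \<tau>)
    \<le> P * \<theta> * (\<bar>volume_log\<bar> / e0) + P * \<theta> * (1 / a) + real (?n - 1) * (P * \<theta> * (1 + 2 / (a * e0)))"
    by (intro add_mono volume_log Ff mult_left_mono lr) auto
  also have "\<dots> \<le> log_const * P * \<theta>"
    using N e0 P0 \<theta> by (simp add: log_const_def algebra_simps)
  finally show "ln ((2 * r) ^ ?n * f r / (vol_const * f y * \<tau> ^ (?n - 1) * \<phi> r)) \<le> log_const * (r * p r) * (r / t) powr a"
    by (simp add: X_def P_def \<theta>_def)
  have "2 * N = 2 * N / e0 * e0" using e0 by simp
  also have "\<dots> \<le> 2 * N / e0 * (P * \<theta>)" using P\<theta> N e0 by (intro mult_left_mono) auto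
  also have "\<dots> \<le> log_const * (P * \<theta>)"
    unfolding log_const_def using P0 \<theta> a e0 by (intro mult_right_mono) auto
  finally show "2 * N \<le> log_const * (r * p r) * (r / t) powr a"
    by (simp add: P_def \<theta>_def mult.assoc)
qed

lemma log_const_pos: "0 < log_const"
  unfolding log_const_def using a e0 N by (intro add_nonneg_pos) auto

end

text \<open>The assertion at a single radius with a single constant, so that comparing two weights
  becomes monotonicity in K.\<close>

definition sobolev_bound ::
    "(real \<Rightarrow> real) \<Rightarrow> real \<Rightarrow> 'n::finite \<Rightarrow> 'n \<Rightarrow> real \<Rightarrow> real \<Rightarrow> real \<Rightarrow> bool" where
  "sobolev_bound F R i1 i3 N r K \<longleftrightarrow>
     (\<forall>g. integrable (ball_measure F R i1 i3 r) g \<longrightarrow>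
        (AE x in ball_measure F R i1 i3 r.
           set_integrable lebesgue (control_ball F R i1 i3 0 r) (\<lambda>y. kernel F R i1 i3 r x y * g y)) \<and>
        T_op F R i1 i3 r g \<in> borel_measurable (ball_measure F R i1 i3 r) \<and>
        luxemburg_norm (Phi N) (ball_measure F R i1 i3 r) (T_op F R i1 i3 r g)
          \<le> ennreal (K * (LINT x|ball_measure F R i1 i3 r. \<bar>g x\<bar>)))"

lemma sobolev_inequality_iff:
  "sobolev_inequality F R i1 i3 N \<theta> \<longleftrightarrow>
    (\<exists>C'>0. \<forall>\<^sub>F r in at_right 0. sobolev_bound F R i1 i3 N r (C' * \<theta> r))"
  unfolding sobolev_inequality_def sobolev_bound_def ..

lemma sobolev_bound_mono:
  assumes "sobolev_bound F R i1 i3 N r K" "K \<le> K'"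
  shows "sobolev_bound F R i1 i3 N r K'"
proof -
  have "ennreal (K * (LINT x|ball_measure F R i1 i3 r. \<bar>g x\<bar>)) \<le> ennreal (K' * (LINT x|ball_measure F R i1 i3 r. \<bar>g x\<bar>))" for g
    using assms(2) by (intro ennreal_leI mult_right_mono) auto
  then show ?thesis
    using assms(1) unfolding sobolev_bound_def by (meson order_trans)
qed

section \<open>The kernel integral over the central ball\<close>

context orlicz_geometry
begin

text \<open>Half of the room left by a N < 1. The logarithm contributes the exponent a N of r / t
  and the vertical section \<delta>; their sum 1 - \<delta> is still integrable.\<close>

definition \<delta> :: real where "\<delta> = (1 - a * N) / 2"

lemma \<delta>: "0 < \<delta>" "\<delta> < 1" "a * N + \<delta> = 1 - \<delta>"
proof -
  have "0 < a * N" using a N by simp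
  then show "0 < \<delta>" "\<delta> < 1" "a * N + \<delta> = 1 - \<delta>"
    using aN by (auto simp: \<delta>_def field_simps)
qed

text \<open>The vertical section of the cone at gap \<open>t\<close> is larger than \<open>f * t\<close> by a factor up to
  \<open>1 / (t * \<bar>F'\<bar>)\<close>. Interpolating between the two lower bounds for the distance makes the section
  integral of the kernel cost only the power \<open>\<delta>\<close> of this factor, which the gap \<open>1 - a * N\<close> absorbs.\<close>

definition slice_weight :: "real \<Rightarrow> real \<Rightarrow> real \<Rightarrow> real" where
  "slice_weight r y t = (log_const * (r * p r) * (r / t) powr a) powr N / vol_const *
    ((f y * min t (1 / p y)) powr (- \<delta>) * height_const powr (1 - \<delta>))"

definition cone_height :: "real \<Rightarrow> real" where "cone_height y = height_const * (f y / p y)"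

lemma slice_weight_nonneg: "0 \<le> slice_weight r y t"
  using vol_const_pos by (auto simp: slice_weight_def intro!: mult_nonneg_nonneg divide_nonneg_nonneg)

text \<open>The reciprocal of the maximum is split into its powers -\<delta> and \<delta> - 1; both
  are decreasing, so each may be evaluated at a different entry.\<close>

lemma max_interpolate:
  fixes A B :: real
  assumes "0 < A" "0 < B"
  shows "1 / max A B \<le> A powr (- \<delta>) * B powr (\<delta> - 1)"
proof -
  let ?M = "max A B"
  have M: "0 < ?M" using assms by (simp add: less_max_iff_disj)
  have "1 / ?M = ?M powr (- \<delta>) * ?M powr (\<delta> - 1)"
    using M unfolding powr_add[symmetric] by (simp add: powr_minus_divide)
  also have "\<dots> \<le> A powr (- \<delta>) * B powr (\<delta> - 1)"
    using assms \<delta> by (intro mult_mono powr_mono2') auto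
  finally show ?thesis .
qed

lemma center_ball_measure:
  assumes "small r"
  shows "0 < measure lborel (center_ball r)" "emeasure lborel (center_ball r) = ennreal (measure lborel (center_ball r))"
    "measure lborel (center_ball r) \<le> (2 * r) ^ CARD('n) * f r"
proof -
  note r = smallD[OF assms]
  have "0 \<in> center_ball r"
    using control_dist_horizontal[of 0 0] r R_pos
    by (auto simp: center_ball_def mem_dball strip_def mid_norm_def intro: le_less_trans)
  moreover have "open (center_ball r)" using open_ball by (simp add: center_ball_def)
  ultimately have "\<not> negligible (center_ball r)" by (intro open_not_negligible) auto
  then have "emeasure lborel (center_ball r) \<noteq> 0"
    unfolding negligible_iff_null_sets center_ball_def by (auto simp: null_sets_def)
  moreover have fin: "emeasure lborel (center_ball r) < \<infinity>"
    unfolding center_ball_def using r by (intro emeasure_ball_finite) auto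
  then show eq: "emeasure lborel (center_ball r) = ennreal (measure lborel (center_ball r))"
    by (intro emeasure_eq_ennreal_measure) auto
  ultimately show "0 < measure lborel (center_ball r)" by (simp add: zero_less_measure_iff)
  show "measure lborel (center_ball r) \<le> (2 * r) ^ CARD('n) * f r"
    unfolding center_ball_def using measure_ball_le[of r 0] r by simp
qed

text \<open>Two bounds on the kernel are used at once. \<open>k1\<close> keeps the vertical gap and
  goes into the linear factor of \<open>Phi N\<close>; the coarser \<open>k2\<close> ignores the
  vertical gap and goes into the logarithm, where only orders of magnitude matter.\<close>

lemma Phi_kernel_le:
  assumes r: "small r" and x: "x \<in> center_ball r" and y: "y \<in> center_ball r" and c: "1 \<le> c"
    and z: "x $ i3 \<noteq> y $ i3" and K: "y \<in> cone r x"
  defines "\<xi> \<equiv> \<bar>x $ i1\<bar>" and "t \<equiv> \<bar>y $ i1 - x $ i1\<bar>"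
  shows "Phi N (kernel F R i1 i3 r x y * measure lborel (center_ball r) / (c * \<phi> r))
    \<le> measure lborel (center_ball r) / (c * \<phi> r) *
      (slice_weight r \<bar>y $ i1\<bar> t * \<bar>x $ i3 - y $ i3\<bar> powr (\<delta> - 1) / sqrt (t * min t (1 / p \<bar>y $ i1\<bar>)) ^ (CARD('n) - 2))"
proof -
  note r' = smallD[OF r]
  let ?n = "CARD('n)" and ?y = "\<bar>y $ i1\<bar>" and ?K = "kernel F R i1 i3 r x y" and ?V = "measure lborel (center_ball r)"
  define \<tau> where "\<tau> = min t (1 / p ?y)"
  define m where "m = sqrt (t * \<tau>)"
  have yr: "?y < r" "\<bar>x $ i1\<bar> < R" using center_ball_nth[OF y, of i1] center_ball_nth[OF x, of i1] i13 r' by auto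
  note b = cone_bounds(1-3)[OF r K yr, folded \<xi>_def t_def]
  have tr: "trunc \<xi> t = \<tau>" using b by (simp add: trunc_def \<tau>_def)
  have y0: "0 < ?y" "t \<le> ?y" using b by auto
  have py: "0 < p ?y" using y0 yr r' by (intro p_pos) auto
  have \<tau>: "0 < \<tau>" "\<tau> \<le> t" using b py by (auto simp: \<tau>_def)
  have m: "\<tau> \<le> m" "0 < m" unfolding m_def
    using \<tau> b by (auto intro!: real_le_rsqrt simp: power2_eq_square mult_right_mono)
  have fy: "0 < f ?y" using y0 by (intro f_pos) auto
  have \<phi>p: "0 < \<phi> r" using r' by (intro \<phi>_pos) auto
  define A where "A = f ?y * \<tau>"
  have A: "0 < A" using fy \<tau> by (simp add: A_def)
  define Z where "Z = \<bar>y $ i3 - x $ i3\<bar> / height_const"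
  have height_const: "0 < height_const" using height_const_ge by simp
  \<comment> \<open>At Z = 0 the power \<open>Z powr (\<delta> - 1)\<close> is 0 by convention and
    the interpolation fails, hence the hypothesis on the vertical coordinates.\<close>
  have Z: "0 < Z" using z height_const by (simp add: Z_def)
  have k: "?K \<le> 1 / (vol_const * max A Z * m ^ (?n - 2))"
    using kernel_le[OF r K yr, folded \<xi>_def t_def] by (simp add: tr A_def Z_def m_def)
  have mx: "0 < max A Z" using A by (simp add: less_max_iff_disj)
  have k1: "?K \<le> (A powr (- \<delta>) * Z powr (\<delta> - 1)) / vol_const / m ^ (?n - 2)"
  proof -
    have "1 / (vol_const * max A Z * m ^ (?n - 2)) = 1 / max A Z / vol_const / m ^ (?n - 2)" by simp
    also have "\<dots> \<le> (A powr (- \<delta>) * Z powr (\<delta> - 1)) / vol_const / m ^ (?n - 2)"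
      using max_interpolate[OF A Z] vol_const_pos m by (intro divide_right_mono) auto
    finally show ?thesis using k by simp
  qed
  have k2: "?K \<le> 1 / (vol_const * f ?y * \<tau> ^ (?n - 1))"
  proof -
    have "\<tau> ^ (?n - 1) = \<tau> * \<tau> ^ (?n - 2)"
      using n_ge_2 by (metis Suc_diff_Suc Suc_1 less_eq_Suc_le numeral_2_eq_2 power_Suc diff_Suc_1)
    also have "f ?y * \<dots> \<le> max A Z * m ^ (?n - 2)"
      unfolding mult.assoc[symmetric] using m \<tau> A by (intro mult_mono power_mono) (auto simp: A_def)
    finally have "vol_const * (f ?y * \<tau> ^ (?n - 1)) \<le> vol_const * (max A Z * m ^ (?n - 2))"
      using vol_const_pos by (intro mult_left_mono) auto
    then have "1 / (vol_const * max A Z * m ^ (?n - 2)) \<le> 1 / (vol_const * f ?y * \<tau> ^ (?n - 1))"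
      using vol_const_pos fy \<tau> mx m by (intro divide_left_mono mult_pos_pos) (auto simp: mult.assoc)
    then show ?thesis using k by simp
  qed
  define L where "L = log_const * (r * p r) * (r / t) powr a"
  have tr2: "0 < t" "t \<le> ?y" using b y0 by auto
  note lg = log_ratio_bound[OF r'(1,5) tr2 yr(1), folded \<tau>_def L_def]
  define T where "T = ?K * ?V / (c * \<phi> r)"
  have V: "0 < ?V" "?V \<le> (2 * r) ^ ?n * f r" using center_ball_measure[OF r] by auto
  have K0: "0 \<le> ?K" by (rule kernel_nonneg)
  have T0: "0 \<le> T" using K0 V c \<phi>p by (simp add: T_def)
  have "Phi N T \<le> T * L powr N"
  proof (cases "T = 0")
    case True then show ?thesis using N by (simp add: Phi_eq)
  next
    case False
    then have Tp: "0 < T" using T0 by simp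
    have "T \<le> ?K * ?V / \<phi> r"
      unfolding T_def using K0 V c \<phi>p by (intro divide_left_mono) auto
    also have "\<dots> \<le> 1 / (vol_const * f ?y * \<tau> ^ (?n - 1)) * ((2 * r) ^ ?n * f r) / \<phi> r"
      using k2 V K0 \<phi>p vol_const_pos fy \<tau> by (intro divide_right_mono mult_mono) auto
    also have "\<dots> = (2 * r) ^ ?n * f r / (vol_const * f ?y * \<tau> ^ (?n - 1) * \<phi> r)" by simp
    finally have "ln T \<le> ln ((2 * r) ^ ?n * f r / (vol_const * f ?y * \<tau> ^ (?n - 1) * \<phi> r))"
      using Tp by (intro ln_mono) auto
    then have "max (2 * N) (ln T) \<le> L" using lg by simp
    then have "max (2 * N) (ln T) powr N \<le> L powr N" using N by (intro powr_mono2) auto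
    then show ?thesis using T0 N by (simp add: Phi_eq mult_left_mono)
  qed
  also have "T * L powr N = ?V / (c * \<phi> r) * (?K * L powr N)" by (simp add: T_def)
  also have "\<dots> \<le> ?V / (c * \<phi> r) * ((A powr (- \<delta>) * Z powr (\<delta> - 1)) / vol_const / m ^ (?n - 2) * L powr N)"
    using k1 V c \<phi>p by (intro mult_left_mono mult_right_mono) auto
  also have "Z powr (\<delta> - 1) = \<bar>x $ i3 - y $ i3\<bar> powr (\<delta> - 1) * height_const powr (1 - \<delta>)"
    using height_const by (simp add: Z_def powr_divide abs_minus_commute powr_minus_divide[of height_const "1 - \<delta>", simplified])
  also have "(A powr (- \<delta>) * (\<bar>x $ i3 - y $ i3\<bar> powr (\<delta> - 1) * height_const powr (1 - \<delta>))) / vol_const / m ^ (?n - 2) * L powr N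
    = slice_weight r ?y t * \<bar>x $ i3 - y $ i3\<bar> powr (\<delta> - 1) / m ^ (?n - 2)"
    by (simp add: slice_weight_def L_def A_def \<tau>_def)
  finally show ?thesis by (simp add: T_def m_def \<tau>_def)
qed

text \<open>Here 2 / \<delta> comes from integrating the vertical singularity, and each middle
  section contributes its length divided by m. The further factor 2 / \<delta> in
  \<open>kernel_const\<close> comes from the integral over the gap.\<close>

definition slice_const :: real where
  "slice_const = log_const powr N / vol_const * (height_const powr (1 - \<delta>) * (height_const / e0) powr \<delta>) * (2 / \<delta>) * (2 * sqrt width_const) ^ (CARD('n) - 2)"

definition kernel_const :: real where "kernel_const = slice_const * (2 / \<delta>)"

lemma slice_const_nonneg: "0 \<le> slice_const"
  using vol_const_pos \<delta> width_const_ge by (auto simp: slice_const_def intro!: mult_nonneg_nonneg divide_nonneg_nonneg)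

lemma kernel_const_nonneg: "0 \<le> kernel_const"
  using slice_const_nonneg \<delta> by (simp add: kernel_const_def)

text \<open>The height of the cone exceeds f \<tau> at most by a multiple of r / t: if \<tau> = 1 /
  p the quotient is constant, and if \<tau> = t then 1 / p is at most y / \<open>e0\<close>. Only
  the power \<delta> of this ratio enters.\<close>

lemma slice_weight_le:
  assumes r: "0 < r" "r < r0" and t: "0 < t" "t < r" and y: "0 < y" "y < r"
  shows "slice_weight r y t * (2 * (cone_height y powr \<delta> / \<delta>)) * (2 * sqrt width_const) ^ (CARD('n) - 2)
    \<le> slice_const * (r * p r) powr N * (r / t) powr (1 - \<delta>)"
proof -
  define \<tau> where "\<tau> = min t (1 / p y)"
  have py: "0 < p y" and pr: "0 < p r" using r y r0 by (auto intro!: p_pos)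
  have \<tau>: "0 < \<tau>" using t py by (simp add: \<tau>_def)
  have fy: "0 < f y" using y by (intro f_pos) auto
  have height_const: "0 < height_const" using height_const_ge by simp
  have "cone_height y / (f y * \<tau>) = height_const * (1 / (p y * \<tau>))" using fy y by (simp add: cone_height_def)
  also have "1 / (p y * \<tau>) \<le> r / (e0 * t)"
  proof (cases "t \<le> 1 / p y")
    case True
    have "1 / p y \<le> y / e0" using y r r0 by (intro inverse_p_le) auto
    also have "\<dots> \<le> r / e0" using y e0 by (intro divide_right_mono) auto
    finally have "1 / p y \<le> r / e0" .
    then have "1 / p y / t \<le> r / e0 / t" using t by (intro divide_right_mono) auto
    then show ?thesis using True by (simp add: \<tau>_def)
  next
    case False
    then have 1: "1 / (p y * \<tau>) = 1" using py by (simp add: \<tau>_def)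
    have "e0 * t \<le> 1 * t" using e0 t by (intro mult_right_mono) auto
    then have "e0 * t \<le> r" using t by linarith
    then show ?thesis unfolding 1 using e0 t by simp
  qed
  finally have q: "cone_height y / (f y * \<tau>) \<le> height_const / e0 * (r / t)" using height_const by simp
  have "(f y * \<tau>) powr (- \<delta>) * cone_height y powr \<delta> = (cone_height y / (f y * \<tau>)) powr \<delta>"
  proof -
    have "0 \<le> cone_height y" "0 \<le> f y * \<tau>" using fy \<tau> height_const py by (auto simp: cone_height_def)
    then show ?thesis by (simp add: powr_divide powr_minus_divide)
  qed
  also have "\<dots> \<le> (height_const / e0 * (r / t)) powr \<delta>"
    using q \<delta> fy \<tau> height_const py by (intro powr_mono2) (auto simp: cone_height_def)
  also have "\<dots> = (height_const / e0) powr \<delta> * (r / t) powr \<delta>"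
    using height_const e0 r t by (intro powr_mult) 
  finally have 1: "(f y * \<tau>) powr (- \<delta>) * cone_height y powr \<delta> \<le> (height_const / e0) powr \<delta> * (r / t) powr \<delta>" .
  have 2: "(log_const * (r * p r) * (r / t) powr a) powr N = log_const powr N * (r * p r) powr N * (r / t) powr (a * N)"
    using log_const_pos r pr t by (simp add: powr_mult powr_powr)
  have "slice_weight r y t * (2 * (cone_height y powr \<delta> / \<delta>)) * (2 * sqrt width_const) ^ (CARD('n) - 2)
    = log_const powr N / vol_const * height_const powr (1 - \<delta>) * (2 / \<delta>) * (2 * sqrt width_const) ^ (CARD('n) - 2) * (r * p r) powr N * (r / t) powr (a * N)
      * ((f y * \<tau>) powr (- \<delta>) * cone_height y powr \<delta>)"
    unfolding slice_weight_def 2 \<tau>_def[symmetric] by simp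
  also have "\<dots> \<le> log_const powr N / vol_const * height_const powr (1 - \<delta>) * (2 / \<delta>) * (2 * sqrt width_const) ^ (CARD('n) - 2) * (r * p r) powr N * (r / t) powr (a * N)
      * ((height_const / e0) powr \<delta> * (r / t) powr \<delta>)"
    using 1 vol_const_pos \<delta> width_const_ge by (intro mult_left_mono) (auto intro!: mult_nonneg_nonneg divide_nonneg_nonneg)
  also have "\<dots> = slice_const * (r * p r) powr N * ((r / t) powr (a * N) * (r / t) powr \<delta>)"
    by (simp add: slice_const_def)
  also have "(r / t) powr (a * N) * (r / t) powr \<delta> = (r / t) powr (1 - \<delta>)"
    by (simp add: powr_add[symmetric] \<delta>(3))
  finally show ?thesis .
qed

lemma nn_integral_gap:
  assumes "0 < r"
  shows "(\<integral>\<^sup>+s. ennreal ((r / \<bar>s - y\<bar>) powr (1 - \<delta>)) * indicator {y - r..y + r} s \<partial>lborel) = ennreal (r * (2 / \<delta>))"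
proof -
  have "(\<integral>\<^sup>+s. ennreal ((r / \<bar>s - y\<bar>) powr (1 - \<delta>)) * indicator {y - r..y + r} s \<partial>lborel)
    = (\<integral>\<^sup>+s. ennreal (r powr (1 - \<delta>)) * (ennreal (\<bar>s - y\<bar> powr (\<delta> - 1)) * indicator {y - r..y + r} s) \<partial>lborel)"
  proof (intro nn_integral_cong)
    fix s
    have "(r / \<bar>s - y\<bar>) powr (1 - \<delta>) = r powr (1 - \<delta>) * \<bar>s - y\<bar> powr (\<delta> - 1)"
      using assms powr_minus_divide[of "\<bar>s - y\<bar>" "1 - \<delta>"] by (simp add: powr_divide)
    then show "ennreal ((r / \<bar>s - y\<bar>) powr (1 - \<delta>)) * indicator {y - r..y + r} s
      = ennreal (r powr (1 - \<delta>)) * (ennreal (\<bar>s - y\<bar> powr (\<delta> - 1)) * indicator {y - r..y + r} s)"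
      by (simp add: ennreal_mult mult.assoc)
  qed
  also have "\<dots> = ennreal (r powr (1 - \<delta>)) * ennreal (2 * (r powr \<delta> / \<delta>))"
    using assms \<delta> by (subst nn_integral_cmult) (auto simp: nn_integral_abs_powr)
  also have "\<dots> = ennreal (r * (2 / \<delta>))"
    using assms \<delta> by (simp add: ennreal_mult[symmetric] powr_add[symmetric] flip: mult.assoc)
  finally show ?thesis .
qed

lemma Phi_kernel_integral:
  assumes r: "small r" and y: "y \<in> center_ball r" and c: "1 \<le> c" "kernel_const / C \<le> c"
  shows "(\<integral>\<^sup>+x. ennreal (Phi N (kernel F R i1 i3 r x y * measure lborel (center_ball r) / (c * \<phi> r))) * indicator (center_ball r) x \<partial>lborel)
    \<le> emeasure lborel (center_ball r)"
proof -
  note r' = smallD[OF r]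
  let ?n = "CARD('n)" and ?V = "measure lborel (center_ball r)" and ?y = "\<bar>y $ i1\<bar>"
  have V: "0 < ?V" "emeasure lborel (center_ball r) = ennreal ?V" using center_ball_measure[OF r] by auto
  have \<phi>p: "0 < \<phi> r" using r' by (intro \<phi>_pos) auto
  have yr: "?y < r" using center_ball_nth[OF y, of i1] i13 by simp
  have width_const: "0 \<le> width_const" using width_const_ge by simp
  define t where "t s = \<bar>y $ i1 - s\<bar>" for s
  define m where "m s = sqrt (t s * min (t s) (1 / p ?y))" for s
  define J where "J s \<longleftrightarrow> 0 < t s \<and> t s < r \<and> 0 < ?y" for s
  \<comment> \<open>At fixed first coordinate s the majorant is a product over the other
    coordinates. The vertical factor carries the weight and the cutoff J; a middle factor is 1 / m
    on an interval of half-width \<open>sqrt width_const * m s\<close>, so its integral does not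
    depend on s.\<close>
  define g where "g i s u =
    (if i = i3 then ennreal (if J s then slice_weight r ?y (t s) else 0) * (ennreal (\<bar>u - y $ i3\<bar> powr (\<delta> - 1)) * indicator {y $ i3 - cone_height ?y..y $ i3 + cone_height ?y} u)
     else ennreal (1 / m s) * indicator {u. \<bar>u - y $ i\<bar> \<le> sqrt width_const * m s} u)" for i s u
  have [measurable]: "t \<in> borel_measurable borel" "m \<in> borel_measurable borel"
    unfolding t_def[abs_def] m_def[abs_def] by measurable
  have [measurable]: "Measurable.pred borel J" unfolding J_def[abs_def] by measurable
  have gm: "(\<lambda>(s, u). g i s u) \<in> borel_measurable (borel \<Otimes>\<^sub>M borel)" for i
    unfolding g_def slice_weight_def by (cases "i = i3") (simp_all add: indicator_def, measurable)
  \<comment> \<open>The exceptional null set is the one excluded in \<open>Phi_kernel_le\<close>,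
    where the vertical coordinates of x and y agree.\<close>
  have point: "AE x in lborel. ennreal (Phi N (kernel F R i1 i3 r x y * ?V / (c * \<phi> r))) * indicator (center_ball r) x
      \<le> ennreal (?V / (c * \<phi> r)) * (\<Prod>i\<in>UNIV - {i1}. g i (x $ i1) (x $ i))"
    using AE_component_neq[of i3 "y $ i3"]
  proof eventually_elim
    case (elim x)
    show ?case
    proof (cases "x \<in> center_ball r \<and> y \<in> cone r x")
      case False
      then have "Phi N (kernel F R i1 i3 r x y * ?V / (c * \<phi> r)) = 0 \<or> x \<notin> center_ball r"
        using N by (auto simp: kernel_def Phi_eq)
      then show ?thesis by auto
    next
      case True
      have xR: "\<bar>x $ i1\<bar> < R" using center_ball_nth[of x r i1] True i13 r' by simp
      note b = cone_bounds[OF r _ yr xR] 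
      have b1: "0 < \<bar>x $ i1\<bar>" "0 < t (x $ i1)" "\<bar>x $ i1\<bar> + t (x $ i1) = ?y"
        using b(1-3) True by (auto simp: t_def)
      have J: "J (x $ i1)" using b1 yr by (auto simp: J_def)
      have tr: "trunc \<bar>x $ i1\<bar> (t (x $ i1)) = min (t (x $ i1)) (1 / p ?y)" using b1(3) by (rule trunc_eq)
      have py: "0 < p ?y" using b1 yr r' by (intro p_pos) auto
      have mp: "0 < m (x $ i1)" using b1 py by (simp add: m_def)
      have "(mid (y - x))\<^sup>2 \<le> width_const * (t (x $ i1) * min (t (x $ i1)) (1 / p ?y))"
        using b(4) True by (simp add: t_def[symmetric] tr)
      then have "sqrt ((mid (y - x))\<^sup>2) \<le> sqrt (width_const * (t (x $ i1) * min (t (x $ i1)) (1 / p ?y)))"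
        by (rule real_sqrt_le_mono)
      then have M: "mid (y - x) \<le> sqrt width_const * m (x $ i1)"
        using mid_norm_nonneg[of i1 i3 "y - x"] by (simp add: m_def real_sqrt_mult)
      have "\<bar>x $ i3 - y $ i3\<bar> \<le> cone_height ?y"
        using b(5) True by (simp add: cone_height_def abs_minus_commute)
      then have g3: "g i3 (x $ i1) (x $ i3) = ennreal (slice_weight r ?y (t (x $ i1)) * \<bar>x $ i3 - y $ i3\<bar> powr (\<delta> - 1))"
        using J by (auto simp: g_def indicator_def abs_le_iff ennreal_mult' slice_weight_nonneg)
      have gi: "g i (x $ i1) (x $ i) = ennreal (1 / m (x $ i1))" if "i \<noteq> i1" "i \<noteq> i3" for i
        using component_le_mid_norm[OF that, of "y - x"] M that by (auto simp: g_def indicator_def abs_minus_commute)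
      have "(\<Prod>i\<in>UNIV - {i1}. g i (x $ i1) (x $ i)) = g i3 (x $ i1) (x $ i3) * (\<Prod>i\<in>UNIV - {i1} - {i3}. g i (x $ i1) (x $ i))"
        using i13 by (subst prod.remove[of _ i3]) auto
      also have "(\<Prod>i\<in>UNIV - {i1} - {i3}. g i (x $ i1) (x $ i)) = (\<Prod>i\<in>UNIV - {i1} - {i3}. ennreal (1 / m (x $ i1)))"
        by (intro prod.cong gi) auto
      also have "\<dots> = ennreal ((1 / m (x $ i1)) ^ (?n - 2))"
        using i13 mp by (simp add: card_Diff_singleton_if numeral_2_eq_2 ennreal_power)
      finally have pg: "(\<Prod>i\<in>UNIV - {i1}. g i (x $ i1) (x $ i))
          = ennreal (slice_weight r ?y (t (x $ i1)) * \<bar>x $ i3 - y $ i3\<bar> powr (\<delta> - 1) / m (x $ i1) ^ (?n - 2))"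
        unfolding g3 using mp slice_weight_nonneg by (simp add: ennreal_mult[symmetric] power_one_over)
      have "Phi N (kernel F R i1 i3 r x y * ?V / (c * \<phi> r))
        \<le> ?V / (c * \<phi> r) * (slice_weight r ?y (t (x $ i1)) * \<bar>x $ i3 - y $ i3\<bar> powr (\<delta> - 1) / m (x $ i1) ^ (?n - 2))"
        using Phi_kernel_le[OF r _ y c(1) elim] True by (simp add: t_def m_def)
      then show ?thesis
        unfolding pg using True V c \<phi>p mp slice_weight_nonneg
        by (subst ennreal_mult[symmetric]) (auto intro!: ennreal_leI mult_nonneg_nonneg divide_nonneg_nonneg)
    qed
  qed
  have inner: "(\<Prod>i\<in>UNIV - {i1}. \<integral>\<^sup>+u. g i s u \<partial>lborel)
      \<le> ennreal (slice_const * (r * p r) powr N) * (ennreal ((r / \<bar>s - y $ i1\<bar>) powr (1 - \<delta>)) * indicator {y $ i1 - r..y $ i1 + r} s)" for s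
  proof (cases "J s")
    case False
    then have "(\<integral>\<^sup>+u. g i3 s u \<partial>lborel) = 0" by (simp add: g_def)
    then have z: "(\<Prod>i\<in>UNIV - {i1}. \<integral>\<^sup>+u. g i s u \<partial>lborel) = 0"
      using i13 by (intro prod_zero) auto
    show ?thesis unfolding z by simp
  next
    case True
    then have J: "0 < t s" "t s < r" "0 < ?y" by (auto simp: J_def)
    have py: "0 < p ?y" using J yr r' by (intro p_pos) auto
    have mp: "0 < m s" using J py by (simp add: m_def)
    have H0: "0 \<le> cone_height ?y" using py height_const_ge f_nonneg by (simp add: cone_height_def)
    have i3: "(\<integral>\<^sup>+u. g i3 s u \<partial>lborel) = ennreal (slice_weight r ?y (t s) * (2 * (cone_height ?y powr \<delta> / \<delta>)))"
    proof -
      have "(\<integral>\<^sup>+u. g i3 s u \<partial>lborel) = ennreal (slice_weight r ?y (t s)) * ennreal (2 * (cone_height ?y powr \<delta> / \<delta>))"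
        using True \<delta> H0 by (simp add: g_def nn_integral_cmult nn_integral_abs_powr)
      also have "\<dots> = ennreal (slice_weight r ?y (t s) * (2 * (cone_height ?y powr \<delta> / \<delta>)))"
        using \<delta> by (intro ennreal_mult[symmetric] slice_weight_nonneg) auto
      finally show ?thesis .
    qed
    have ii: "(\<integral>\<^sup>+u. g i s u \<partial>lborel) = ennreal (2 * sqrt width_const)" if "i \<noteq> i3" for i
    proof -
      define q where "q = sqrt width_const * m s"
      have q: "0 \<le> q" using width_const mp by (simp add: q_def)
      have set_eq: "{u. \<bar>u - y $ i\<bar> \<le> q} = {y $ i - q..y $ i + q}"
        by (auto simp: abs_le_iff)
      have "(\<integral>\<^sup>+u. g i s u \<partial>lborel) = (\<integral>\<^sup>+u. ennreal (1 / m s) * indicator {y $ i - q..y $ i + q} u \<partial>lborel)"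
        using that by (simp only: g_def if_False set_eq q_def[symmetric])
      also have "\<dots> = ennreal (1 / m s) * emeasure lborel {y $ i - q..y $ i + q}"
        by (rule nn_integral_cmult_indicator) simp
      also have "emeasure lborel {y $ i - q..y $ i + q} = ennreal (2 * q)"
        using q by simp
      also have "ennreal (1 / m s) * ennreal (2 * q) = ennreal (1 / m s * (2 * q))"
        using mp q by (intro ennreal_mult[symmetric]) auto
      also have "1 / m s * (2 * q) = 2 * sqrt width_const" using mp by (simp add: q_def)
      finally show ?thesis .
    qed
    have "(\<Prod>i\<in>UNIV - {i1}. \<integral>\<^sup>+u. g i s u \<partial>lborel)
        = (\<integral>\<^sup>+u. g i3 s u \<partial>lborel) * (\<Prod>i\<in>UNIV - {i1} - {i3}. \<integral>\<^sup>+u. g i s u \<partial>lborel)"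
      using i13 by (subst prod.remove[of _ i3]) auto
    also have "(\<Prod>i\<in>UNIV - {i1} - {i3}. \<integral>\<^sup>+u. g i s u \<partial>lborel) = (\<Prod>i\<in>UNIV - {i1} - {i3}. ennreal (2 * sqrt width_const))"
      by (intro prod.cong ii) auto
    also have "\<dots> = ennreal ((2 * sqrt width_const) ^ (?n - 2))"
      using i13 width_const by (simp add: card_Diff_singleton_if numeral_2_eq_2 ennreal_power)
    also have "(\<integral>\<^sup>+u. g i3 s u \<partial>lborel) * ennreal ((2 * sqrt width_const) ^ (?n - 2))
        = ennreal (slice_weight r ?y (t s) * (2 * (cone_height ?y powr \<delta> / \<delta>)) * (2 * sqrt width_const) ^ (?n - 2))"
      unfolding i3 using width_const \<delta> slice_weight_nonneg[of r ?y "t s"] by (intro ennreal_mult[symmetric]) auto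
    also have "\<dots> \<le> ennreal (slice_const * (r * p r) powr N * (r / t s) powr (1 - \<delta>))"
      using slice_weight_le[OF r'(1,5) J(1,2,3) yr] by (rule ennreal_leI)
    also have "\<dots> = ennreal (slice_const * (r * p r) powr N) * (ennreal ((r / \<bar>s - y $ i1\<bar>) powr (1 - \<delta>)) * indicator {y $ i1 - r..y $ i1 + r} s)"
      using J slice_const_nonneg by (auto simp: t_def ennreal_mult abs_minus_commute indicator_def abs_less_iff)
    finally show ?thesis .
  qed
  have "(\<integral>\<^sup>+x. ennreal (Phi N (kernel F R i1 i3 r x y * ?V / (c * \<phi> r))) * indicator (center_ball r) x \<partial>lborel)
    \<le> (\<integral>\<^sup>+x. ennreal (?V / (c * \<phi> r)) * (\<Prod>i\<in>UNIV - {i1}. g i (x $ i1) (x $ i)) \<partial>lborel)"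
    by (intro nn_integral_mono_AE point)
  also have "\<dots> = ennreal (?V / (c * \<phi> r)) * (\<integral>\<^sup>+x. (\<Prod>i\<in>UNIV - {i1}. g i (x $ i1) (x $ i)) \<partial>lborel)"
  proof (intro nn_integral_cmult borel_measurable_prod_ennreal)
    fix i
    have "(\<lambda>x::real^'n. (\<lambda>(s, u). g i s u) (x $ i1, x $ i)) \<in> borel_measurable lborel"
      by (rule measurable_compose[OF _ gm]) measurable
    then show "(\<lambda>x::real^'n. g i (x $ i1) (x $ i)) \<in> borel_measurable lborel" by simp
  qed
  also have "(\<integral>\<^sup>+x. (\<Prod>i\<in>UNIV - {i1}. g i (x $ i1) (x $ i)) \<partial>lborel)
    = (\<integral>\<^sup>+s. (\<Prod>i\<in>UNIV - {i1}. \<integral>\<^sup>+u. g i s u \<partial>lborel) \<partial>lborel)"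
    by (rule nn_integral_prod_fibers[OF gm])
  also have "\<dots> \<le> (\<integral>\<^sup>+s. ennreal (slice_const * (r * p r) powr N) * (ennreal ((r / \<bar>s - y $ i1\<bar>) powr (1 - \<delta>)) * indicator {y $ i1 - r..y $ i1 + r} s) \<partial>lborel)"
    by (intro nn_integral_mono inner)
  also have "\<dots> = ennreal (slice_const * (r * p r) powr N) * ennreal (r * (2 / \<delta>))"
    using r' by (subst nn_integral_cmult) (auto simp: nn_integral_gap)
  \<comment> \<open>The factor r from the gap integral and the N-th power of r p(r) from the
    logarithm combine to \<phi>, which is how this weight arises.\<close>
  also have "\<dots> = ennreal (kernel_const / C * \<phi> r)"
    using slice_const_nonneg r' C \<delta> by (subst ennreal_mult[symmetric]) (auto simp: kernel_const_def \<phi>_eq)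
  also have "ennreal (?V / (c * \<phi> r)) * ennreal (kernel_const / C * \<phi> r) \<le> ennreal ?V"
  proof -
    have "?V / (c * \<phi> r) * (kernel_const / C * \<phi> r) = ?V * ((kernel_const / C) / c)" using \<phi>p by simp
    also have "(kernel_const / C) / c \<le> 1" using c by (subst divide_le_eq_1_pos) auto
    then have "?V * ((kernel_const / C) / c) \<le> ?V * 1" using V by (intro mult_left_mono) auto
    finally show ?thesis using V c \<phi>p kernel_const_nonneg C by (simp add: ennreal_mult[symmetric] ennreal_leI)
  qed
  finally show ?thesis using V by (simp add: mult_left_mono)
qed

theorem sobolev: "sobolev_inequality F R i1 i3 N \<phi>"
proof -
  \<comment> \<open>The first entry keeps c out of the logarithm, the second absorbs the constant of
    the integral.\<close>
  define c where "c = max 1 (kernel_const / C)"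
  have c: "1 \<le> c" "kernel_const / C \<le> c" by (auto simp: c_def)
  have "eventually (\<lambda>r. r \<in> {0<..<r0 / (dist_const + 2)}) (at_right 0)"
    using r0 dist_const_ge by (intro eventually_at_right_real) auto
  then have ev: "eventually small (at_right 0)"
    by eventually_elim (use dist_const_ge in \<open>auto simp: small_def field_simps\<close>)
  have main: "sobolev_bound F R i1 i3 N r (2 * c * \<phi> r)" if r: "small r" for r
    unfolding sobolev_bound_def
  proof (intro allI impI)
    fix g :: "real^'n \<Rightarrow> real" assume g: "integrable (ball_measure F R i1 i3 r) g"
    note r' = smallD[OF r]
    note bm = center_ball_measure[OF r]
    have \<phi>p: "0 < \<phi> r" using r' by (intro \<phi>_pos) auto
    have k: "center_ball r \<in> sets borel" "0 < emeasure lborel (center_ball r)" "emeasure lborel (center_ball r) < \<infinity>"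
      using bm by (auto simp: center_ball_def)
    have g': "integrable (uniform_measure lebesgue (center_ball r)) g" using g by (simp add: ball_measure_def center_ball_def)
    have T: "T_op F R i1 i3 r g = (\<lambda>x. LINT y:center_ball r|lebesgue. kernel F R i1 i3 r x y * g y)"
      by (simp add: T_op_def center_ball_def fun_eq_iff)
    have cp: "0 < c * \<phi> r" using c \<phi>p by simp
    note kb = kernel_orlicz_bound[OF k kernel_measurable[OF r] kernel_nonneg _ cp Phi_kernel_integral[OF r _ c] g']
    show "(AE x in ball_measure F R i1 i3 r.
           set_integrable lebesgue (control_ball F R i1 i3 0 r) (\<lambda>y. kernel F R i1 i3 r x y * g y)) \<and>
        T_op F R i1 i3 r g \<in> borel_measurable (ball_measure F R i1 i3 r) \<and>
        luxemburg_norm (Phi N) (ball_measure F R i1 i3 r) (T_op F R i1 i3 r g)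
          \<le> ennreal (2 * c * \<phi> r * (LINT x|ball_measure F R i1 i3 r. \<bar>g x\<bar>))"
      unfolding T ball_measure_def center_ball_def[symmetric] using kb[OF less_imp_le[OF N]]
      unfolding mult.assoc by blast
  qed
  have "\<forall>\<^sub>F r in at_right 0. sobolev_bound F R i1 i3 N r (2 * c * \<phi> r)"
    using ev by eventually_elim (rule main)
  moreover have "0 < 2 * c" using c by simp
  ultimately show ?thesis unfolding sobolev_inequality_iff by blast
qed

end

lemma sobolev_inequality_mono:
  assumes S: "sobolev_inequality F R i1 i3 N \<theta>" and K: "0 < K"
    and le: "eventually (\<lambda>r. \<theta> r \<le> K * \<theta>' r) (at_right 0)"
  shows "sobolev_inequality F R i1 i3 N \<theta>'"
proof -
  obtain C' where C': "0 < C'" and ev: "\<forall>\<^sub>F r in at_right 0. sobolev_bound F R i1 i3 N r (C' * \<theta> r)"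
    using S unfolding sobolev_inequality_iff by blast
  have "\<forall>\<^sub>F r in at_right 0. sobolev_bound F R i1 i3 N r (C' * K * \<theta>' r)"
    using ev le
  proof eventually_elim
    case (elim r)
    have "C' * \<theta> r \<le> C' * (K * \<theta>' r)" using elim(2) C' by (intro mult_left_mono) auto
    then show ?case
      using sobolev_bound_mono[OF elim(1)] by (simp add: mult.assoc)
  qed
  moreover have "0 < C' * K" using C' K by simp
  ultimately show ?thesis unfolding sobolev_inequality_iff by blast
qed

text \<open>The hypothesis on F'' says precisely that -F' times x^(1+a) has a nonnegative
  derivative.\<close>

lemma derivative_growth:
  fixes F :: "real \<Rightarrow> real"
  assumes d: "\<And>x. 0 < x \<Longrightarrow> x < r0 \<Longrightarrow> deriv F differentiable (at x)"
    and le: "\<And>x. 0 < x \<Longrightarrow> x < r0 \<Longrightarrow> deriv (deriv F) x \<le> (1 + a) * (- deriv F x / x)"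
    and uv: "0 < u" "u \<le> v" "v < r0"
  shows "- deriv F u * u powr (1 + a) \<le> - deriv F v * v powr (1 + a)"
proof (rule DERIV_nonneg_imp_nondecreasing[OF uv(2), where f = "\<lambda>x. - deriv F x * x powr (1 + a)"])
  fix x assume x: "u \<le> x" "x \<le> v"
  then have x0: "0 < x" "x < r0" using uv by auto
  have "(deriv F has_real_derivative deriv (deriv F) x) (at x)"
    using d[OF x0] by (simp add: DERIV_deriv_iff_real_differentiable)
  then have D: "((\<lambda>x. - deriv F x * x powr (1 + a)) has_real_derivative
      - deriv (deriv F) x * x powr (1 + a) + - deriv F x * ((1 + a) * x powr (1 + a - 1))) (at x)"
    using x0 by (auto intro!: derivative_eq_intros simp: field_simps)
  have "deriv (deriv F) x * x powr (1 + a) \<le> (1 + a) * (- deriv F x / x) * x powr (1 + a)"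
    using le[OF x0] by (intro mult_right_mono) auto
  also have "\<dots> = - deriv F x * ((1 + a) * x powr (1 + a - 1))"
    using x0 by (simp add: powr_add)
  finally have "0 \<le> - deriv (deriv F) x * x powr (1 + a) + - deriv F x * ((1 + a) * x powr (1 + a - 1))"
    by simp
  with D show "\<exists>D. ((\<lambda>x. - deriv F x * x powr (1 + a)) has_real_derivative D) (at x) \<and> 0 \<le> D"
    by blast
qed

theorem proposition70:
  fixes F \<phi> :: "real \<Rightarrow> real" and R N C \<epsilon> r0 :: real and i1 i3 :: "'n::finite"
  assumes "i1 \<noteq> i3"
    and "N > 1"
    and "R > 0"
    and "geometric_structure R F"
    and "C > 0"
    and "\<phi> = (\<lambda>r. C * \<bar>deriv F r\<bar> powr N * r powr (N + 1))"
    and "(\<phi> \<longlongrightarrow> 0) (at_right 0)"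
    and "\<epsilon> > 0"
    and "0 < r0" and "r0 < R"
    and "\<forall>r\<in>{0<..<r0}. deriv (deriv F) r \<le> (1 + (1 - \<epsilon>) / N) * (\<bar>deriv F r\<bar> / r)"
  shows "sobolev_inequality F R i1 i3 N \<phi> \<and>
    (bdd_above (\<phi> ` {0<..<r0}) \<longrightarrow>
      sobolev_inequality F R i1 i3 N (\<lambda>_. SUP s\<in>{0<..<r0}. \<phi> s)) \<and>
    (\<forall>\<epsilon>'>0. \<forall>C1>0.
      (\<forall>r\<in>{0<..<r0}. \<bar>deriv F r\<bar> \<le> C1 * (1 / r) powr (1 + (1 - \<epsilon>') / N)) \<longrightarrow>
        bdd_above (\<phi> ` {0<..<r0}) \<and>
        sobolev_inequality F R i1 i3 N (\<lambda>_. SUP s\<in>{0<..<r0}. \<phi> s) \<and>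
        sobolev_inequality F R i1 i3 N (\<lambda>_. C1))"
proof -
  have G: "\<And>x. 0 < x \<Longrightarrow> x < R \<Longrightarrow> F differentiable (at x) \<and> deriv F differentiable (at x)"
      "filterlim F at_top (at_right 0)"
      "\<And>x. 0 < x \<Longrightarrow> x < R \<Longrightarrow> deriv F x < 0 \<and> deriv (deriv F) x > 0"
    using assms(4) by (auto simp: geometric_structure_def)
  have "\<exists>\<epsilon>. 0 < \<epsilon> \<and> \<epsilon> < 1 \<and> (\<forall>x\<in>{0<..<R}. 1 / (- x * deriv F x) \<le> 1 / \<epsilon>)"
    using assms(4) unfolding geometric_structure_def by blast
  then obtain e0 where e0: "0 < e0" "e0 < 1" "\<And>x. x \<in> {0<..<R} \<Longrightarrow> 1 / (- x * deriv F x) \<le> 1 / e0"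
    by blast
  have e0': "e0 \<le> x * (- deriv F x)" if "0 < x" "x < R" for x
  proof -
    have "0 < x * (- deriv F x)" using G(3)[OF that] that by (intro mult_pos_pos) auto
    then show ?thesis using e0(3)[of x] that e0(1) by (simp add: field_simps)
  qed
  \<comment> \<open>For \<epsilon> >= 1 the exponent \<open>(1 - \<epsilon>) / N\<close> would not
    be positive. A smaller \<epsilon> only weakens the bound on F'' and keeps a in (0, 1).\<close>
  define \<epsilon>1 where "\<epsilon>1 = min \<epsilon> (1 / 2)"
  define a where "a = (1 - \<epsilon>1) / N"
  have \<epsilon>1: "0 < \<epsilon>1" "\<epsilon>1 \<le> 1 / 2" "\<epsilon>1 \<le> \<epsilon>" using assms(8) by (auto simp: \<epsilon>1_def)
  have a: "0 < a" "a * N < 1" "a < 1" using \<epsilon>1 assms(2) by (auto simp: a_def field_simps)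
  have growth: "deriv (deriv F) x \<le> (1 + a) * (- deriv F x / x)" if "0 < x" "x < r0" for x
  proof -
    have neg: "\<bar>deriv F x\<bar> = - deriv F x" "0 < - deriv F x" using G(3)[of x] that assms(10) by auto
    have nn: "0 \<le> - deriv F x / x" using neg(2) that by (intro divide_nonneg_nonneg) auto
    have "deriv (deriv F) x \<le> (1 + (1 - \<epsilon>) / N) * (\<bar>deriv F x\<bar> / x)"
      using assms(11) that by auto
    also have "\<dots> = (1 + (1 - \<epsilon>) / N) * (- deriv F x / x)" unfolding neg(1) by simp
    also have "\<dots> \<le> (1 + a) * (- deriv F x / x)"
      using \<epsilon>1 assms(2) unfolding a_def
      by (intro mult_right_mono[OF _ nn] add_left_mono divide_right_mono) auto
    finally show ?thesis .
  qed
  interpret orlicz_geometry F R r0 e0 a i1 i3 N C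
  proof unfold_locales
    show "- deriv F u * u powr (1 + a) \<le> - deriv F v * v powr (1 + a)"
      if "0 < u" "u \<le> v" "v < r0" for u v
    proof (rule derivative_growth[OF _ growth that])
      show "deriv F differentiable (at x)" if "0 < x" "x < r0" for x
        using G(1)[of x] that assms(10) by auto
    qed
  qed (use assms G e0 e0' a in auto)
  have ev: "eventually (\<lambda>r. r \<in> {0<..<r0}) (at_right 0)"
    using assms(9) by (rule eventually_at_right_real)
  have \<phi>: "sobolev_inequality F R i1 i3 N \<phi>"
  proof (rule sobolev_inequality_mono[OF sobolev, of 1])
    \<comment> \<open>The two weights are written with p and with the absolute value of F'; they
      agree on (0, R).\<close>
    show "eventually (\<lambda>r. local.\<phi> r \<le> 1 * \<phi> r) (at_right 0)"
      using ev by eventually_elim (use assms(6,10) abs_deriv_F in \<open>auto simp: \<phi>_def\<close>)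
  qed simp
  have sup: "sobolev_inequality F R i1 i3 N (\<lambda>_. SUP s\<in>{0<..<r0}. \<phi> s)" if "bdd_above (\<phi> ` {0<..<r0})"
  proof (rule sobolev_inequality_mono[OF \<phi>, of 1])
    show "eventually (\<lambda>r. \<phi> r \<le> 1 * (SUP s\<in>{0<..<r0}. \<phi> s)) (at_right 0)"
      using ev by eventually_elim (use that in \<open>auto intro: cSUP_upper\<close>)
  qed simp
  \<comment> \<open>The assumed power of 1 / r, raised to N, is r^(-(N + 1 - \<epsilon>')); against
    r^(N + 1) it leaves r^\<epsilon>', which is bounded on (0, \<open>r0\<close>).\<close>
  have power: "\<phi> r \<le> C * C1 powr N * r0 powr \<epsilon>'"
    if \<epsilon>': "0 < \<epsilon>'" and C1: "0 < C1" and r: "r \<in> {0<..<r0}"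
      and le: "\<forall>r\<in>{0<..<r0}. \<bar>deriv F r\<bar> \<le> C1 * (1 / r) powr (1 + (1 - \<epsilon>') / N)" for \<epsilon>' C1 r
  proof -
    have r0: "0 < r" "r < r0" using r by auto
    have "\<phi> r = C * \<bar>deriv F r\<bar> powr N * r powr (N + 1)" using assms(6) by simp
    also have "\<dots> \<le> C * (C1 * (1 / r) powr (1 + (1 - \<epsilon>') / N)) powr N * r powr (N + 1)"
      using le r assms(2,5) by (intro mult_right_mono mult_left_mono powr_mono2) auto
    also have "(C1 * (1 / r) powr (1 + (1 - \<epsilon>') / N)) powr N = C1 powr N * (1 / r) powr (N + (1 - \<epsilon>'))"
      using C1 r0 assms(2) by (simp add: powr_mult powr_powr distrib_right)
    also have "(1 / r) powr (N + (1 - \<epsilon>')) = r powr (- (N + (1 - \<epsilon>')))"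
      unfolding powr_divide powr_minus_divide by simp
    also have "C * (C1 powr N * r powr (- (N + (1 - \<epsilon>')))) * r powr (N + 1)
        = C * C1 powr N * (r powr (- (N + (1 - \<epsilon>'))) * r powr (N + 1))" by simp
    also have "r powr (- (N + (1 - \<epsilon>'))) * r powr (N + 1) = r powr \<epsilon>'"
      by (simp only: powr_add[symmetric]) simp
    also have "C * C1 powr N * r powr \<epsilon>' \<le> C * C1 powr N * r0 powr \<epsilon>'"
      using r0 \<epsilon>' assms(5) by (intro mult_left_mono powr_mono2) auto
    finally show ?thesis .
  qed
  show ?thesis
  proof (intro conjI allI impI \<phi> sup)
    fix \<epsilon>' C1 :: real
    assume h: "0 < \<epsilon>'" "0 < C1" "\<forall>r\<in>{0<..<r0}. \<bar>deriv F r\<bar> \<le> C1 * (1 / r) powr (1 + (1 - \<epsilon>') / N)"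
    note pw = power[OF h(1,2) _ h(3)]
    show bdd: "bdd_above (\<phi> ` {0<..<r0})" by (rule bdd_aboveI2[OF pw])
    then show "bdd_above (\<phi> ` {0<..<r0})" .
    show "sobolev_inequality F R i1 i3 N (\<lambda>_. C1)"
    \<comment> \<open>The factor is the bound on \<phi> divided by \<open>C1\<close>, so that its
      product with the constant weight \<open>C1\<close> is that bound.\<close>
    proof (rule sobolev_inequality_mono[OF \<phi>, of "C * C1 powr N * r0 powr \<epsilon>' / C1"])
      show "0 < C * C1 powr N * r0 powr \<epsilon>' / C1" using h(2) assms(5,9) by simp
      show "eventually (\<lambda>r. \<phi> r \<le> C * C1 powr N * r0 powr \<epsilon>' / C1 * C1) (at_right 0)"
        using ev by eventually_elim (use pw h(2) in auto)
    qed
  qed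
qed

end
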